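(* Let $\alpha,\alpha',\beta,\beta',\gamma,\rho,a\in\mathbb{C}$ with $\operatorname{Re}(\gamma)>0$ and $a\ne0$, and let $\mu$ be a real number, such that $\mu>0$ and $\operatorname{Re}(\rho)>\max\{0,\operatorname{Re}(-\alpha+\beta),\operatorname{Re}(-\alpha-\alpha'-\beta'+\gamma)\}$. Then for every $x>0$, $$\left(\mathcal{D}_{0+}^{\alpha,\alpha',\beta,\beta',\gamma}\left(t^{\rho-1}I^{m,n}_{p,q}\left[at^{\mu}\,\middle|\begin{matrix}(a_i,A_i,\alpha_i)_{1,p}\\(b_j,B_j,\beta_j)_{1,q}\end{matrix}\right]\right)\right)(x)=x^{\alpha+\alpha'-\gamma+\rho-1}\,I^{m,n+3}_{p+3,q+3}\left[ax^{\mu}\,\middle|\begin{matrix}U\\L\end{matrix}\right],$$ where the list of upper triples is $$U=(1-\rho,\mu,1),\ (1-\alpha+\beta-\rho,\mu,1),\ (1-\alpha-\alpha'-\beta'+\gamma-\rho,\mu,1),\ (a_i,A_i,\alpha_i)_{1,p}$$ and the list of lower triples is $$L=(b_j,B_j,\beta_j)_{1,q},\ (1+\beta-\rho,\mu,1),\ (1-\alpha-\alpha'+\gamma-\rho,\mu,1),\ (1-\alpha-\beta'+\gamma-\rho,\mu,1).$$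
   Context: **$I$-function.** Let $m,n,p,q$ be integers with $0\le m\le q$, $0\le n\le p$; let $a_i\in\mathbb{C}$, $A_i,\alpha_i>0$ $(1\le i\le p)$ and $b_j\in\mathbb{C}$, $B_j,\beta_j>0$ $(1\le j\le q)$. For $z\neq0$ (with a chosen value of $\arg z$; $z^{-s}=e^{-s(\log|z|+i\arg z)}$), $$I^{m,n}_{p,q}\left[z\,\middle|\begin{matrix}(a_i,A_i,\alpha_i)_{1,p}\\(b_j,B_j,\beta_j)_{1,q}\end{matrix}\right]=\frac{1}{2\pi i}\int_{C}\chi(s)z^{-s}\,ds,\qquad \chi(s)=\frac{\prod_{j=1}^{m}\Gamma^{\beta_j}(b_j+B_js)\prod_{i=1}^{n}\Gamma^{\alpha_i}(1-a_i-A_is)}{\prod_{j=m+1}^{q}\Gamma^{\beta_j}(1-b_j-B_js)\prod_{i=n+1}^{p}\Gamma^{\alpha_i}(a_i+A_is)}.$$ Here $(a_i,A_i,\alpha_i)_{1,p}$ is the ordered list of triples for $i=1,\dots,p$ (the first $n$ upper triples and the first $m$ lower triples enter the numerator), $\Gamma^{\kappa}(w)=(\Gamma(w))^{\kappa}$, with the branch of non-integer powers fixed along $C$ and the same for the same triple in all $I$-functions considered; empty products equal $1$. The singularities of $\Gamma^{\beta_j}(b_j+B_js)$, $j\le m$, lie to the left of $C$ and those of $\Gamma^{\alpha_i}(1-a_i-A_is)$, $i\le n$, to the right. **Standing assumptions.** The contour $C$ is the imaginary axis $\operatorname{Re}(s)=0$, traversed upwards, and for each $I$-function occurring the following conditions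 for absolute convergence hold: with (computed from the parameters of that $I$-function) $\mu^*=\sum_{j=1}^q\beta_jB_j-\sum_{i=1}^p\alpha_iA_i$, $\Omega=\sum_{i=1}^p(\frac12-\operatorname{Re}(a_i))\alpha_i-\sum_{j=1}^q(\frac12-\operatorname{Re}(b_j))\beta_j$, $\Delta=\sum_{j=1}^m\beta_jB_j-\sum_{j=m+1}^q\beta_jB_j+\sum_{i=1}^n\alpha_iA_i-\sum_{i=n+1}^p\alpha_iA_i$, either $\Delta>0$ and $|\arg z|<\frac{\pi}{2}\Delta$, or $\Delta\ge0$, $|\arg z|=\frac{\pi}{2}\Delta$ and one of: $\mu^*=0$ and $\Omega<-1$; or $\mu^*\ne0$ and $\Omega+\sigma\mu^*<-1$ where $\sigma=\operatorname{Re}(s)$ on $C$ (so $\sigma=0$). For $t>0$, $\arg(at^{\pm\mu})=\arg a$. **Operators.** For $\operatorname{Re}(\gamma)>0$, $x>0$, the left-sided Marichev–Saigo–Maeda (MSM) fractional integral is $$\left(\mathcal{I}_{0+}^{\alpha,\alpha',\beta,\beta',\gamma}f\right)(x)=\frac{x^{-\alpha}}{\Gamma(\gamma)}\int_0^x(x-t)^{\gamma-1}t^{-\alpha'}F_3\left(\alpha,\alpha',\beta,\beta';\gamma;1-\tfrac{t}{x},1-\tfrac{x}{t}\right)f(t)\,dt ,$$ and the left-sided MSM fractional derivative is $$\left(\mathcal{D}_{0+}^{\alpha,\alpha',\beta,\beta',\gamma}f\right)(x)=\left(\frac{d}{dx}\right)^{N}\left(\mathcal{I}_{0+}^{-\alpha',-\alpha,-\beta'+N,-\beta,-\gamma+N}f\right)(x),\qquad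 N=[\operatorname{Re}(\gamma)]+1,$$ $[\cdot]$ denoting the integer part. $F_3(\alpha,\alpha',\beta,\beta';\gamma;u,v)=\sum_{k,l\ge0}\frac{(\alpha)_k(\alpha')_l(\beta)_k(\beta')_l}{(\gamma)_{k+l}}\frac{u^kv^l}{k!\,l!}$ for $\max\{|u|,|v|\}<1$ (third Appell function, $(\cdot)_k$ the Pochhammer symbol), and for $u\in[0,1)$, $v\le0$ it denotes the analytic continuation $\sum_{k\ge0}\frac{(\alpha)_k(\beta)_k}{(\gamma)_k}\frac{u^k}{k!}\,{}_2F_1(\alpha',\beta';\gamma+k;v)$. *)

theory Defs
  imports "HOL-Analysis.Analysis"
begin

section \<open>The I-function\<close>

text \<open>A parameter triple \<open>(a, A, \<alpha>)\<close>; the numbers \<open>p\<close> and \<open>q\<close> are the lengths of the lists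
  \<open>us\<close> of upper and \<open>ls\<close> of lower triples.\<close>

type_synonym triple = "complex \<times> real \<times> real"

text \<open>
  A choice of branches: \<open>\<Lambda> c D \<kappa>\<close> is a logarithm of \<open>s \<mapsto> Gamma (c + D * s)\<close>, continuous on
  the imaginary axis with the poles removed, and the \<open>\<kappa>\<close>-th power is \<open>exp (\<kappa> * \<Lambda> c D \<kappa> s)\<close>.
  The factors of a triple \<open>(a, A, \<alpha>)\<close> have \<open>(c, D) = (a, A)\<close> or \<open>(c, D) = (1 - a, - A)\<close>.
  Since \<open>\<Lambda>\<close> depends on the triple only, the same triple has the same branch in every I-function.
\<close>

definition Gamma_branch :: "(complex \<Rightarrow> real \<Rightarrow> real \<Rightarrow> complex \<Rightarrow> complex) \<Rightarrow> bool" where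
  "Gamma_branch \<Lambda> \<longleftrightarrow>
     (\<forall>c D \<kappa>. let C = {s. Re s = 0 \<and> c + of_real D * s \<notin> \<int>\<^sub>\<le>\<^sub>0} in
        continuous_on C (\<Lambda> c D \<kappa>) \<and> (\<forall>s\<in>C. exp (\<Lambda> c D \<kappa> s) = Gamma (c + of_real D * s)))"

text \<open>The value \<open>0\<close> at a pole follows the library's convention for \<open>Gamma\<close>: a denominator
  factor may have a pole on the axis, and there \<open>1 / 0 = 0\<close> is the correct value of the
  reciprocal, as \<open>\<kappa> > 0\<close>.\<close>

definition Gamma_pow ::
  "(complex \<Rightarrow> real \<Rightarrow> real \<Rightarrow> complex \<Rightarrow> complex) \<Rightarrow> complex \<Rightarrow> real \<Rightarrow> real \<Rightarrow> complex \<Rightarrow> complex" where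
  "Gamma_pow \<Lambda> c D \<kappa> s =
     (if c + of_real D * s \<in> \<int>\<^sub>\<le>\<^sub>0 then 0 else exp (of_real \<kappa> * \<Lambda> c D \<kappa> s))"

definition I_chi ::
  "(complex \<Rightarrow> real \<Rightarrow> real \<Rightarrow> complex \<Rightarrow> complex) \<Rightarrow> nat \<Rightarrow> nat \<Rightarrow> triple list \<Rightarrow> triple list \<Rightarrow>
     complex \<Rightarrow> complex" where
  "I_chi \<Lambda> m n us ls s =
     ((\<Prod>(b, B, \<beta>)\<leftarrow>take m ls. Gamma_pow \<Lambda> b B \<beta> s) *
      (\<Prod>(a, A, \<alpha>)\<leftarrow>take n us. Gamma_pow \<Lambda> (1 - a) (- A) \<alpha> s)) /
     ((\<Prod>(b, B, \<beta>)\<leftarrow>drop m ls. Gamma_pow \<Lambda> (1 - b) (- B) \<beta> s) *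
      (\<Prod>(a, A, \<alpha>)\<leftarrow>drop n us. Gamma_pow \<Lambda> a A \<alpha> s))"

text \<open>\<open>\<theta>\<close> is the chosen value of \<open>arg z\<close>. The contour is parametrized by \<open>s = \<i> * \<tau>\<close>, hence the
  factor \<open>\<i>\<close> from \<open>ds = \<i> d\<tau>\<close>.\<close>

definition I_fun ::
  "(complex \<Rightarrow> real \<Rightarrow> real \<Rightarrow> complex \<Rightarrow> complex) \<Rightarrow> nat \<Rightarrow> nat \<Rightarrow> triple list \<Rightarrow> triple list \<Rightarrow>
     complex \<Rightarrow> real \<Rightarrow> complex" where
  "I_fun \<Lambda> m n us ls z \<theta> =
     1 / (2 * of_real pi * \<i>) *
     (LINT \<tau>|lborel. I_chi \<Lambda> m n us ls (\<i> * of_real \<tau>) *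
        exp (- (\<i> * of_real \<tau>) * (of_real (ln (cmod z)) + \<i> * of_real \<theta>)) * \<i>)"

definition I_mu_star :: "triple list \<Rightarrow> triple list \<Rightarrow> real" where
  "I_mu_star us ls = (\<Sum>(b, B, \<beta>)\<leftarrow>ls. \<beta> * B) - (\<Sum>(a, A, \<alpha>)\<leftarrow>us. \<alpha> * A)"

definition I_Omega :: "triple list \<Rightarrow> triple list \<Rightarrow> real" where
  "I_Omega us ls =
     (\<Sum>(a, A, \<alpha>)\<leftarrow>us. (1 / 2 - Re a) * \<alpha>) - (\<Sum>(b, B, \<beta>)\<leftarrow>ls. (1 / 2 - Re b) * \<beta>)"

definition I_Delta :: "nat \<Rightarrow> nat \<Rightarrow> triple list \<Rightarrow> triple list \<Rightarrow> real" where
  "I_Delta m n us ls =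
     (\<Sum>(b, B, \<beta>)\<leftarrow>take m ls. \<beta> * B) - (\<Sum>(b, B, \<beta>)\<leftarrow>drop m ls. \<beta> * B) +
     (\<Sum>(a, A, \<alpha>)\<leftarrow>take n us. \<alpha> * A) - (\<Sum>(a, A, \<alpha>)\<leftarrow>drop n us. \<alpha> * A)"

text \<open>The parameter \<open>\<sigma>\<close> is the real part on the contour.\<close>

definition I_convergence ::
  "nat \<Rightarrow> nat \<Rightarrow> triple list \<Rightarrow> triple list \<Rightarrow> real \<Rightarrow> real \<Rightarrow> bool" where
  "I_convergence m n us ls \<sigma> \<theta> \<longleftrightarrow>
     (I_Delta m n us ls > 0 \<and> \<bar>\<theta>\<bar> < pi / 2 * I_Delta m n us ls) \<or>
     (I_Delta m n us ls \<ge> 0 \<and> \<bar>\<theta>\<bar> = pi / 2 * I_Delta m n us ls \<and>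
        ((I_mu_star us ls = 0 \<and> I_Omega us ls < - 1) \<or>
         (I_mu_star us ls \<noteq> 0 \<and> I_Omega us ls + \<sigma> * I_mu_star us ls < - 1)))"

definition I_admissible ::
  "nat \<Rightarrow> nat \<Rightarrow> triple list \<Rightarrow> triple list \<Rightarrow> real \<Rightarrow> bool" where
  "I_admissible m n us ls \<theta> \<longleftrightarrow>
     m \<le> length ls \<and> n \<le> length us \<and>
     (\<forall>(a, A, \<alpha>)\<in>set us. A > 0 \<and> \<alpha> > 0) \<and>
     (\<forall>(b, B, \<beta>)\<in>set ls. B > 0 \<and> \<beta> > 0) \<and>
     (\<forall>(b, B, \<beta>)\<in>set (take m ls). \<forall>s. b + of_real B * s \<in> \<int>\<^sub>\<le>\<^sub>0 \<longrightarrow> Re s < 0) \<and>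
     (\<forall>(a, A, \<alpha>)\<in>set (take n us). \<forall>s. 1 - a - of_real A * s \<in> \<int>\<^sub>\<le>\<^sub>0 \<longrightarrow> Re s > 0) \<and>
     I_convergence m n us ls 0 \<theta>"


section \<open>Hypergeometric functions\<close>

definition hypergeo_2F1_series ::
  "complex \<Rightarrow> complex \<Rightarrow> complex \<Rightarrow> complex \<Rightarrow> complex" where
  "hypergeo_2F1_series a b c z =
     (\<Sum>n. pochhammer a n * pochhammer b n / pochhammer c n * z ^ n / fact n)"

text \<open>
  The principal branch of \<open>\<^sub>2F\<^sub>1\<close>: analytic continuation of the series along the rays from the
  origin, i.e. to open sets that are star-shaped with respect to \<open>0\<close>. Two such continuations agree
  at a common point, because the intersection of their domains is again open and star-shaped with
  respect to \<open>0\<close>. The points reached are those off the cut \<open>[1, \<infinity>)\<close>.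
\<close>

definition hypergeo_2F1 ::
  "complex \<Rightarrow> complex \<Rightarrow> complex \<Rightarrow> complex \<Rightarrow> complex" where
  "hypergeo_2F1 a b c z =
     (THE w. \<exists>S f. open S \<and> z \<in> S \<and> (\<forall>y\<in>S. closed_segment 0 y \<subseteq> S) \<and> f holomorphic_on S \<and>
        (\<forall>y\<in>S \<inter> ball 0 1. f y = hypergeo_2F1_series a b c y) \<and> w = f z)"

text \<open>The second case is meant for \<open>u \<in> [0, 1)\<close> and real \<open>v \<le> 0\<close>; no other
  arguments occur in the operators below.\<close>

definition Appell_F3 ::
  "complex \<Rightarrow> complex \<Rightarrow> complex \<Rightarrow> complex \<Rightarrow> complex \<Rightarrow> complex \<Rightarrow> complex \<Rightarrow> complex" where
  "Appell_F3 \<alpha> \<alpha>' \<beta> \<beta>' \<gamma> u v =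
     (if max (cmod u) (cmod v) < 1
      then (\<Sum>\<^sub>\<infinity>(k, l)\<in>UNIV.
              pochhammer \<alpha> k * pochhammer \<alpha>' l * pochhammer \<beta> k * pochhammer \<beta>' l /
              pochhammer \<gamma> (k + l) * (u ^ k * v ^ l / (fact k * fact l)))
      else (\<Sum>k. pochhammer \<alpha> k * pochhammer \<beta> k / pochhammer \<gamma> k * (u ^ k / fact k) *
              hypergeo_2F1 \<alpha>' \<beta>' (\<gamma> + of_nat k) v))"


section \<open>Marichev--Saigo--Maeda operators\<close>

definition MSM_integrand ::
  "complex \<Rightarrow> complex \<Rightarrow> complex \<Rightarrow> complex \<Rightarrow> complex \<Rightarrow> (real \<Rightarrow> complex) \<Rightarrow> real \<Rightarrow> real \<Rightarrow> complex" where
  "MSM_integrand \<alpha> \<alpha>' \<beta> \<beta>' \<gamma> f x t =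
     of_real (x - t) powr (\<gamma> - 1) * of_real t powr (- \<alpha>') *
     Appell_F3 \<alpha> \<alpha>' \<beta> \<beta>' \<gamma> (of_real (1 - t / x)) (of_real (1 - x / t)) * f t"

definition MSM_integral ::
  "complex \<Rightarrow> complex \<Rightarrow> complex \<Rightarrow> complex \<Rightarrow> complex \<Rightarrow> (real \<Rightarrow> complex) \<Rightarrow> real \<Rightarrow> complex" where
  "MSM_integral \<alpha> \<alpha>' \<beta> \<beta>' \<gamma> f x =
     of_real x powr (- \<alpha>) / Gamma \<gamma> * (LINT t:{0<..<x}|lborel. MSM_integrand \<alpha> \<alpha>' \<beta> \<beta>' \<gamma> f x t)"

definition iter_deriv :: "nat \<Rightarrow> (real \<Rightarrow> complex) \<Rightarrow> real \<Rightarrow> complex" where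
  "iter_deriv k = (\<lambda>g y. vector_derivative g (at y)) ^^ k"

definition MSM_order :: "complex \<Rightarrow> nat" where
  "MSM_order \<gamma> = nat (\<lfloor>Re \<gamma>\<rfloor> + 1)"

definition MSM_derivative ::
  "complex \<Rightarrow> complex \<Rightarrow> complex \<Rightarrow> complex \<Rightarrow> complex \<Rightarrow> (real \<Rightarrow> complex) \<Rightarrow> real \<Rightarrow> complex" where
  "MSM_derivative \<alpha> \<alpha>' \<beta> \<beta>' \<gamma> f x =
     (let N = MSM_order \<gamma> in
      iter_deriv N
        (MSM_integral (- \<alpha>') (- \<alpha>) (- \<beta>' + of_nat N) (- \<beta>) (- \<gamma> + of_nat N) f) x)"

text \<open>Integrals and derivatives are total functions in HOL; this predicate says that those in
  \<open>MSM_derivative\<close> really exist on the positive half-line.\<close>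

definition MSM_derivative_exists ::
  "complex \<Rightarrow> complex \<Rightarrow> complex \<Rightarrow> complex \<Rightarrow> complex \<Rightarrow> (real \<Rightarrow> complex) \<Rightarrow> bool" where
  "MSM_derivative_exists \<alpha> \<alpha>' \<beta> \<beta>' \<gamma> f \<longleftrightarrow>
     (let N = MSM_order \<gamma> in
      \<forall>x>0.
        set_integrable lborel {0<..<x}
          (MSM_integrand (- \<alpha>') (- \<alpha>) (- \<beta>' + of_nat N) (- \<beta>) (- \<gamma> + of_nat N) f x) \<and>
        (\<forall>k<N. iter_deriv k
          (MSM_integral (- \<alpha>') (- \<alpha>) (- \<beta>' + of_nat N) (- \<beta>) (- \<gamma> + of_nat N) f)
            differentiable at x))"

end

theory Submission
  imports Defs "HOL-Complex_Analysis.Complex_Analysis" "HOL-Real_Asymp.Real_Asymp"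
begin

text \<open>
  Inserting the contour integral of the I-function into \<open>f\<close> exhibits \<open>f\<close> as a superposition of the
  powers \<open>t\<^bsup>\<rho> - \<mu>s - 1\<^esup>\<close> with \<open>Re s = 0\<close>. On a power \<open>t\<^bsup>w - 1\<^esup>\<close> the MSM integral acts by a shift of
  the exponent and multiplication by a quotient of six Gamma functions, \<open>MSM_multiplier\<close>
  (\<open>MSM_kernel_power\<close>). The \<open>N\<close> derivatives that follow produce \<open>N\<close> linear factors, which remove the
  shift by \<open>N\<close> from one of the reciprocal Gamma functions (\<open>MSM_multiplier_falling_product\<close>). At
  \<open>w = \<rho> - \<mu>s\<close> the result is the product of the six Gamma factors by which the integrand of the
  I-function with the lists \<open>U\<close> and \<open>L\<close> differs from that of the given one (\<open>I_chi_extended\<close>). So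
  the theorem amounts to the multiplier formula in the full range of \<open>\<rho>\<close>, to the interchange of the
  MSM integral with the contour integral, and to \<open>N\<close> differentiations under the integral sign.

  \<^bold>\<open>The multiplier.\<close> In the kernel the two arguments of \<open>F\<^sub>3\<close> depend on the single variable
  \<open>y = 1 - t / x\<close>. Pfaff's transformation of the inner hypergeometric series
  (\<open>hypergeo_2F1_pfaff\<close>) turns \<open>F\<^sub>3\<close>, up to a power of \<open>t / x\<close>, into one power series \<open>H(y)\<close>
  (\<open>Appell_F3_eq_F3_diag\<close>), and the MSM integral of a power becomes the integral of
  \<open>y\<^bsup>\<gamma> - 1\<^esup> (1 - y)\<^bsup>\<rho> - 1\<^esup> H(y)\<close> over \<open>(0, 1)\<close>. Termwise integration and two applications of Gauss's
  summation theorem (\<open>gauss_sum\<close>) evaluate it. This is legitimate if the coefficients of \<open>H\<close> are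
  \<open>O(n\<^bsup>E - 1\<^esup>)\<close> with \<open>E < Re \<rho>\<close>, and for \<open>Re \<alpha>' \<ge> 1\<close> a direct estimate gives that. For other \<open>\<alpha>'\<close> the
  direct estimate is too weak, because it ignores cancellation. Here the contiguous relation
  \<open>F3_diag_contiguous\<close> helps: it expresses \<open>H\<close> by the function that belongs to
  \<open>\<alpha>' + 1, \<beta>' + 1, \<gamma> + 1\<close> and the derivative of that function, multiplied by \<open>1 - y\<close>. The critical
  exponent does not change under this shift, so both the growth of \<open>H\<close> and its derivatives near \<open>1\<close>
  (\<open>grows_F3_diag\<close>) and, after an integration by parts, the integral formula (\<open>F3_mellin\<close>) descend
  from the case \<open>Re \<alpha>' \<ge> 1\<close>.

  \<^bold>\<open>The interchanges.\<close> A weak form of Stirling's formula on vertical lines shows that at \<open>s = \<i>\<tau>\<close> the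
  integrand of an I-function is
  \<open>O((1 + \<bar>\<tau>\<bar>)\<^bsup>\<Omega>\<^esup> exp (- (\<pi>\<Delta>/2 - \<bar>\<theta>\<bar>) \<bar>\<tau>\<bar>))\<close> (\<open>vertical_growth_I_density\<close>). The multiplier
  contributes \<open>(1 + \<bar>\<tau>\<bar>)\<^bsup>Re \<gamma> - N\<^esup>\<close>, and \<open>k\<close> derivatives contribute \<open>(1 + \<bar>\<tau>\<bar>)\<^bsup>k\<^esup>\<close>. The I-function with
  the lists \<open>U\<close> and \<open>L\<close> has the same \<open>\<Delta>\<close>, and its \<open>\<Omega>\<close> is larger by \<open>Re \<gamma>\<close>, so its condition for
  absolute convergence makes everything integrable that occurs for \<open>k \<le> N\<close>
  (\<open>MSM_integral_superposition\<close>, \<open>iter_deriv_LINT_powr\<close>).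
\<close>

section \<open>The size of Pochhammer symbols\<close>

text \<open>Euler's limit formula for \<open>1 / \<Gamma>\<close> in absolute value. The power has base \<open>n + 1\<close>, so that the
  bounds drawn from this limit hold from \<open>n = 0\<close> on.\<close>

lemma norm_pochhammer_tendsto:
  fixes a :: complex
  shows "(\<lambda>n. cmod (pochhammer a n) / (fact n * (real n + 1) powr (Re a - 1))) \<longlonglongrightarrow> cmod (rGamma a)"
proof -
  define r where "r = Re a"
  have 1: "(\<lambda>n. cmod (rGamma_series a n)) \<longlonglongrightarrow> cmod (rGamma a)"
    by (intro tendsto_norm rGamma_series_LIMSEQ)
  have 2: "(\<lambda>n. real n powr r / ((real n + 1) * (real n + 2) powr (r - 1))) \<longlonglongrightarrow> 1"
    by real_asymp
  have "(\<lambda>n. cmod (rGamma_series a n) * (real n powr r / ((real n + 1) * (real n + 2) powr (r - 1))))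
      \<longlonglongrightarrow> cmod (rGamma a) * 1"
    by (intro tendsto_mult 1 2)
  moreover have "\<forall>\<^sub>F n in sequentially.
      cmod (rGamma_series a n) * (real n powr r / ((real n + 1) * (real n + 2) powr (r - 1))) =
      cmod (pochhammer a (Suc n)) / (fact (Suc n) * (real (Suc n) + 1) powr (Re a - 1))"
    using eventually_gt_at_top[of 0]
  proof eventually_elim
    case (elim n)
    have "cmod (exp (a * of_real (ln (real n)))) = real n powr r"
      using elim by (simp add: powr_def r_def mult.commute)
    thus ?case using elim unfolding rGamma_series_def
      by (simp add: norm_mult norm_divide field_simps r_def add_ac)
  qed
  ultimately have "(\<lambda>n. cmod (pochhammer a (Suc n)) / (fact (Suc n) * (real (Suc n) + 1) powr (Re a - 1)))
      \<longlonglongrightarrow> cmod (rGamma a)"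
    by (simp add: tendsto_cong)
  thus ?thesis by (rule LIMSEQ_imp_Suc)
qed

lemma norm_pochhammer_upper:
  fixes a :: complex
  obtains C where "C > 0" "\<And>n. cmod (pochhammer a n) \<le> C * (fact n * (real n + 1) powr (Re a - 1))"
proof -
  have "Bseq (\<lambda>n. cmod (pochhammer a n) / (fact n * (real n + 1) powr (Re a - 1)))"
    using norm_pochhammer_tendsto[of a] by (intro convergent_imp_Bseq convergentI)
  then obtain C where C: "C > 0" 
    "\<And>n. norm (cmod (pochhammer a n) / (fact n * (real n + 1) powr (Re a - 1))) \<le> C"
    unfolding Bseq_def by blast
  show ?thesis
    by (rule that[OF C(1)]) (use C(2) in \<open>simp add: divide_simps norm_mult\<close>)
qed

lemma norm_pochhammer_lower:
  fixes a :: complex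
  assumes "a \<notin> \<int>\<^sub>\<le>\<^sub>0"
  obtains C where "C > 0" "\<And>n. fact n * (real n + 1) powr (Re a - 1) \<le> C * cmod (pochhammer a n)"
proof -
  have nz: "pochhammer a n \<noteq> 0" for n
    using assms pochhammer_eq_0_imp_nonpos_Int by blast
  have "(\<lambda>n. inverse (cmod (pochhammer a n) / (fact n * (real n + 1) powr (Re a - 1)))) 
         \<longlonglongrightarrow> inverse (cmod (rGamma a))"
    using assms by (intro tendsto_inverse norm_pochhammer_tendsto) (auto simp: rGamma_eq_zero_iff)
  hence "Bseq (\<lambda>n. inverse (cmod (pochhammer a n) / (fact n * (real n + 1) powr (Re a - 1))))"
    by (intro convergent_imp_Bseq convergentI)
  then obtain C where C: "C > 0" 
    "\<And>n. norm (inverse (cmod (pochhammer a n) / (fact n * (real n + 1) powr (Re a - 1)))) \<le> C"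
    unfolding Bseq_def by blast
  show ?thesis
    by (rule that[OF C(1)]) (use C(2) nz in \<open>simp add: divide_simps norm_mult split: if_splits\<close>)
qed

lemma norm_pochhammer_ratio:
  fixes a b :: complex
  assumes "b \<notin> \<int>\<^sub>\<le>\<^sub>0"
  obtains C where "C > 0"
    "\<And>n. cmod (pochhammer a n / pochhammer b n) \<le> C * (real n + 1) powr (Re a - Re b)"
proof -
  obtain C1 where C1: "C1 > 0" "\<And>n. cmod (pochhammer a n) \<le> C1 * (fact n * (real n + 1) powr (Re a - 1))"
    using norm_pochhammer_upper by blast
  obtain C2 where C2: "C2 > 0" "\<And>n. fact n * (real n + 1) powr (Re b - 1) \<le> C2 * cmod (pochhammer b n)"
    using norm_pochhammer_lower[OF assms] by blast
  have nz: "pochhammer b n \<noteq> 0" for n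
    using assms pochhammer_eq_0_imp_nonpos_Int by blast
  show ?thesis
  proof (rule that[of "C1 * C2"])
    fix n
    have "cmod (pochhammer a n) \<le> C1 * ((fact n * (real n + 1) powr (Re b - 1)) * (real n + 1) powr (Re a - Re b))"
      using C1(2)[of n] by (simp add: powr_add[symmetric] mult.assoc)
    also have "\<dots> \<le> C1 * ((C2 * cmod (pochhammer b n)) * (real n + 1) powr (Re a - Re b))"
      using C1 C2 by (intro mult_left_mono mult_right_mono) auto
    finally show "cmod (pochhammer a n / pochhammer b n) \<le> C1 * C2 * (real n + 1) powr (Re a - Re b)"
      using nz[of n] by (simp add: norm_divide divide_simps mult_ac)
  qed (use C1 C2 in auto)
qed

lemma nonpos_Int_Re_le: "z \<in> \<int>\<^sub>\<le>\<^sub>0 \<Longrightarrow> Re z \<le> 0"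
  by (elim nonpos_Ints_cases) auto

lemma norm_pochhammer_ge_Re:
  assumes "Re c \<ge> 0"
  shows "pochhammer (Re c) n \<le> cmod (pochhammer c n)"
proof (induction n)
  case (Suc n)
  have "pochhammer (Re c) (Suc n) = pochhammer (Re c) n * (Re c + n)"
    by (simp add: pochhammer_Suc)
  also have "\<dots> \<le> cmod (pochhammer c n) * cmod (c + of_nat n)"
    using Suc assms abs_Re_le_cmod[of "c + of_nat n"] by (intro mult_mono) auto
  finally show ?case by (simp add: pochhammer_Suc norm_mult)
qed auto

lemma norm_pochhammer_le:
  assumes "cmod c \<le> A"
  shows "cmod (pochhammer c n) \<le> pochhammer A n"
proof (induction n)
  case (Suc n)
  have "cmod (pochhammer c (Suc n)) = cmod (pochhammer c n) * cmod (c + of_nat n)"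
    by (simp add: pochhammer_Suc norm_mult)
  also have "\<dots> \<le> pochhammer A n * (A + n)"
    using Suc assms norm_triangle_ineq[of c "of_nat n"] order_trans[OF norm_ge_zero Suc.IH]
    by (intro mult_mono) auto
  finally show ?case by (simp add: pochhammer_Suc norm_mult)
qed auto

lemma summable_Suc_powr: "s < -1 \<Longrightarrow> summable (\<lambda>n. (real n + 1) powr s)"
proof -
  assume "s < -1"
  hence "summable (\<lambda>n. real n powr s)" by (simp add: summable_real_powr_iff)
  hence "summable (\<lambda>n. real (Suc n) powr s)" by (subst summable_Suc_iff)
  thus ?thesis by (simp add: add.commute)
qed

section \<open>Gauss's summation theorem\<close>

text \<open>For \<open>Re c > 0\<close> this is the lower bound for \<open>(c)\<^sub>n\<close>. Lowering \<open>c\<close> by one multiplies the reciprocal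
  Gamma function by a linear factor, and so a descent reaches every \<open>c\<close>, the poles of \<open>\<Gamma>\<close> included.\<close>

lemma norm_rGamma_upper:
  fixes c :: complex
  shows "\<exists>C>0. \<forall>n. cmod (rGamma (c + of_nat n)) \<le> C * ((real n + 1) powr (1 - Re c) / fact n)"
proof -
  have base: "\<exists>C>0. \<forall>n. cmod (rGamma (c + of_nat n)) \<le> C * ((real n + 1) powr (1 - Re c) / fact n)"
    if "Re c > 0" for c
  proof -
    have c: "c \<notin> \<int>\<^sub>\<le>\<^sub>0" using that nonpos_Int_Re_le[of c] by auto
    hence nz: "pochhammer c n \<noteq> 0" for n
      using pochhammer_eq_0_imp_nonpos_Int by blast
    obtain C where C: "C > 0" "\<And>n. fact n * (real n + 1) powr (Re c - 1) \<le> C * cmod (pochhammer c n)"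
      using norm_pochhammer_lower[OF c] by blast
    show ?thesis
    proof (intro exI[of _ "C * cmod (rGamma c)"] conjI allI)
      show "0 < C * cmod (rGamma c)" using C c by (auto simp: rGamma_eq_zero_iff)
      fix n
      have *: "cmod (rGamma (c + of_nat n)) = cmod (rGamma c) / cmod (pochhammer c n)"
        using nz[of n] by (simp add: pochhammer_rGamma[of c n] norm_mult)
      have "1 / cmod (pochhammer c n) \<le> C / (fact n * (real n + 1) powr (Re c - 1))"
        using C(2)[of n] nz[of n] by (simp add: field_simps)
      also have "\<dots> = C * ((real n + 1) powr (1 - Re c) / fact n)"
        by (simp add: powr_diff field_simps)
      finally have "cmod (rGamma c) * (1 / cmod (pochhammer c n)) \<le> 
          cmod (rGamma c) * (C * ((real n + 1) powr (1 - Re c) / fact n))"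
        by (intro mult_left_mono) auto
      thus "cmod (rGamma (c + of_nat n)) \<le> C * cmod (rGamma c) * ((real n + 1) powr (1 - Re c) / fact n)"
        unfolding * by (simp add: mult_ac)
    qed
  qed
  have step: "\<exists>C>0. \<forall>n. cmod (rGamma (c + of_nat n)) \<le> C * ((real n + 1) powr (1 - Re c) / fact n)"
    if ex: "\<exists>C>0. \<forall>n. cmod (rGamma (c + 1 + of_nat n)) \<le> C * ((real n + 1) powr (1 - Re (c + 1)) / fact n)" for c
  proof -
    obtain C where C: "C > 0" "\<And>n. cmod (rGamma (c + 1 + of_nat n)) \<le> C * ((real n + 1) powr (1 - Re (c + 1)) / fact n)"
      using ex by blast
    show ?thesis
    proof (intro exI[of _ "(cmod c + 1) * C"] conjI allI)
      fix n
      have "rGamma (c + of_nat n) = (c + of_nat n) * rGamma (c + 1 + of_nat n)"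
        using rGamma_plus1[of "c + of_nat n"] by (simp add: add_ac)
      hence "cmod (rGamma (c + of_nat n)) = cmod (c + of_nat n) * cmod (rGamma (c + 1 + of_nat n))"
        by (simp add: norm_mult)
      also have "\<dots> \<le> ((cmod c + 1) * (real n + 1)) * (C * ((real n + 1) powr (1 - Re (c + 1)) / fact n))"
      proof (intro mult_mono C(2))
        show "cmod (c + of_nat n) \<le> (cmod c + 1) * (real n + 1)"
        proof -
          have "cmod (c + of_nat n) \<le> cmod c + real n"
            using norm_triangle_ineq[of c "of_nat n"] by simp
          also have "\<dots> \<le> (cmod c + 1) * (real n + 1)"
            by (simp add: algebra_simps add_nonneg_nonneg)
          finally show ?thesis .
        qed
      qed auto
      also have "(1 - Re c) = 1 + (1 - Re (c + 1))" by simp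
      hence "((cmod c + 1) * (real n + 1)) * (C * ((real n + 1) powr (1 - Re (c + 1)) / fact n)) =
            (cmod c + 1) * C * ((real n + 1) powr (1 - Re c) / fact n)"
        by (simp only: powr_add) (simp add: mult_ac)
      finally show "cmod (rGamma (c + of_nat n)) \<le> (cmod c + 1) * C * ((real n + 1) powr (1 - Re c) / fact n)" .
    qed (use C norm_ge_zero[of c] in \<open>auto intro!: mult_pos_pos simp: add_nonneg_pos\<close>)
  qed
  obtain m :: nat where "- Re c < real m" using reals_Archimedean2 by blast
  hence m: "Re c + m > 0" by simp
  thus ?thesis
  proof (induction m arbitrary: c)
    case 0
    thus ?case using base by simp
  next
    case (Suc m)
    show ?case by (rule step, rule Suc.IH) (use Suc.prems in auto)
  qed
qed

text \<open>The terms of \<open>\<^sub>2F\<^sub>1(a, b; c; 1) / \<Gamma>(c)\<close>. In this normalization Gauss's theorem holds for every \<open>c\<close>,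
  and below it is applied at a \<open>c\<close> that may be a nonpositive integer.\<close>

definition gauss_term :: "complex \<Rightarrow> complex \<Rightarrow> complex \<Rightarrow> nat \<Rightarrow> complex" where
  "gauss_term a b c n = pochhammer a n * pochhammer b n / fact n * rGamma (c + of_nat n)"

lemma norm_gauss_term:
  "\<exists>C>0. \<forall>n. cmod (gauss_term a b c n) \<le> C * (real n + 1) powr (Re (a + b - c) - 1)"
proof -
  obtain A where A: "A > 0" "\<And>n. cmod (pochhammer a n) \<le> A * (fact n * (real n + 1) powr (Re a - 1))"
    using norm_pochhammer_upper by blast
  obtain B where B: "B > 0" "\<And>n. cmod (pochhammer b n) \<le> B * (fact n * (real n + 1) powr (Re b - 1))"
    using norm_pochhammer_upper by blast
  obtain C where C: "C > 0" "\<And>n. cmod (rGamma (c + of_nat n)) \<le> C * ((real n + 1) powr (1 - Re c) / fact n)"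
    using norm_rGamma_upper by blast
  show ?thesis
  proof (intro exI[of _ "A * B * C"] conjI allI)
    fix n
    have "cmod (gauss_term a b c n) = 
        cmod (pochhammer a n) * cmod (pochhammer b n) / fact n * cmod (rGamma (c + of_nat n))"
      by (simp add: gauss_term_def norm_mult norm_divide)
    also have "\<dots> \<le> (A * (fact n * (real n + 1) powr (Re a - 1))) * (B * (fact n * (real n + 1) powr (Re b - 1)))
         / fact n * (C * ((real n + 1) powr (1 - Re c) / fact n))"
      using A B C by (intro mult_mono divide_right_mono A(2) B(2) C(2) mult_nonneg_nonneg divide_nonneg_nonneg) auto
    also have "\<dots> = A * B * C * ((real n + 1) powr (Re a - 1) * (real n + 1) powr (Re b - 1) * (real n + 1) powr (1 - Re c))"
      by (simp add: field_simps)
    also have "(real n + 1) powr (Re a - 1) * (real n + 1) powr (Re b - 1) * (real n + 1) powr (1 - Re c) =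
        (real n + 1) powr (Re (a + b - c) - 1)"
      by (simp only: powr_add[symmetric]) (simp add: algebra_simps)
    finally show "cmod (gauss_term a b c n) \<le> A * B * C * (real n + 1) powr (Re (a + b - c) - 1)" .
  qed (use A B C in auto)
qed

lemma summable_norm_gauss_term:
  assumes "Re (c - a - b) > 0"
  shows "summable (\<lambda>n. cmod (gauss_term a b c n))"
proof -
  obtain C where C: "\<And>n. cmod (gauss_term a b c n) \<le> C * (real n + 1) powr (Re (a + b - c) - 1)"
    using norm_gauss_term by blast
  show ?thesis
    by (rule summable_comparison_test_ev[OF _ summable_mult[OF summable_Suc_powr[of "Re (a + b - c) - 1"], of C]])
       (use C assms in auto)
qed

text \<open>The termwise difference of the two sides telescopes along \<open>n * gauss_term a b c n\<close>, which tends
  to \<open>0\<close> under the condition of Gauss's theorem.\<close>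

lemma gauss_contiguous:
  assumes "Re (c - a - b) > 0"
  shows "(c - a - b) * suminf (gauss_term a b c) = (c - a) * (c - b) * suminf (gauss_term a b (c + 1))"
proof -
  let ?w = "\<lambda>n. of_nat n * gauss_term a b c n"
  obtain C where C: "C > 0" "\<And>n. cmod (gauss_term a b c n) \<le> C * (real n + 1) powr (Re (a + b - c) - 1)"
    using norm_gauss_term by blast
  have w0: "?w \<longlonglongrightarrow> 0"
  proof (rule Lim_null_comparison)
    show "\<forall>\<^sub>F n in sequentially. cmod (?w n) \<le> C * (real n + 1) powr (Re (a + b - c))"
    proof (intro always_eventually allI)
      fix n
      have "cmod (?w n) \<le> (real n + 1) * (C * (real n + 1) powr (Re (a + b - c) - 1))"
        using C(2)[of n] by (simp only: norm_mult, intro mult_mono) auto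
      thus "cmod (?w n) \<le> C * (real n + 1) powr (Re (a + b - c))"
        by (simp add: powr_diff)
    qed
    have "Re (a + b - c) < 0" using assms by simp
    thus "(\<lambda>n. C * (real n + 1) powr (Re (a + b - c))) \<longlonglongrightarrow> 0"
      by real_asymp
  qed
  have "(\<lambda>n. ?w n - ?w (Suc n)) sums (?w 0 - 0)"
    using telescope_sums'[OF w0] by simp
  moreover have "?w n - ?w (Suc n) = (c - a - b) * gauss_term a b c n - (c - a) * (c - b) * gauss_term a b (c + 1) n" for n
  proof -
    define v where "v = gauss_term a b (c + 1) n"
    have u: "gauss_term a b c n = (c + of_nat n) * v"
      using rGamma_plus1[of "c + of_nat n"] by (simp add: v_def gauss_term_def add_ac mult_ac)
    have "?w (Suc n) = (a + of_nat n) * (b + of_nat n) * v"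
      by (simp add: v_def gauss_term_def pochhammer_Suc add_ac mult_ac divide_simps del: of_nat_Suc)
         (simp add: algebra_simps)
    thus ?thesis unfolding u v_def[symmetric] by (simp only:) (simp add: algebra_simps)
  qed
  ultimately have "(\<lambda>n. (c - a - b) * gauss_term a b c n - (c - a) * (c - b) * gauss_term a b (c + 1) n) sums 0"
    by simp
  moreover have "summable (gauss_term a b c)" "summable (gauss_term a b (c + 1))"
    using assms by (auto intro!: summable_norm_cancel[OF summable_norm_gauss_term])
  hence "(\<lambda>n. (c - a - b) * gauss_term a b c n - (c - a) * (c - b) * gauss_term a b (c + 1) n) sums
      ((c - a - b) * suminf (gauss_term a b c) - (c - a) * (c - b) * suminf (gauss_term a b (c + 1)))"
    by (intro sums_diff sums_mult summable_sums)
  ultimately show ?thesis using sums_unique2 by fastforce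
qed

lemma gauss_iterated:
  assumes "Re (c - a - b) > 0"
  shows "pochhammer (c - a - b) n * suminf (gauss_term a b c) = 
         pochhammer (c - a) n * pochhammer (c - b) n * suminf (gauss_term a b (c + of_nat n))"
proof (induction n)
  case (Suc n)
  have "pochhammer (c - a - b) (Suc n) * suminf (gauss_term a b c) =
      (c - a - b + of_nat n) * (pochhammer (c - a - b) n * suminf (gauss_term a b c))"
    by (simp add: pochhammer_Suc mult_ac)
  also have "\<dots> = pochhammer (c - a) n * pochhammer (c - b) n * 
      ((c + of_nat n - a - b) * suminf (gauss_term a b (c + of_nat n)))"
    by (simp only: Suc) (simp add: algebra_simps)
  also have "(c + of_nat n - a - b) * suminf (gauss_term a b (c + of_nat n)) =
     (c + of_nat n - a) * (c + of_nat n - b) * suminf (gauss_term a b (c + of_nat n + 1))"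
    by (rule gauss_contiguous) (use assms in auto)
  finally show ?case by (simp add: pochhammer_Suc algebra_simps)
qed auto

text \<open>Tannery's theorem applies because a shift of \<open>c\<close> to the right decreases the majorant of the terms,
  in which \<open>c\<close> is replaced by \<open>Re c\<close>.\<close>

lemma gauss_limit:
  assumes c: "Re c > 0" and cab: "Re (c - a - b) > 0"
  shows "(\<lambda>n. Gamma (c + of_nat n) * suminf (gauss_term a b (c + of_nat n))) \<longlonglongrightarrow> 1"
proof -
  have cn: "c + of_nat n \<notin> \<int>\<^sub>\<le>\<^sub>0" for n using nonpos_Int_Re_le[of "c + of_nat n"] c by auto
  have pz: "pochhammer (c + of_nat n) k \<noteq> 0" for n k
    using cn pochhammer_eq_0_imp_nonpos_Int by blast
  define t where "t = (\<lambda>k n. pochhammer a k * pochhammer b k / (fact k * pochhammer (c + of_nat n) k))"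
  have rG: "Gamma (c + of_nat n) * rGamma (c + of_nat n + of_nat k) = 1 / pochhammer (c + of_nat n) k" for n k
  proof -
    have "rGamma (c + of_nat n) \<noteq> 0" using cn[of n] by (simp add: rGamma_eq_zero_iff)
    thus ?thesis using pz[of n k] unfolding pochhammer_rGamma[of "c + of_nat n" k] Gamma_def
      by (simp add: field_simps)
  qed
  have t: "Gamma (c + of_nat n) * gauss_term a b (c + of_nat n) k = t k n" for n k
    unfolding gauss_term_def t_def using rG[of n k] by (simp add: field_simps)
  have pR: "pochhammer (Re c) k > 0" for k using c by (intro pochhammer_pos) auto
  \<comment> \<open>Only the zeroth term survives, since \<open>(c + n)\<^sub>k\<close> grows at least like \<open>n\<close> for \<open>k > 0\<close>.\<close>
  have lim: "(\<lambda>n. t k n) \<longlonglongrightarrow> (if k = 0 then 1 else 0)" for k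
  proof (cases k)
    case (Suc j)
    have inv: "filterlim (\<lambda>n. pochhammer (c + of_nat n) k) at_infinity sequentially" 
    proof -
      have "filterlim (\<lambda>n. cmod (pochhammer (c + of_nat n) k)) at_top sequentially"
      proof (rule filterlim_at_top_mono[of "\<lambda>n. real n * Re c ^ j"])
        show "filterlim (\<lambda>n. real n * Re c ^ j) at_top sequentially"
          using c by (intro filterlim_at_top_mult_tendsto_pos[OF tendsto_const _ filterlim_real_sequentially]) auto
        show "\<forall>\<^sub>F n in sequentially. real n * Re c ^ j \<le> cmod (pochhammer (c + of_nat n) k)"
        proof (intro always_eventually allI)
          fix n
          have ge: "Re c ^ j \<le> pochhammer (Re c + 1 + of_nat n) j"
          proof -
            have "(\<Prod>i=0..<j. Re c) \<le> (\<Prod>i=0..<j. Re c + 1 + of_nat n + of_nat i)"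
              using c by (intro prod_mono) auto
            thus ?thesis by (simp add: pochhammer_prod)
          qed
          have "real n * Re c ^ j \<le> (Re c + n) * pochhammer (Re c + 1 + of_nat n) j"
            using c ge by (intro mult_mono) auto
          also have "\<dots> = pochhammer (Re (c + of_nat n)) k" by (simp add: Suc pochhammer_rec add_ac)
          also have "\<dots> \<le> cmod (pochhammer (c + of_nat n) k)"
            using c by (intro norm_pochhammer_ge_Re) auto
          finally show "real n * Re c ^ j \<le> cmod (pochhammer (c + of_nat n) k)" .
        qed
      qed
      thus ?thesis by (rule filterlim_norm_at_top_imp_at_infinity)
    qed
    have "(\<lambda>n. pochhammer a k * pochhammer b k / fact k / pochhammer (c + of_nat n) k) \<longlonglongrightarrow> 0"
      by (rule tendsto_divide_0[OF tendsto_const inv])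
    thus ?thesis using Suc by (simp add: t_def)
  qed (simp add: t_def)
  define M where "M = (\<lambda>k. cmod (pochhammer a k) * cmod (pochhammer b k) / (fact k * pochhammer (Re c) k))"
  have summ: "summable M"
  proof -
    have "M k = cmod (gauss_term a b (of_real (Re c)) k) * Gamma (Re c)" for k
    proof -
      have "rGamma (Re c) = pochhammer (Re c) k * rGamma (Re c + of_nat k)"
        by (rule pochhammer_rGamma)
      moreover have "rGamma (complex_of_real (Re c) + of_nat k) = of_real (rGamma (Re c + of_nat k))"
        by (metis of_real_add of_real_of_nat_eq rGamma_complex_of_real)
      moreover have "rGamma (Re c) > 0" 
        using c Gamma_real_pos[of "Re c"] by (simp add: rGamma_inverse_Gamma)
      moreover from calculation have "rGamma (Re c + of_nat k) > 0"
        using pR[of k] by (simp add: zero_less_mult_iff)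
      ultimately show ?thesis using pR[of k] 
        by (simp add: M_def gauss_term_def norm_mult norm_divide Gamma_def field_simps abs_mult)
    qed
    moreover have "summable (\<lambda>k. cmod (gauss_term a b (of_real (Re c)) k) * Gamma (Re c))"
      using cab by (intro summable_mult2 summable_norm_gauss_term) auto
    ultimately show ?thesis by presburger
  qed
  have bd: "norm (t k n) \<le> M k" for k n
  proof -
    have "pochhammer (Re c) k \<le> pochhammer (Re c + n) k"
      unfolding pochhammer_prod using c by (intro prod_mono) auto
    also have "\<dots> \<le> cmod (pochhammer (c + of_nat n) k)"
      using norm_pochhammer_ge_Re[of "c + of_nat n" k] c by auto
    finally have "pochhammer (Re c) k \<le> cmod (pochhammer (c + of_nat n) k)" .
    thus ?thesis unfolding t_def M_def norm_divide norm_mult using pR[of k]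
      by (intro frac_le mult_mono) (auto simp: zero_less_mult_iff intro!: mult_nonneg_nonneg)
  qed
  have "((\<lambda>n. suminf (\<lambda>k. t k n)) \<longlongrightarrow> suminf (\<lambda>k. if k = 0 then 1 else 0)) sequentially"
    using tannerys_theorem[OF lim _ summ] bd by (auto simp: always_eventually)
  moreover have "suminf (\<lambda>k::nat. if k = 0 then 1 else 0 :: complex) = 1"
    using sums_unique[OF sums_single[of 0 "\<lambda>_. 1::complex"]] by simp
  moreover have "suminf (\<lambda>k. t k n) = Gamma (c + of_nat n) * suminf (gauss_term a b (c + of_nat n))" for n
    unfolding t[symmetric] using cab 
    by (intro suminf_mult summable_norm_cancel[OF summable_norm_gauss_term]) auto
  ultimately show ?thesis by simp
qed

text \<open>By the iterated contiguous relation the sum at \<open>c\<close> is the sum at \<open>c + n\<close> times a quotient of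
  Pochhammer symbols; as \<open>n\<close> grows, Euler's limit evaluates the quotient. This settles \<open>Re c > 0\<close>, and the
  contiguous relation carries the result to the left.\<close>

theorem gauss_sum:
  assumes cab: "Re (c - a - b) > 0"
  shows "suminf (gauss_term a b c) = Gamma (c - a - b) * rGamma (c - a) * rGamma (c - b)"
proof -
  have base: "suminf (gauss_term a b c) = Gamma (c - a - b) * rGamma (c - a) * rGamma (c - b)"
    if cab: "Re (c - a - b) > 0" and c: "Re c > 0" for c
  proof -
    have c': "c \<notin> \<int>\<^sub>\<le>\<^sub>0" "c - a - b \<notin> \<int>\<^sub>\<le>\<^sub>0" 
      using nonpos_Int_Re_le[of "c"] nonpos_Int_Re_le[of "c - a - b"] c cab by auto
    have pz: "pochhammer c n \<noteq> 0" "pochhammer (c - a - b) n \<noteq> 0" for n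
      using c' pochhammer_eq_0_imp_nonpos_Int by blast+
    \<comment> \<open>The powers of \<open>n\<close> in the four Euler limits cancel, because
      \<open>(c - a) + (c - b) = (c - a - b) + c\<close>.\<close>
    define P where "P = (\<lambda>n. rGamma_series (c - a) n * rGamma_series (c - b) n / (rGamma_series (c - a - b) n * rGamma_series c n) * rGamma c)"
    have P: "P \<longlonglongrightarrow> rGamma (c - a) * rGamma (c - b) / (rGamma (c - a - b) * rGamma c) * rGamma c"
      unfolding P_def using c' by (intro tendsto_intros rGamma_series_LIMSEQ) (auto simp: rGamma_eq_zero_iff)
    have P': "P n = pochhammer (c - a) (Suc n) * pochhammer (c - b) (Suc n) / 
         (pochhammer (c - a - b) (Suc n) * Gamma (c + of_nat (Suc n)))" for n
    proof -
      have e: "exp ((c-a) * of_real (ln (of_nat n))) * exp ((c-b) * of_real (ln (of_nat n))) =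
            exp ((c-a-b) * of_real (ln (of_nat n))) * exp (c * of_real (ln (of_nat n)))"
        unfolding exp_add[symmetric] by (simp add: algebra_simps)
      have "rGamma c = pochhammer c (Suc n) * rGamma (c + of_nat (Suc n))" 
        by (rule pochhammer_rGamma)
      moreover have "P n = pochhammer (c - a) (Suc n) * pochhammer (c - b) (Suc n) / 
         (pochhammer (c - a - b) (Suc n) * pochhammer c (Suc n)) * rGamma c"
      proof -
        have gen: "(p1 / (f * e1)) * (p2 / (f * e2)) / ((p3 / (f * e3)) * (p4 / (f * e4))) * r
           = p1 * p2 / (p3 * p4) * r" 
           if "e1 * e2 = e3 * e4" "e1 \<noteq> 0" "e2 \<noteq> 0" "e3 \<noteq> 0" "e4 \<noteq> 0" "f \<noteq> 0" 
             for p1 p2 p3 p4 f e1 e2 e3 e4 r :: complex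
        proof -
          have "(p1 / (f * e1)) * (p2 / (f * e2)) / ((p3 / (f * e3)) * (p4 / (f * e4))) * r = 
                p1 * p2 / (p3 * p4) * r * ((e3 * e4) / (e1 * e2))"
            using that by (simp add: divide_simps)
          also have "(e3 * e4) / (e1 * e2) = 1" using that by simp
          finally show ?thesis by simp
        qed
        show ?thesis unfolding P_def rGamma_series_def using e by (subst gen) auto
      qed
      ultimately have "P n = pochhammer (c - a) (Suc n) * pochhammer (c - b) (Suc n) / 
         (pochhammer (c - a - b) (Suc n) * pochhammer c (Suc n)) * 
         (pochhammer c (Suc n) * rGamma (c + of_nat (Suc n)))" by simp
      also have "\<dots> = pochhammer (c - a) (Suc n) * pochhammer (c - b) (Suc n) / 
         pochhammer (c - a - b) (Suc n) * rGamma (c + of_nat (Suc n))"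
        using pz(1)[of "Suc n"] by simp
      finally show ?thesis by (simp only: rGamma_inverse_Gamma) (simp add: divide_inverse mult_ac)
    qed
    have "(\<lambda>n. P n * (Gamma (c + of_nat (Suc n)) * suminf (gauss_term a b (c + of_nat (Suc n))))) \<longlonglongrightarrow> 
        (rGamma (c - a) * rGamma (c - b) / (rGamma (c - a - b) * rGamma c) * rGamma c) * 1"
      by (intro tendsto_mult P LIMSEQ_Suc[OF gauss_limit[OF c cab]])
    moreover have "P n * (Gamma (c + of_nat (Suc n)) * suminf (gauss_term a b (c + of_nat (Suc n)))) =
        suminf (gauss_term a b c)" for n
    proof -
      have "c + of_nat (Suc n) \<notin> \<int>\<^sub>\<le>\<^sub>0" using nonpos_Int_Re_le[of "c + of_nat (Suc n)"] c by auto
      hence "Gamma (c + of_nat (Suc n)) \<noteq> 0" using Gamma_eq_zero_iff by blast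
      thus ?thesis
        unfolding P' using gauss_iterated[OF cab, of "Suc n"] pz(2)[of "Suc n"] by (simp add: field_simps)
    qed
    ultimately have "suminf (gauss_term a b c) = rGamma (c - a) * rGamma (c - b) / (rGamma (c - a - b) * rGamma c) * rGamma c"
      using LIMSEQ_unique[OF tendsto_const] by auto
    thus ?thesis using c' by (simp add: Gamma_def rGamma_eq_zero_iff divide_simps)
  qed
  obtain m :: nat where "- Re c < real m" using reals_Archimedean2 by blast
  hence m: "Re c + m > 0" by simp
  thus ?thesis using cab
  proof (induction m arbitrary: c)
    case 0
    thus ?case using base by simp
  next
    case (Suc m)
    have nz: "c - a - b \<noteq> 0" using Suc.prems by auto
    have IH: "suminf (gauss_term a b (c + 1)) = Gamma (c + 1 - a - b) * rGamma (c + 1 - a) * rGamma (c + 1 - b)"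
      by (rule Suc.IH) (use Suc.prems in auto)
    have "(c - a - b) * suminf (gauss_term a b c) = (c - a) * (c - b) * suminf (gauss_term a b (c + 1))"
      by (rule gauss_contiguous) fact
    also have "\<dots> = Gamma ((c - a - b) + 1) * ((c - a) * rGamma ((c - a) + 1)) * ((c - b) * rGamma ((c - b) + 1))"
      unfolding IH by (simp add: algebra_simps)
    also have "\<dots> = (c - a - b) * Gamma (c - a - b) * rGamma (c - a) * rGamma (c - b)"
      using Suc.prems nonpos_Int_Re_le[of "c - a - b"]
      by (subst Gamma_plus1) (auto simp: rGamma_plus1)
    finally show ?case using nz by simp
  qed
qed

section \<open>Double series and binomial series\<close>

text \<open>The two ways in which absolutely convergent double series are summed below: by rows, and along the
  antidiagonals as in a product of power series.\<close>

lemma double_series: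
  fixes T :: "nat \<Rightarrow> nat \<Rightarrow> 'a :: banach"
  assumes row: "\<And>k. summable (\<lambda>l. norm (T k l))"
      and rows: "summable (\<lambda>k. \<Sum>l. norm (T k l))"
    shows double_series_rows: "(\<lambda>k. \<Sum>l. T k l) sums infsum (\<lambda>(k, l). T k l) UNIV"
      and double_series_diag: "(\<lambda>n. \<Sum>k\<le>n. T k (n - k)) sums infsum (\<lambda>(k, l). T k l) UNIV"
proof -
  have "(\<lambda>(k, l). norm (T k l)) summable_on Sigma UNIV (\<lambda>_. UNIV)"
  proof (rule summable_on_SigmaI[where g = "\<lambda>k. \<Sum>l. norm (T k l)"])
    show "((\<lambda>l. case (k, l) of (k, l) \<Rightarrow> norm (T k l)) has_sum (\<Sum>l. norm (T k l))) UNIV" for k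
      using row[of k] by (auto intro!: sums_nonneg_imp_has_sum summable_sums)
    show "(\<lambda>k. \<Sum>l. norm (T k l)) summable_on UNIV"
      using rows row by (intro norm_summable_imp_summable_on) (simp add: suminf_nonneg)
  qed auto
  hence "(\<lambda>(k, l). norm (T k l)) summable_on UNIV" by simp
  hence "(\<lambda>(k, l). T k l) summable_on UNIV"
    by (intro abs_summable_summable[of "\<lambda>(k, l). T k l"]) (simp add: case_prod_unfold)
  hence hs: "((\<lambda>(k, l). T k l) has_sum infsum (\<lambda>(k, l). T k l) UNIV) UNIV" by simp
  have "((\<lambda>k. \<Sum>l. T k l) has_sum infsum (\<lambda>(k, l). T k l) UNIV) UNIV"
  proof (rule has_sum_SigmaD[where B = "\<lambda>_. UNIV"])
    show "((\<lambda>(k, l). T k l) has_sum infsum (\<lambda>(k, l). T k l) UNIV) (UNIV \<times> UNIV)" using hs by simp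
    show "((\<lambda>l. case (k, l) of (k, l) \<Rightarrow> T k l) has_sum (\<Sum>l. T k l)) UNIV" for k
      using row[of k] by (auto intro!: norm_summable_imp_has_sum summable_sums intro: summable_norm_cancel)
  qed
  thus "(\<lambda>k. \<Sum>l. T k l) sums infsum (\<lambda>(k, l). T k l) UNIV" by (rule has_sum_imp_sums)
  have "((\<lambda>(n, k). T k (n - k)) has_sum infsum (\<lambda>(k, l). T k l) UNIV) (SIGMA n:UNIV. {..n}) \<longleftrightarrow>
        ((\<lambda>(k, l). T k l) has_sum infsum (\<lambda>(k, l). T k l) UNIV) UNIV"
    by (rule has_sum_reindex_bij_witness[of _ "\<lambda>(k, l). (k + l, k)" "\<lambda>(n, k). (k, n - k)"]) auto
  hence "((\<lambda>(n, k). T k (n - k)) has_sum infsum (\<lambda>(k, l). T k l) UNIV) (SIGMA n:UNIV. {..n})"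
    using hs by simp
  hence "((\<lambda>n. \<Sum>k\<le>n. T k (n - k)) has_sum infsum (\<lambda>(k, l). T k l) UNIV) UNIV"
    by (rule has_sum_SigmaD) (auto intro: has_sum_finiteI)
  thus "(\<lambda>n. \<Sum>k\<le>n. T k (n - k)) sums infsum (\<lambda>(k, l). T k l) UNIV" by (rule has_sum_imp_sums)
qed

text \<open>The antidiagonals up to \<open>K + L\<close> cover the rectangle with sides \<open>K\<close> and \<open>L\<close>, so that their total
  bounds all finite rectangular sums.\<close>

lemma double_series_of_diag:
  fixes T :: "nat \<Rightarrow> nat \<Rightarrow> 'a :: banach"
  assumes sm: "summable (\<lambda>n. \<Sum>k\<le>n. norm (T k (n - k)))"
  shows "\<And>k. summable (\<lambda>l. norm (T k l))" "summable (\<lambda>k. \<Sum>l. norm (T k l))"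
proof -
  define S where "S = (\<Sum>n. \<Sum>k\<le>n. norm (T k (n - k)))"
  have box: "(\<Sum>k<K. \<Sum>l<L. norm (T k l)) \<le> S" for K L
  proof -
    have "(\<Sum>k<K. \<Sum>l<L. norm (T k l)) = (\<Sum>(k, l)\<in>{..<K} \<times> {..<L}. norm (T k l))"
      by (rule sum.cartesian_product)
    also have "\<dots> = (\<Sum>(n, k)\<in>(\<lambda>(k, l). (k + l, k)) ` ({..<K} \<times> {..<L}). norm (T k (n - k)))"
      by (subst sum.reindex) (auto simp: inj_on_def intro!: sum.cong)
    also have "\<dots> \<le> (\<Sum>(n, k)\<in>(SIGMA n:{..<K + L}. {..n}). norm (T k (n - k)))"
      by (rule sum_mono2) auto
    also have "\<dots> = (\<Sum>n<K + L. \<Sum>k\<le>n. norm (T k (n - k)))"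
      by (rule sum.Sigma[symmetric]) auto
    also have "\<dots> \<le> S" unfolding S_def by (intro sum_le_suminf sm) (auto intro: sum_nonneg)
    finally show ?thesis .
  qed
  show row: "summable (\<lambda>l. norm (T k l))" for k
  proof (rule summableI_nonneg_bounded)
    fix L
    have "(\<Sum>l<L. norm (T k l)) \<le> (\<Sum>k<Suc k. \<Sum>l<L. norm (T k l))"
      by (simp add: sum_nonneg)
    thus "(\<Sum>l<L. norm (T k l)) \<le> S" using box[where K = "Suc k" and L = L] by linarith
  qed auto
  show "summable (\<lambda>k. \<Sum>l. norm (T k l))"
  proof (rule summableI_nonneg_bounded)
    fix K
    have "(\<Sum>k<K. \<Sum>l. norm (T k l)) = (\<Sum>l. \<Sum>k<K. norm (T k l))"
      by (rule suminf_sum[symmetric]) (rule row)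
    also have "\<dots> \<le> S"
    proof (rule suminf_le_const)
      show "summable (\<lambda>l. \<Sum>k<K. norm (T k l))" by (intro summable_sum row)
      fix L show "(\<Sum>l<L. \<Sum>k<K. norm (T k l)) \<le> S" using box[where K = K and L = L] by (subst sum.swap)
    qed
    finally show "(\<Sum>k<K. \<Sum>l. norm (T k l)) \<le> S" .
  qed (use row in \<open>auto intro: suminf_nonneg\<close>)
qed

lemma summable_powr_geometric:
  fixes r s :: real
  assumes "0 \<le> r" "r < 1"
  shows "summable (\<lambda>n. (real n + 1) powr s * r ^ n)"
proof -
  \<comment> \<open>With \<open>r < x * q\<close> and \<open>x, q < 1\<close>, the power of \<open>x\<close> absorbs the polynomial factor and \<open>q\<close> remains.\<close>
  define q where "q = (1 + r) / 2"
  have q: "0 < q" "q < 1" "r < q" using assms by (auto simp: q_def)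
  define x where "x = (r + q) / 2 / q"
  have x: "0 < x" "x < 1" "r < x * q" using q assms by (auto simp: x_def)
  have "((\<lambda>n. (real n + 1) powr s * x ^ n) \<longlongrightarrow> 0) sequentially"
    using x by real_asymp
  hence ev: "\<forall>\<^sub>F n in sequentially. (real n + 1) powr s * x ^ n < 1"
    by (rule order_tendstoD) auto
  show ?thesis
  proof (rule summable_comparison_test_ev)
    show "\<forall>\<^sub>F n in sequentially. norm ((real n + 1) powr s * r ^ n) \<le> q ^ n"
      using ev
    proof eventually_elim
      case (elim n)
      have "(real n + 1) powr s * r ^ n \<le> (real n + 1) powr s * (x * q) ^ n"
        using x assms by (intro mult_left_mono power_mono) auto
      also have "\<dots> = (real n + 1) powr s * x ^ n * q ^ n" by (simp add: power_mult_distrib)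
      also have "\<dots> \<le> 1 * q ^ n" using elim q by (intro mult_right_mono) auto
      finally show ?case using assms by simp
    qed
    show "summable ((^) q)" using q by (intro summable_geometric) auto
  qed
qed

lemma binomial_series_complex:
  fixes z :: complex
  assumes "cmod z < 1"
  shows "(\<lambda>m. pochhammer a m / fact m * z ^ m) sums (1 - z) powr (- a)"
proof -
  have "(\<lambda>m. (- a gchoose m) * (- z) ^ m) sums (1 + (- z)) powr (- a)"
    by (rule gen_binomial_complex) (use assms in auto)
  moreover have "(- a gchoose m) * (- z) ^ m = pochhammer a m / fact m * z ^ m" for m
    by (simp add: gbinomial_pochhammer power_minus[of z] field_simps)
  ultimately show ?thesis by simp
qed

lemma binomial_series_real:
  fixes z :: real
  assumes "\<bar>z\<bar> < 1"
  shows "(\<lambda>m. pochhammer a m / fact m * z ^ m) sums (1 - z) powr (- a)"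
proof -
  have "(\<lambda>m. (- a gchoose m) * (- z) ^ m) sums (1 + (- z)) powr (- a)"
    by (rule gen_binomial_real) (use assms in auto)
  moreover have "(- a gchoose m) * (- z) ^ m = pochhammer a m / fact m * z ^ m" for m
    by (simp add: gbinomial_pochhammer power_minus[of z] field_simps)
  ultimately show ?thesis by simp
qed

section \<open>Pfaff's transformation and the continuation of the hypergeometric function\<close>

lemma norm_hypergeo_coeff:
  assumes "c \<notin> \<int>\<^sub>\<le>\<^sub>0"
  obtains C s where "C > 0" "\<And>n. cmod (pochhammer a n * pochhammer b n / (pochhammer c n * fact n)) \<le> C * (real n + 1) powr s"
proof -
  obtain A where A: "A > 0" "\<And>n. cmod (pochhammer a n) \<le> A * (fact n * (real n + 1) powr (Re a - 1))"
    using norm_pochhammer_upper by blast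
  obtain B where B: "B > 0" "\<And>n. cmod (pochhammer b n / pochhammer c n) \<le> B * (real n + 1) powr (Re b - Re c)"
    using norm_pochhammer_ratio[OF assms] by blast
  show ?thesis
  proof (rule that[of "A * B"])
    fix n
    have "cmod (pochhammer a n * pochhammer b n / (pochhammer c n * fact n)) = 
       cmod (pochhammer a n) * cmod (pochhammer b n / pochhammer c n) / fact n"
      by (simp add: norm_mult norm_divide)
    also have "\<dots> \<le> (A * (fact n * (real n + 1) powr (Re a - 1))) * (B * (real n + 1) powr (Re b - Re c)) / fact n"
      using A B by (intro divide_right_mono mult_mono) auto
    also have "\<dots> = A * B * ((real n + 1) powr (Re a - 1) * (real n + 1) powr (Re b - Re c))" by simp
    also have "\<dots> = A * B * ((real n + 1) powr (Re a - 1 + (Re b - Re c)))"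
      by (simp only: powr_add)
    finally show "cmod (pochhammer a n * pochhammer b n / (pochhammer c n * fact n)) \<le> A * B * (real n + 1) powr (Re a - 1 + (Re b - Re c))" .
  qed (use A B in auto)
qed

lemma summable_norm_hypergeo:
  assumes "c \<notin> \<int>\<^sub>\<le>\<^sub>0" "0 \<le> r" "r < 1"
  shows "summable (\<lambda>n. cmod (pochhammer a n * pochhammer b n / (pochhammer c n * fact n)) * r ^ n)"
proof -
  obtain C s where C: "C > 0" "\<And>n. cmod (pochhammer a n * pochhammer b n / (pochhammer c n * fact n)) \<le> C * (real n + 1) powr s"
    using norm_hypergeo_coeff[OF assms(1)] by blast
  show ?thesis
  proof (rule summable_comparison_test_ev)
    show "summable (\<lambda>n. C * ((real n + 1) powr s * r ^ n))"
      using assms by (intro summable_mult summable_powr_geometric)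
    show "\<forall>\<^sub>F n in sequentially. norm (cmod (pochhammer a n * pochhammer b n / (pochhammer c n * fact n)) * r ^ n) \<le> C * ((real n + 1) powr s * r ^ n)"
      using mult_right_mono[OF C(2), of "r ^ n" for n] assms by (intro always_eventually allI) (simp add: abs_mult mult.assoc)
  qed
qed

lemma hypergeo_2F1_series_sums:
  assumes "c \<notin> \<int>\<^sub>\<le>\<^sub>0" "cmod z < 1"
  shows "(\<lambda>n. pochhammer a n * pochhammer b n / (pochhammer c n * fact n) * z ^ n) sums hypergeo_2F1_series a b c z"
proof -
  have "summable (\<lambda>n. cmod (pochhammer a n * pochhammer b n / (pochhammer c n * fact n) * z ^ n))"
    using summable_norm_hypergeo[OF assms(1), of "cmod z" a b] assms(2)
    by (simp only: norm_mult norm_power norm_divide norm_ge_zero simp_thms)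
  hence "summable (\<lambda>n. pochhammer a n * pochhammer b n / (pochhammer c n * fact n) * z ^ n)"
    by (rule summable_norm_cancel)
  thus ?thesis by (simp add: hypergeo_2F1_series_def sums_iff field_simps)
qed

lemma holomorphic_hypergeo_2F1_series:
  assumes "c \<notin> \<int>\<^sub>\<le>\<^sub>0"
  shows "hypergeo_2F1_series a b c holomorphic_on ball 0 1"
proof (rule power_series_holomorphic)
  fix w :: complex
  assume "w \<in> ball 0 1"
  thus "(\<lambda>n. pochhammer a n * pochhammer b n / (pochhammer c n * fact n) * (w - 0) ^ n) sums hypergeo_2F1_series a b c w"
    using hypergeo_2F1_series_sums[OF assms, of w a b] by simp
qed

text \<open>Two continuations to star-shaped sets agree on the intersection, which is star-shaped and hence
  connected, by the identity theorem; the value described by \<open>hypergeo_2F1\<close> is therefore unique.\<close>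

lemma hypergeo_2F1_eqI:
  assumes S: "open S" "z \<in> S" "\<And>y. y \<in> S \<Longrightarrow> closed_segment 0 y \<subseteq> S"
      and f: "f holomorphic_on S" "\<And>y. y \<in> S \<Longrightarrow> y \<in> ball 0 1 \<Longrightarrow> f y = hypergeo_2F1_series a b c y"
    shows "hypergeo_2F1 a b c z = f z"
  unfolding hypergeo_2F1_def
proof (rule the_equality)
  show "\<exists>S g. open S \<and> z \<in> S \<and> (\<forall>y\<in>S. closed_segment 0 y \<subseteq> S) \<and> g holomorphic_on S \<and>
        (\<forall>y\<in>S \<inter> ball 0 1. g y = hypergeo_2F1_series a b c y) \<and> f z = g z"
    using assms by (intro exI[of _ S] exI[of _ f]) auto
next
  fix w
  assume "\<exists>S f. open S \<and> z \<in> S \<and> (\<forall>y\<in>S. closed_segment 0 y \<subseteq> S) \<and> f holomorphic_on S \<and>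
        (\<forall>y\<in>S \<inter> ball 0 1. f y = hypergeo_2F1_series a b c y) \<and> w = f z"
  then obtain S' g where g: "open S'" "z \<in> S'" "\<And>y. y \<in> S' \<Longrightarrow> closed_segment 0 y \<subseteq> S'"
    "g holomorphic_on S'" "\<And>y. y \<in> S' \<Longrightarrow> y \<in> ball 0 1 \<Longrightarrow> g y = hypergeo_2F1_series a b c y" "w = g z"
    by blast
  have 0: "0 \<in> S" "0 \<in> S'" using S g ends_in_segment(1)[of 0 z] by blast+
  have "g z = f z"
  proof (rule analytic_continuation_open[of "S \<inter> S' \<inter> ball 0 1" "S \<inter> S'" g f])
    have "starlike (S \<inter> S')" unfolding starlike_def using 0 S(3) g(3) by (intro bexI[of _ 0]) auto
    thus "connected (S \<inter> S')" by (rule starlike_imp_connected)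
    show "S \<inter> S' \<inter> ball 0 1 \<noteq> {}" using 0 by (auto intro!: exI[of _ 0])
    show "f holomorphic_on S \<inter> S'" "g holomorphic_on S \<inter> S'"
      using f(1) g(4) by (auto intro: holomorphic_on_subset)
  qed (use S g f in auto)
  thus "w = f z" using g by simp
qed

text \<open>The binomial theorem for Pochhammer symbols, after reflection of the last factor:
  \<open>(c + n)\<^sub>N\<^sub>-\<^sub>n\<close> is up to sign \<open>(1 - c - N)\<^sub>N\<^sub>-\<^sub>n\<close>, and the two parameters then add up to \<open>1 - b - N\<close>.\<close>

lemma chu_vandermonde:
  fixes b c :: complex
  shows "(\<Sum>n\<le>N. (-1) ^ n * of_nat (N choose n) * pochhammer (c - b) n * pochhammer (c + of_nat n) (N - n)) = pochhammer b N"
proof -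
  have "(\<Sum>n\<le>N. (-1) ^ n * of_nat (N choose n) * pochhammer (c - b) n * pochhammer (c + of_nat n) (N - n)) =
        (\<Sum>n\<le>N. (-1) ^ N * (of_nat (N choose n) * pochhammer (c - b) n * pochhammer (1 - c - of_nat N) (N - n)))"
  proof (rule sum.cong)
    fix n assume n: "n \<in> {..N}"
    have "pochhammer (1 - c - of_nat N) (N - n) = pochhammer (- (c + of_nat N - 1)) (N - n)"
      by (simp add: algebra_simps)
    also have "\<dots> = (-1) ^ (N - n) * pochhammer (c + of_nat N - 1 - of_nat (N - n) + 1) (N - n)"
      by (rule pochhammer_minus)
    also have "c + of_nat N - 1 - of_nat (N - n) + 1 = c + of_nat n" using n by (simp add: of_nat_diff)
    finally have "pochhammer (1 - c - of_nat N) (N - n) = (-1) ^ (N - n) * pochhammer (c + of_nat n) (N - n)" .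
    moreover have "(-1) ^ N * (-1) ^ (N - n) = ((-1) ^ n :: complex)"
      using n by (simp add: power_add[symmetric] minus_one_power_iff)
    ultimately show "(-1) ^ n * of_nat (N choose n) * pochhammer (c - b) n * pochhammer (c + of_nat n) (N - n) =
        (-1) ^ N * (of_nat (N choose n) * pochhammer (c - b) n * pochhammer (1 - c - of_nat N) (N - n))"
      by (simp add: mult_ac)
  qed auto
  also have "\<dots> = (-1) ^ N * pochhammer ((c - b) + (1 - c - of_nat N)) N"
    by (simp only: pochhammer_binomial_sum sum_distrib_left)
  also have "(c - b) + (1 - c - of_nat N) = - (b + of_nat N - 1)" by simp
  also have "(-1) ^ N * pochhammer (- (b + of_nat N - 1)) N = (-1) ^ N * ((-1) ^ N * pochhammer (b + of_nat N - 1 - of_nat N + 1) N)"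
    by (subst pochhammer_minus) simp
  also have "\<dots> = pochhammer b N" by (simp add: mult.assoc[symmetric] power_mult_distrib[symmetric])
  finally show ?thesis .
qed

lemma norm_div_minus_one:
  fixes v :: complex
  assumes "Re v < 1/2"
  shows "cmod (v / (v - 1)) < 1"
proof -
  have "(cmod v)\<^sup>2 < (cmod (v - 1))\<^sup>2"
    using assms unfolding cmod_power2 by (simp add: power2_eq_square algebra_simps)
  hence "cmod v < cmod (v - 1)" by (rule power2_less_imp_less) simp
  thus ?thesis by (simp add: norm_divide divide_simps)
qed

text \<open>Expansion of each \<open>(1 - v)\<^bsup>- a - n\<^esup>\<close> gives a double series whose antidiagonal sums are evaluated by
  the Chu--Vandermonde identity. The series of absolute values converges when
  \<open>\<bar>v\<bar> / (1 - \<bar>v\<bar>) < 1\<close>, and \<open>1/3\<close> is a radius for which this holds.\<close>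

lemma pfaff_near_0:
  assumes c: "c \<notin> \<int>\<^sub>\<le>\<^sub>0" and v: "cmod v < 1/3"
  shows "(1 - v) powr (-a) * hypergeo_2F1_series a (c - b) c (v / (v - 1)) = hypergeo_2F1_series a b c v"
proof -
  define r where "r = cmod v"
  have r: "0 \<le> r" "r < 1/3" using v by (auto simp: r_def)
  have v1: "v \<noteq> 1" using v by auto
  define q where "q = (\<lambda>n. pochhammer a n * pochhammer (c - b) n / (pochhammer c n * fact n))"
  define T where "T = (\<lambda>n m. q n * (-v) ^ n * (pochhammer (a + of_nat n) m / fact m * v ^ m))"
  define A where "A = cmod a"
  have pb: "(\<lambda>m. pochhammer (A + n) m / fact m * r ^ m) sums (1 - r) powr (- (A + n))" for n :: nat
    by (rule binomial_series_real) (use r in auto)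
  have Tle: "cmod (T n m) \<le> cmod (q n) * r ^ n * (pochhammer (A + n) m / fact m * r ^ m)" for n m
  proof -
    have ple: "cmod (pochhammer (a + of_nat n) m) \<le> pochhammer (A + n) m"
      by (intro norm_pochhammer_le norm_triangle_le) (simp add: A_def)
    have "cmod (T n m) = cmod (q n) * r ^ n * (cmod (pochhammer (a + of_nat n) m) / fact m * r ^ m)"
      by (simp add: T_def norm_mult norm_power norm_divide r_def)
    also have "\<dots> \<le> cmod (q n) * r ^ n * (pochhammer (A + n) m / fact m * r ^ m)"
      using r by (intro mult_left_mono mult_right_mono divide_right_mono ple) auto
    finally show ?thesis .
  qed
  have row: "summable (\<lambda>m. cmod (T n m))" for n
    by (rule summable_comparison_test_ev[OF _ summable_mult[OF sums_summable[OF pb[of n]], of "cmod (q n) * r ^ n"]])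
       (use Tle in auto)
  have rowle: "(\<Sum>m. cmod (T n m)) \<le> cmod (q n) * (r / (1 - r)) ^ n * (1 - r) powr (-A)" for n
  proof -
    have "(\<Sum>m. cmod (T n m)) \<le> (\<Sum>m. cmod (q n) * r ^ n * (pochhammer (A + n) m / fact m * r ^ m))"
      by (intro suminf_le Tle row summable_mult sums_summable[OF pb])
    also have "\<dots> = cmod (q n) * r ^ n * (1 - r) powr (- (A + n))"
      by (rule sums_unique[symmetric], rule sums_mult, rule pb)
    also have "(1 - r) powr (- (A + n)) = (1 - r) powr (-A) * (1 - r) powr (- real n)"
      by (simp only: powr_add[symmetric] minus_add_distrib)
    also have "(1 - r) powr (- real n) = 1 / (1 - r) ^ n"
      using r by (subst powr_minus, subst powr_realpow) (auto simp: field_simps)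
    finally show ?thesis by (simp add: power_divide)
  qed
  have rows: "summable (\<lambda>n. \<Sum>m. cmod (T n m))"
  proof (rule summable_comparison_test_ev)
    show "summable (\<lambda>n. cmod (q n) * (r / (1 - r)) ^ n * (1 - r) powr (-A))"
      unfolding q_def using r c by (intro summable_mult2 summable_norm_hypergeo) (auto simp: field_simps)
    show "\<forall>\<^sub>F n in sequentially. norm (\<Sum>m. cmod (T n m)) \<le> cmod (q n) * (r / (1 - r)) ^ n * (1 - r) powr (-A)"
      using rowle row by (intro always_eventually allI) (simp add: suminf_nonneg)
  qed
  have "(\<Sum>m. T n m) = q n * (v / (v - 1)) ^ n * (1 - v) powr (- a)" for n
  proof -
    have "T n sums (q n * (-v) ^ n * (1 - v) powr (- (a + of_nat n)))"
      unfolding T_def by (intro sums_mult binomial_series_complex) (use v in auto)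
    hence "(\<Sum>m. T n m) = q n * (-v) ^ n * (1 - v) powr (- (a + of_nat n))" by (simp add: sums_iff)
    also have "(1 - v) powr (- (a + of_nat n)) = (1 - v) powr (- a) / (1 - v) ^ n"
      using v1 by (simp add: powr_diff powr_nat')
    also have "q n * (-v) ^ n * ((1 - v) powr (- a) / (1 - v) ^ n) = q n * ((-v) / (1 - v)) ^ n * (1 - v) powr (- a)"
      unfolding power_divide by simp
    also have "(-v) / (1 - v) = v / (v - 1)" by (metis minus_diff_eq minus_divide_divide)
    finally show ?thesis .
  qed
  hence "(\<lambda>n. q n * (v / (v - 1)) ^ n * (1 - v) powr (- a)) sums infsum (\<lambda>(k, l). T k l) UNIV"
    using double_series_rows[of T, OF row rows] by simp
  moreover have "cmod (v / (v - 1)) < 1"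
    by (rule norm_div_minus_one) (use v complex_Re_le_cmod[of v] in linarith)
  hence "(\<lambda>n. q n * (v / (v - 1)) ^ n * (1 - v) powr (- a)) sums (hypergeo_2F1_series a (c - b) c (v / (v - 1)) * (1 - v) powr (- a))"
    unfolding q_def by (intro sums_mult2 hypergeo_2F1_series_sums c)
  ultimately have 1: "infsum (\<lambda>(k, l). T k l) UNIV = hypergeo_2F1_series a (c - b) c (v / (v - 1)) * (1 - v) powr (- a)"
    using sums_unique2 by blast
  have "(\<Sum>k\<le>N. T k (N - k)) = pochhammer a N * pochhammer b N / (pochhammer c N * fact N) * v ^ N" for N
  proof -
    have pz: "pochhammer c n \<noteq> 0" for n using c pochhammer_eq_0_imp_nonpos_Int by blast
    have "T k (N - k) = pochhammer a N / (pochhammer c N * fact N) * v ^ N * 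
       ((-1) ^ k * of_nat (N choose k) * pochhammer (c - b) k * pochhammer (c + of_nat k) (N - k))" 
      if k: "k \<le> N" for k
    proof -
      have a: "pochhammer a N = pochhammer a k * pochhammer (a + of_nat k) (N - k)"
        and cc: "pochhammer c N = pochhammer c k * pochhammer (c + of_nat k) (N - k)"
        using k by (auto intro: pochhammer_product)
      have ch: "of_nat (N choose k) = (fact N / (fact k * fact (N - k)) :: complex)"
        using k by (simp add: binomial_fact)
      have vv: "v ^ N = v ^ k * v ^ (N - k)" using k by (simp add: power_add[symmetric])
      have nz: "pochhammer (c + of_nat k) (N - k) \<noteq> 0" using pz[of N] cc by auto
      have mv: "(-v) ^ k = (-1) ^ k * v ^ k" by (rule power_minus)
      show ?thesis unfolding T_def q_def a cc ch vv mv using nz pz[of k] by (simp add: field_simps)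
    qed
    hence "(\<Sum>k\<le>N. T k (N - k)) = (\<Sum>k\<le>N. pochhammer a N / (pochhammer c N * fact N) * v ^ N * 
       ((-1) ^ k * of_nat (N choose k) * pochhammer (c - b) k * pochhammer (c + of_nat k) (N - k)))"
      by (intro sum.cong) auto
    also have "\<dots> = pochhammer a N / (pochhammer c N * fact N) * v ^ N * pochhammer b N"
      by (simp only: sum_distrib_left[symmetric] chu_vandermonde)
    finally show ?thesis by simp
  qed
  hence "(\<lambda>N. pochhammer a N * pochhammer b N / (pochhammer c N * fact N) * v ^ N) sums infsum (\<lambda>(k, l). T k l) UNIV"
    using double_series_diag[of T, OF row rows] by simp
  moreover have "(\<lambda>N. pochhammer a N * pochhammer b N / (pochhammer c N * fact N) * v ^ N) sums hypergeo_2F1_series a b c v"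
    by (rule hypergeo_2F1_series_sums) (use c v in auto)
  ultimately show ?thesis using 1 sums_unique2 by (metis mult.commute)
qed

text \<open>The transformed series is holomorphic on the half-plane \<open>Re v < 1/2\<close>. This is star-shaped with
  respect to \<open>0\<close> and contains the nonpositive real numbers, where the MSM kernel evaluates \<open>\<^sub>2F\<^sub>1\<close>.\<close>

theorem hypergeo_2F1_pfaff:
  assumes c: "c \<notin> \<int>\<^sub>\<le>\<^sub>0" and v: "Re v < 1/2"
  shows "hypergeo_2F1 a b c v = (1 - v) powr (-a) * hypergeo_2F1_series a (c - b) c (v / (v - 1))"
    and "cmod v < 1 \<Longrightarrow> hypergeo_2F1 a b c v = hypergeo_2F1_series a b c v"
proof -
  define S :: "complex set" where "S = {v. Re v < 1/2}"
  define f where "f = (\<lambda>v. (1 - v) powr (-a) * hypergeo_2F1_series a (c - b) c (v / (v - 1)))"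
  have S: "open S" "convex S" "0 \<in> S"
    unfolding S_def by (rule open_halfspace_Re_lt, rule convex_halfspace_Re_lt, simp)
  have "(hypergeo_2F1_series a (c - b) c \<circ> (\<lambda>v. v / (v - 1))) holomorphic_on S"
    by (rule holomorphic_on_compose_gen[OF _ holomorphic_hypergeo_2F1_series[OF c]])
       (auto intro!: holomorphic_intros norm_div_minus_one simp: S_def dist_norm)
  hence "(\<lambda>v. hypergeo_2F1_series a (c - b) c (v / (v - 1))) holomorphic_on S" by (simp add: o_def)
  moreover have "(\<lambda>v. (1 - v) powr (-a)) holomorphic_on S"
    by (intro holomorphic_intros) (auto simp: S_def complex_nonpos_Reals_iff)
  ultimately have f: "f holomorphic_on S" unfolding f_def by (rule holomorphic_on_mult[rotated])
  have agree: "f y = hypergeo_2F1_series a b c y" if "y \<in> S" "y \<in> ball 0 1" for y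
  proof (rule analytic_continuation_open[of "ball 0 (1/3)" "S \<inter> ball 0 1" f])
    show "connected (S \<inter> ball 0 1)" using S by (intro convex_connected convex_Int) auto
    have "Re z < 1/2" if "cmod z < 1/3" for z using that complex_Re_le_cmod[of z] by linarith
    thus "ball 0 (1/3) \<subseteq> S \<inter> ball 0 1" by (auto simp: S_def)
    show "f holomorphic_on S \<inter> ball 0 1" using f by (rule holomorphic_on_subset) auto
    show "hypergeo_2F1_series a b c holomorphic_on S \<inter> ball 0 1"
      using holomorphic_hypergeo_2F1_series[OF c] by (rule holomorphic_on_subset) auto
    show "f z = hypergeo_2F1_series a b c z" if "z \<in> ball 0 (1/3)" for z
      unfolding f_def by (rule pfaff_near_0[OF c]) (use that in auto)
  qed (use S that in auto)
  have seg: "closed_segment 0 y \<subseteq> S" if "y \<in> S" for y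
    using S that by (intro closed_segment_subset) auto
  have "hypergeo_2F1 a b c v = f v"
    by (rule hypergeo_2F1_eqI[OF S(1) _ seg f agree]) (use v in \<open>auto simp: S_def\<close>)
  thus "hypergeo_2F1 a b c v = (1 - v) powr (-a) * hypergeo_2F1_series a (c - b) c (v / (v - 1))"
    by (simp add: f_def)
  show "hypergeo_2F1 a b c v = hypergeo_2F1_series a b c v" if "cmod v < 1"
    using agree[of v] \<open>hypergeo_2F1 a b c v = f v\<close> that v by (auto simp: S_def)
qed

section \<open>Appell's function on the curve of the MSM kernel\<close>

text \<open>If \<open>x\<close> is a nonpositive integer, then \<open>(x + k)\<^sub>l\<close> is not the quotient of \<open>(x)\<^sub>k\<^sub>+\<^sub>l\<close> by \<open>(x)\<^sub>k\<close>, as the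
  latter may vanish. Replacing \<open>x\<close> by \<open>x + \<i>\<close> enlarges every factor and preserves the real part, which is all
  that the size depends on.\<close>

lemma pochhammer_majorant:
  fixes x :: complex
  obtains x' where "Re x' = Re x" "x' \<notin> \<int>\<^sub>\<le>\<^sub>0"
    "\<And>k l. cmod (pochhammer (x + of_nat k) l) \<le> cmod (pochhammer (x' + of_nat k) l)"
proof (cases "x \<in> \<int>\<^sub>\<le>\<^sub>0")
  case False
  thus ?thesis using that[of x] by simp
next
  case True
  then obtain m where m: "x = - of_nat m" by (elim nonpos_Ints_cases')
  show ?thesis
  proof (rule that[of "x + \<i>"])
    show "x + \<i> \<notin> \<int>\<^sub>\<le>\<^sub>0" using m by (auto elim!: nonpos_Ints_cases simp: complex_eq_iff)
    fix k l
    show "cmod (pochhammer (x + of_nat k) l) \<le> cmod (pochhammer (x + \<i> + of_nat k) l)"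
      unfolding pochhammer_prod prod_norm[symmetric]
    proof (intro prod_mono conjI)
      fix i
      show "cmod (x + of_nat k + of_nat i) \<le> cmod (x + \<i> + of_nat k + of_nat i)"
        unfolding cmod_def m by (intro real_sqrt_le_mono) simp
    qed auto
  qed simp
qed

text \<open>The double series for \<open>F\<^sub>3(\<alpha>, \<alpha>', \<beta>, \<beta>'; \<gamma>; y, y / (y - 1))\<close> after Pfaff's transformation of the
  series in the second argument; the factor \<open>(1 - y)\<^bsup>\<alpha>'\<^esup>\<close> is split off, and the terms carry \<open>y\<^bsup>k + l\<^esup>\<close>.\<close>

definition F3_term :: "complex \<Rightarrow> complex \<Rightarrow> complex \<Rightarrow> complex \<Rightarrow> complex \<Rightarrow> nat \<Rightarrow> nat \<Rightarrow> complex" where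
  "F3_term \<alpha> \<alpha>' \<beta> \<beta>' \<gamma> k l =
     pochhammer \<alpha> k * pochhammer \<beta> k * pochhammer \<alpha>' l * pochhammer (\<gamma> - \<beta>' + of_nat k) l /
     (pochhammer \<gamma> (k + l) * fact k * fact l)"

definition F3_coeff :: "complex \<Rightarrow> complex \<Rightarrow> complex \<Rightarrow> complex \<Rightarrow> complex \<Rightarrow> nat \<Rightarrow> complex" where
  "F3_coeff \<alpha> \<alpha>' \<beta> \<beta>' \<gamma> n = (\<Sum>k\<le>n. F3_term \<alpha> \<alpha>' \<beta> \<beta>' \<gamma> k (n - k))"

definition F3_diag :: "complex \<Rightarrow> complex \<Rightarrow> complex \<Rightarrow> complex \<Rightarrow> complex \<Rightarrow> complex \<Rightarrow> complex" where
  "F3_diag \<alpha> \<alpha>' \<beta> \<beta>' \<gamma> y = (\<Sum>n. F3_coeff \<alpha> \<alpha>' \<beta> \<beta>' \<gamma> n * y ^ n)"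

text \<open>The term is a product of four quotients of Pochhammer symbols, each of which has the size of a power
  of its index.\<close>

lemma norm_F3_term:
  assumes "\<gamma> \<notin> \<int>\<^sub>\<le>\<^sub>0"
  obtains C where "C > 0"
    "\<And>k l. cmod (F3_term \<alpha> \<alpha>' \<beta> \<beta>' \<gamma> k l) \<le> C * ((real k + 1) powr (Re (\<alpha> + \<beta> - \<gamma> + \<beta>') - 1) *
        (real l + 1) powr (Re \<alpha>' - 1) * (real (k + l) + 1) powr (- Re \<beta>'))"
proof -
  obtain x where x: "Re x = Re (\<gamma> - \<beta>')" "x \<notin> \<int>\<^sub>\<le>\<^sub>0"
    "\<And>k l. cmod (pochhammer (\<gamma> - \<beta>' + of_nat k) l) \<le> cmod (pochhammer (x + of_nat k) l)"
    using pochhammer_majorant[of "\<gamma> - \<beta>'"] by blast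
  have xz: "pochhammer x n \<noteq> 0" for n using x(2) pochhammer_eq_0_imp_nonpos_Int by blast
  obtain C1 where C1: "C1 > 0" "\<And>n. cmod (pochhammer \<alpha> n) \<le> C1 * (fact n * (real n + 1) powr (Re \<alpha> - 1))"
    using norm_pochhammer_upper by blast
  obtain C2 where C2: "C2 > 0" "\<And>n. cmod (pochhammer \<alpha>' n) \<le> C2 * (fact n * (real n + 1) powr (Re \<alpha>' - 1))"
    using norm_pochhammer_upper by blast
  obtain C3 where C3: "C3 > 0" "\<And>n. cmod (pochhammer \<beta> n / pochhammer x n) \<le> C3 * (real n + 1) powr (Re \<beta> - Re x)"
    using norm_pochhammer_ratio[OF x(2)] by blast
  obtain C4 where C4: "C4 > 0" "\<And>n. cmod (pochhammer x n / pochhammer \<gamma> n) \<le> C4 * (real n + 1) powr (Re x - Re \<gamma>)"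
    using norm_pochhammer_ratio[OF assms] by blast
  show ?thesis
  proof (rule that[of "C1 * C2 * C3 * C4"])
    fix k l
    have "cmod (F3_term \<alpha> \<alpha>' \<beta> \<beta>' \<gamma> k l) = 
       cmod (pochhammer \<alpha> k) / fact k * cmod (pochhammer \<beta> k) * (cmod (pochhammer \<alpha>' l) / fact l) * 
       cmod (pochhammer (\<gamma> - \<beta>' + of_nat k) l) / cmod (pochhammer \<gamma> (k + l))"
      by (simp add: F3_term_def norm_mult norm_divide field_simps)
    also have "\<dots> \<le> cmod (pochhammer \<alpha> k) / fact k * cmod (pochhammer \<beta> k) * (cmod (pochhammer \<alpha>' l) / fact l) * 
       cmod (pochhammer (x + of_nat k) l) / cmod (pochhammer \<gamma> (k + l))"
      by (intro divide_right_mono mult_left_mono x(3)) auto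
    also have "cmod (pochhammer (x + of_nat k) l) = cmod (pochhammer x (k + l)) / cmod (pochhammer x k)"
      using xz[of k] by (simp add: pochhammer_product' norm_mult)
    also have "cmod (pochhammer \<alpha> k) / fact k * cmod (pochhammer \<beta> k) * (cmod (pochhammer \<alpha>' l) / fact l) * 
       (cmod (pochhammer x (k + l)) / cmod (pochhammer x k)) / cmod (pochhammer \<gamma> (k + l)) =
       (cmod (pochhammer \<alpha> k) / fact k) * (cmod (pochhammer \<alpha>' l) / fact l) * cmod (pochhammer \<beta> k / pochhammer x k) * 
        cmod (pochhammer x (k + l) / pochhammer \<gamma> (k + l))"
      by (simp add: norm_divide)
    also have "\<dots> \<le> (C1 * (real k + 1) powr (Re \<alpha> - 1)) * (C2 * (real l + 1) powr (Re \<alpha>' - 1)) *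
        (C3 * (real k + 1) powr (Re \<beta> - Re x)) * (C4 * (real (k + l) + 1) powr (Re x - Re \<gamma>))"
      using C1 C2 C3(1) C4(1) 
      by (intro mult_mono C3(2) C4(2)) (auto simp: divide_simps mult_ac)
    also have "\<dots> = C1 * C2 * C3 * C4 * (((real k + 1) powr (Re \<alpha> - 1) * (real k + 1) powr (Re \<beta> - Re x)) *
        (real l + 1) powr (Re \<alpha>' - 1) * (real (k + l) + 1) powr (Re x - Re \<gamma>))"
      by (simp only: mult_ac)
    also have "(real k + 1) powr (Re \<alpha> - 1) * (real k + 1) powr (Re \<beta> - Re x) = 
        (real k + 1) powr (Re (\<alpha> + \<beta> - \<gamma> + \<beta>') - 1)"
      using x(1) by (simp only: powr_add[symmetric]) (simp add: algebra_simps)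
    also have "Re x - Re \<gamma> = - Re \<beta>'" using x(1) by simp
    finally show "cmod (F3_term \<alpha> \<alpha>' \<beta> \<beta>' \<gamma> k l) \<le> C1 * C2 * C3 * C4 * ((real k + 1) powr (Re (\<alpha> + \<beta> - \<gamma> + \<beta>') - 1) *
        (real l + 1) powr (Re \<alpha>' - 1) * (real (k + l) + 1) powr (- Re \<beta>'))" .
  qed (use C1 C2 C3 C4 in auto)
qed

lemma F3_term_double_series:
  fixes \<alpha> \<alpha>' \<beta> \<beta>' \<gamma> y :: complex
  assumes \<gamma>: "\<gamma> \<notin> \<int>\<^sub>\<le>\<^sub>0" and y: "cmod y < 1"
  defines "T \<equiv> (\<lambda>k l. F3_term \<alpha> \<alpha>' \<beta> \<beta>' \<gamma> k l * y ^ (k + l))"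
  shows "\<And>k. summable (\<lambda>l. cmod (T k l))" and "summable (\<lambda>k. \<Sum>l. cmod (T k l))"
proof -
  define p where "p = Re (\<alpha> + \<beta> - \<gamma> + \<beta>') - 1 + \<bar>Re \<beta>'\<bar>"
  define s where "s = Re \<alpha>' - 1 + \<bar>Re \<beta>'\<bar>"
  define r where "r = cmod y"
  have r: "0 \<le> r" "r < 1" using y by (auto simp: r_def)
  obtain C where C: "C > 0"
    "\<And>k l. cmod (F3_term \<alpha> \<alpha>' \<beta> \<beta>' \<gamma> k l) \<le> C * ((real k + 1) powr (Re (\<alpha> + \<beta> - \<gamma> + \<beta>') - 1) *
        (real l + 1) powr (Re \<alpha>' - 1) * (real (k + l) + 1) powr (- Re \<beta>'))"
    using norm_F3_term[OF \<gamma>] by blast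
  have le: "cmod (T k l) \<le> (C * (real k + 1) powr p * r ^ k) * ((real l + 1) powr s * r ^ l)" for k l
  proof -
    \<comment> \<open>A crude splitting of the mixed power suffices against the geometric factor.\<close>
    have "(real (k + l) + 1) powr (- Re \<beta>') \<le> (real (k + l) + 1) powr \<bar>Re \<beta>'\<bar>"
      by (intro powr_mono) auto
    also have "\<dots> \<le> ((real k + 1) * (real l + 1)) powr \<bar>Re \<beta>'\<bar>"
      by (intro powr_mono2) (auto simp: algebra_simps)
    also have "\<dots> = (real k + 1) powr \<bar>Re \<beta>'\<bar> * (real l + 1) powr \<bar>Re \<beta>'\<bar>"
      by (simp add: powr_mult)
    finally have 1: "(real (k + l) + 1) powr (- Re \<beta>') \<le> (real k + 1) powr \<bar>Re \<beta>'\<bar> * (real l + 1) powr \<bar>Re \<beta>'\<bar>" .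
    have "cmod (F3_term \<alpha> \<alpha>' \<beta> \<beta>' \<gamma> k l) \<le> C * ((real k + 1) powr (Re (\<alpha> + \<beta> - \<gamma> + \<beta>') - 1) *
        (real l + 1) powr (Re \<alpha>' - 1) * ((real k + 1) powr \<bar>Re \<beta>'\<bar> * (real l + 1) powr \<bar>Re \<beta>'\<bar>))"
      using C(1) by (intro order_trans[OF C(2)] mult_left_mono 1) auto
    also have "\<dots> = C * (real k + 1) powr p * (real l + 1) powr s"
      by (simp add: p_def s_def powr_add mult_ac)
    finally have "cmod (F3_term \<alpha> \<alpha>' \<beta> \<beta>' \<gamma> k l) * r ^ (k + l) \<le> C * (real k + 1) powr p * (real l + 1) powr s * r ^ (k + l)"
      using r by (intro mult_right_mono) auto
    thus ?thesis by (simp add: T_def r_def norm_mult norm_power power_add mult_ac)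
  qed
  have sm: "summable (\<lambda>l. (real l + 1) powr s * r ^ l)" using r by (rule summable_powr_geometric)
  show row: "summable (\<lambda>l. cmod (T k l))" for k
    by (rule summable_comparison_test_ev[OF _ summable_mult[OF sm, of "C * (real k + 1) powr p * r ^ k"]])
       (use le in auto)
  show "summable (\<lambda>k. \<Sum>l. cmod (T k l))"
  proof (rule summable_comparison_test_ev)
    show "summable (\<lambda>k. (C * ((real k + 1) powr p * r ^ k)) * (\<Sum>l. (real l + 1) powr s * r ^ l))"
      using r by (intro summable_mult summable_mult2 summable_powr_geometric)
    show "\<forall>\<^sub>F k in sequentially. norm (\<Sum>l. cmod (T k l)) \<le> (C * ((real k + 1) powr p * r ^ k)) * (\<Sum>l. (real l + 1) powr s * r ^ l)"
    proof (intro always_eventually allI)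
      fix k
      have "(\<Sum>l. cmod (T k l)) \<le> (\<Sum>l. (C * (real k + 1) powr p * r ^ k) * ((real l + 1) powr s * r ^ l))"
        by (intro suminf_le le row summable_mult sm)
      also have "\<dots> = (C * (real k + 1) powr p * r ^ k) * (\<Sum>l. (real l + 1) powr s * r ^ l)"
        by (rule suminf_mult[OF sm])
      finally show "norm (\<Sum>l. cmod (T k l)) \<le> (C * ((real k + 1) powr p * r ^ k)) * (\<Sum>l. (real l + 1) powr s * r ^ l)"
        using row[of k] by (simp add: suminf_nonneg mult_ac)
    qed
  qed
qed

lemma F3_diag_sums:
  assumes \<gamma>: "\<gamma> \<notin> \<int>\<^sub>\<le>\<^sub>0" and y: "cmod y < 1"
  shows "(\<lambda>n. F3_coeff \<alpha> \<alpha>' \<beta> \<beta>' \<gamma> n * y ^ n) sums F3_diag \<alpha> \<alpha>' \<beta> \<beta>' \<gamma> y"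
    and "(\<lambda>k. \<Sum>l. F3_term \<alpha> \<alpha>' \<beta> \<beta>' \<gamma> k l * y ^ (k + l)) sums F3_diag \<alpha> \<alpha>' \<beta> \<beta>' \<gamma> y"
proof -
  let ?T = "\<lambda>k l. F3_term \<alpha> \<alpha>' \<beta> \<beta>' \<gamma> k l * y ^ (k + l)"
  note T = F3_term_double_series[OF \<gamma> y, of \<alpha> \<alpha>' \<beta> \<beta>']
  have "(\<lambda>n. F3_coeff \<alpha> \<alpha>' \<beta> \<beta>' \<gamma> n * y ^ n) sums infsum (\<lambda>(k, l). ?T k l) UNIV"
    using double_series_diag[of ?T, OF T] by (simp add: F3_coeff_def sum_distrib_right)
  moreover from this have "infsum (\<lambda>(k, l). ?T k l) UNIV = F3_diag \<alpha> \<alpha>' \<beta> \<beta>' \<gamma> y"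
    by (simp add: F3_diag_def sums_iff)
  ultimately show "(\<lambda>n. F3_coeff \<alpha> \<alpha>' \<beta> \<beta>' \<gamma> n * y ^ n) sums F3_diag \<alpha> \<alpha>' \<beta> \<beta>' \<gamma> y"
      "(\<lambda>k. \<Sum>l. ?T k l) sums F3_diag \<alpha> \<alpha>' \<beta> \<beta>' \<gamma> y"
    using double_series_rows[of ?T, OF T] by simp_all
qed

text \<open>For \<open>t \<le> 1/2\<close> the function \<open>Appell_F3\<close> is by definition a series of hypergeometric functions, each of
  which Pfaff's transformation turns into a power series in \<open>1 - t\<close>. For \<open>t > 1/2\<close> both arguments lie in the unit
  disc, and summation of the double series by rows leads to the same series.\<close>

theorem Appell_F3_eq_F3_diag:
  fixes t :: real
  assumes \<gamma>: "Re \<gamma> > 0" and t: "0 < t" "t < 1"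
  shows "Appell_F3 \<alpha> \<alpha>' \<beta> \<beta>' \<gamma> (of_real (1 - t)) (of_real (1 - 1 / t)) =
         of_real t powr \<alpha>' * F3_diag \<alpha> \<alpha>' \<beta> \<beta>' \<gamma> (of_real (1 - t))"
proof -
  define u v where "u = complex_of_real (1 - t)" and "v = complex_of_real (1 - 1 / t)"
  have gk: "\<gamma> + of_nat k \<notin> \<int>\<^sub>\<le>\<^sub>0" for k using nonpos_Int_Re_le[of "\<gamma> + of_nat k"] \<gamma> by auto
  have g0: "\<gamma> \<notin> \<int>\<^sub>\<le>\<^sub>0" using gk[of 0] by simp
  have u: "cmod u < 1" using t by (simp add: u_def del: of_real_diff)
  have v: "Re v < 1/2" using t by (simp add: v_def field_simps)
  have v1: "1 - v = inverse (of_real t)" by (simp add: v_def divide_inverse)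
  have vu: "v / (v - 1) = u"
    using t by (simp add: v_def u_def field_simps)
  have pw: "(1 - v) powr (- \<alpha>') = of_real t powr \<alpha>'"
  proof -
    have "complex_of_real t \<notin> \<real>\<^sub>\<le>\<^sub>0" using t by (simp add: complex_nonpos_Reals_iff)
    hence "Ln (inverse (complex_of_real t)) = - Ln (of_real t)" by (rule Ln_inverse)
    thus ?thesis unfolding v1 powr_def using t by simp
  qed
  have hyp: "hypergeo_2F1 \<alpha>' \<beta>' (\<gamma> + of_nat k) v = 
      of_real t powr \<alpha>' * hypergeo_2F1_series \<alpha>' (\<gamma> + of_nat k - \<beta>') (\<gamma> + of_nat k) u" for k
    by (subst hypergeo_2F1_pfaff(1)[OF gk v]) (simp add: pw vu)
  define K where "K = (\<lambda>k. pochhammer \<alpha> k * pochhammer \<beta> k / pochhammer \<gamma> k * (u ^ k / fact k))"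
  have row: "K k * hypergeo_2F1 \<alpha>' \<beta>' (\<gamma> + of_nat k) v = 
      of_real t powr \<alpha>' * (\<Sum>l. F3_term \<alpha> \<alpha>' \<beta> \<beta>' \<gamma> k l * u ^ (k + l))" for k
  proof -
    have "(\<lambda>l. K k * (pochhammer \<alpha>' l * pochhammer (\<gamma> + of_nat k - \<beta>') l / (pochhammer (\<gamma> + of_nat k) l * fact l) * u ^ l)) sums
       (K k * hypergeo_2F1_series \<alpha>' (\<gamma> + of_nat k - \<beta>') (\<gamma> + of_nat k) u)"
      by (intro sums_mult hypergeo_2F1_series_sums gk u)
    also have "(\<lambda>l. K k * (pochhammer \<alpha>' l * pochhammer (\<gamma> + of_nat k - \<beta>') l / (pochhammer (\<gamma> + of_nat k) l * fact l) * u ^ l)) =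
       (\<lambda>l. F3_term \<alpha> \<alpha>' \<beta> \<beta>' \<gamma> k l * u ^ (k + l))"
    proof
      fix l
      have e: "\<gamma> + of_nat k - \<beta>' = \<gamma> - \<beta>' + of_nat k" by simp
      show "K k * (pochhammer \<alpha>' l * pochhammer (\<gamma> + of_nat k - \<beta>') l / (pochhammer (\<gamma> + of_nat k) l * fact l) * u ^ l) =
       F3_term \<alpha> \<alpha>' \<beta> \<beta>' \<gamma> k l * u ^ (k + l)"
        unfolding K_def F3_term_def pochhammer_product' power_add e by (simp add: mult_ac)
    qed
    finally show ?thesis unfolding hyp by (simp add: sums_iff mult_ac)
  qed
  have S: "(\<lambda>k. K k * hypergeo_2F1 \<alpha>' \<beta>' (\<gamma> + of_nat k) v) sums (of_real t powr \<alpha>' * F3_diag \<alpha> \<alpha>' \<beta> \<beta>' \<gamma> u)"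
    unfolding row by (intro sums_mult F3_diag_sums g0 u)
  have "Appell_F3 \<alpha> \<alpha>' \<beta> \<beta>' \<gamma> u v = of_real t powr \<alpha>' * F3_diag \<alpha> \<alpha>' \<beta> \<beta>' \<gamma> u"
  proof (cases "max (cmod u) (cmod v) < 1")
    case False
    show ?thesis using sums_unique[OF S] unfolding Appell_F3_def if_not_P[OF False] K_def by simp
  next
    case True
    hence vn: "cmod v < 1" by simp
    define Q where "Q = (\<lambda>k l. pochhammer \<alpha> k * pochhammer \<alpha>' l * pochhammer \<beta> k * pochhammer \<beta>' l /
              pochhammer \<gamma> (k + l) * (u ^ k * v ^ l / (fact k * fact l)))"
    define g where "g = complex_of_real (Re \<gamma>)"
    have g: "g \<notin> \<int>\<^sub>\<le>\<^sub>0" using nonpos_Int_Re_le[of g] \<gamma> by (auto simp: g_def)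
    have pg: "cmod (pochhammer g n) = pochhammer (Re \<gamma>) n" "pochhammer (Re \<gamma>) n > 0" for n
      using \<gamma> pochhammer_pos[of "Re \<gamma>" n] by (auto simp: g_def pochhammer_of_real)
    have pgl: "pochhammer (Re \<gamma>) k * pochhammer (Re \<gamma>) l \<le> cmod (pochhammer \<gamma> (k + l))" for k l
    proof -
      have "pochhammer (Re \<gamma>) k * pochhammer (Re \<gamma>) l \<le> pochhammer (Re \<gamma>) k * pochhammer (Re \<gamma> + of_nat k) l"
        using \<gamma> pg(2)[of k] unfolding pochhammer_prod[of _ l] by (intro mult_left_mono prod_mono) auto
      also have "\<dots> = pochhammer (Re \<gamma>) (k + l)" by (simp add: pochhammer_product')
      also have "\<dots> \<le> cmod (pochhammer \<gamma> (k + l))" by (rule norm_pochhammer_ge_Re) (use \<gamma> in auto)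
      finally show ?thesis .
    qed
    define F where "F = (\<lambda>k. cmod (pochhammer \<alpha> k * pochhammer \<beta> k / (pochhammer g k * fact k)) * cmod u ^ k)"
    define F' where "F' = (\<lambda>k. cmod (pochhammer \<alpha>' k * pochhammer \<beta>' k / (pochhammer g k * fact k)) * cmod v ^ k)"
    have F: "summable F" "summable F'" unfolding F_def F'_def
      by (intro summable_norm_hypergeo g u vn norm_ge_zero)+
    have F0: "F k \<ge> 0" "F' k \<ge> 0" for k by (auto simp: F_def F'_def)
    have le: "cmod (Q k l) \<le> F k * F' l" for k l
    proof -
      have "cmod (Q k l) = cmod (pochhammer \<alpha> k * pochhammer \<beta> k) * cmod (pochhammer \<alpha>' l * pochhammer \<beta>' l) * 
          (cmod u ^ k * cmod v ^ l) / (fact k * fact l) / cmod (pochhammer \<gamma> (k + l))"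
        by (simp add: Q_def norm_mult norm_divide norm_power mult_ac)
      also have "\<dots> \<le> cmod (pochhammer \<alpha> k * pochhammer \<beta> k) * cmod (pochhammer \<alpha>' l * pochhammer \<beta>' l) * 
          (cmod u ^ k * cmod v ^ l) / (fact k * fact l) / (pochhammer (Re \<gamma>) k * pochhammer (Re \<gamma>) l)"
        using pg(2) by (intro divide_left_mono pgl mult_pos_pos) 
          (auto intro!: mult_pos_pos pochhammer_eq_0_imp_nonpos_Int dest: pochhammer_eq_0_imp_nonpos_Int simp: g0)
      also have "\<dots> = F k * F' l" 
        by (simp add: F_def F'_def norm_mult norm_divide pg mult_ac)
      finally show ?thesis .
    qed
    have Qrow: "summable (\<lambda>l. cmod (Q k l))" for k
      by (rule summable_comparison_test_ev[OF _ summable_mult[OF F(2), of "F k"]]) (use le in auto)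
    have Qrows: "summable (\<lambda>k. \<Sum>l. cmod (Q k l))"
    proof (rule summable_comparison_test_ev[OF _ summable_mult2[OF F(1), of "suminf F'"]])
      show "\<forall>\<^sub>F k in sequentially. norm (\<Sum>l. cmod (Q k l)) \<le> F k * suminf F'"
      proof (intro always_eventually allI)
        fix k
        have "(\<Sum>l. cmod (Q k l)) \<le> (\<Sum>l. F k * F' l)" by (intro suminf_le le Qrow summable_mult F)
        also have "\<dots> = F k * suminf F'" by (rule suminf_mult[OF F(2)])
        finally show "norm (\<Sum>l. cmod (Q k l)) \<le> F k * suminf F'" using Qrow[of k] by (simp add: suminf_nonneg)
      qed
    qed
    have "(\<Sum>l. Q k l) = K k * hypergeo_2F1 \<alpha>' \<beta>' (\<gamma> + of_nat k) v" for k
    proof -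
      have "(\<lambda>l. K k * (pochhammer \<alpha>' l * pochhammer \<beta>' l / (pochhammer (\<gamma> + of_nat k) l * fact l) * v ^ l)) sums
         (K k * hypergeo_2F1_series \<alpha>' \<beta>' (\<gamma> + of_nat k) v)"
        by (intro sums_mult hypergeo_2F1_series_sums gk vn)
      also have "(\<lambda>l. K k * (pochhammer \<alpha>' l * pochhammer \<beta>' l / (pochhammer (\<gamma> + of_nat k) l * fact l) * v ^ l)) = Q k"
        by (auto simp: K_def Q_def pochhammer_product' fun_eq_iff mult_ac)
      finally show ?thesis by (simp add: sums_iff hypergeo_2F1_pfaff(2)[OF gk v vn])
    qed
    hence "(\<lambda>k. K k * hypergeo_2F1 \<alpha>' \<beta>' (\<gamma> + of_nat k) v) sums infsum (\<lambda>(k, l). Q k l) UNIV"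
      using double_series_rows[of Q, OF Qrow Qrows] by simp
    moreover have "Appell_F3 \<alpha> \<alpha>' \<beta> \<beta>' \<gamma> u v = infsum (\<lambda>(k, l). Q k l) UNIV"
      unfolding Appell_F3_def if_P[OF True] Q_def ..
    ultimately show ?thesis using S sums_unique2 by metis
  qed
  thus ?thesis by (simp only: u_def v_def)
qed

section \<open>Growth of the kernel series at the end point\<close>

text \<open>Growth of order \<open>E\<close> on the real radius towards \<open>1\<close>, with one more power for every derivative. The
  derivatives are part of the notion because each use of the contiguous relation below differentiates once.\<close>

definition grows :: "(complex \<Rightarrow> complex) \<Rightarrow> real \<Rightarrow> bool" where
  "grows H E \<longleftrightarrow> H holomorphic_on ball 0 1 \<and>
     (\<forall>j. \<exists>C. \<forall>y. 0 \<le> y \<and> y < 1 \<longrightarrow> cmod ((deriv ^^ j) H (of_real y)) \<le> C * (1 - y) powr (- E - real j))"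

lemma growsI:
  assumes "H holomorphic_on ball 0 1"
    "\<And>j. \<exists>C. \<forall>y. 0 \<le> y \<and> y < 1 \<longrightarrow> cmod ((deriv ^^ j) H (of_real y)) \<le> C * (1 - y) powr (- E - real j)"
  shows "grows H E"
  using assms by (simp add: grows_def)

lemma growsE:
  assumes "grows H E"
  obtains C where "\<And>y. 0 \<le> y \<Longrightarrow> y < 1 \<Longrightarrow> cmod ((deriv ^^ j) H (of_real y)) \<le> C * (1 - y) powr (- E - real j)" "C \<ge> 0"
proof -
  obtain C where C: "\<forall>y. 0 \<le> y \<and> y < 1 \<longrightarrow> cmod ((deriv ^^ j) H (of_real y)) \<le> C * (1 - y) powr (- E - real j)"
    using assms unfolding grows_def by blast
  have "cmod ((deriv ^^ j) H (of_real 0)) \<le> C * (1 - 0 :: real) powr (- E - real j)"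
    using C[rule_format, of 0] by simp
  hence "C \<ge> 0" using order_trans[OF norm_ge_zero] by fastforce
  show ?thesis by (rule that[of C]) (use C \<open>C \<ge> 0\<close> in auto)
qed

lemma grows_holomorphic: "grows H E \<Longrightarrow> H holomorphic_on ball 0 1"
  by (simp add: grows_def)

lemma of_real_in_ball: "0 \<le> y \<Longrightarrow> y < 1 \<Longrightarrow> complex_of_real y \<in> ball 0 1"
  by simp

lemma grows_cong:
  assumes H: "grows H E" and eq: "\<And>z. cmod z < 1 \<Longrightarrow> H z = G z"
  shows "grows G E"
proof -
  have hG: "G holomorphic_on ball 0 1"
    using grows_holomorphic[OF H] by (rule holomorphic_transform) (use eq in auto)
  have "(deriv ^^ j) G z = (deriv ^^ j) H z" if "z \<in> ball 0 1" for j z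
    by (rule higher_deriv_transform_within_open[OF hG grows_holomorphic[OF H] open_ball that])
       (use eq in auto)
  thus ?thesis using H hG of_real_in_ball unfolding grows_def by (metis (no_types, lifting))
qed

lemma grows_mono:
  assumes "grows H E" "E \<le> E'"
  shows "grows H E'"
proof (rule growsI)
  fix j
  obtain C where C: "\<And>y. 0 \<le> y \<Longrightarrow> y < 1 \<Longrightarrow> cmod ((deriv ^^ j) H (of_real y)) \<le> C * (1 - y) powr (- E - real j)" "C \<ge> 0"
    using growsE[OF assms(1)] by metis
  show "\<exists>C. \<forall>y. 0 \<le> y \<and> y < 1 \<longrightarrow> cmod ((deriv ^^ j) H (of_real y)) \<le> C * (1 - y) powr (- E' - real j)"
  proof (intro exI allI impI)
    fix y :: real assume y: "0 \<le> y \<and> y < 1"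
    have "(1 - y) powr (- E - real j) \<le> (1 - y) powr (- E' - real j)"
      using y assms(2) by (intro powr_mono') auto
    thus "cmod ((deriv ^^ j) H (of_real y)) \<le> C * (1 - y) powr (- E' - real j)"
      using C(1)[of y] C(2) y by (meson mult_left_mono order_trans)
  qed
qed (rule grows_holomorphic[OF assms(1)])

lemma grows_deriv:
  assumes "grows H E"
  shows "grows (deriv H) (E + 1)"
proof (rule growsI)
  show "deriv H holomorphic_on ball 0 1"
    using grows_holomorphic[OF assms] by (rule holomorphic_deriv) auto
  fix j
  obtain C where C: "\<And>y. 0 \<le> y \<Longrightarrow> y < 1 \<Longrightarrow> cmod ((deriv ^^ Suc j) H (of_real y)) \<le> C * (1 - y) powr (- E - real (Suc j))"
    using growsE[OF assms, of "Suc j"] by metis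
  moreover have "- E - real (Suc j) = - (E + 1) - real j" by simp
  ultimately show "\<exists>C. \<forall>y. 0 \<le> y \<and> y < 1 \<longrightarrow> cmod ((deriv ^^ j) (deriv H) (of_real y)) \<le> C * (1 - y) powr (- (E + 1) - real j)"
    unfolding funpow_Suc_right o_def by metis
qed

lemma grows_add:
  assumes "grows H E" "grows G E"
  shows "grows (\<lambda>z. H z + G z) E"
proof (rule growsI)
  show "(\<lambda>z. H z + G z) holomorphic_on ball 0 1"
    using assms by (intro holomorphic_intros grows_holomorphic)
  fix j
  obtain C where C: "\<And>y. 0 \<le> y \<Longrightarrow> y < 1 \<Longrightarrow> cmod ((deriv ^^ j) H (of_real y)) \<le> C * (1 - y) powr (- E - real j)"
    using growsE[OF assms(1)] by metis
  obtain D where D: "\<And>y. 0 \<le> y \<Longrightarrow> y < 1 \<Longrightarrow> cmod ((deriv ^^ j) G (of_real y)) \<le> D * (1 - y) powr (- E - real j)"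
    using growsE[OF assms(2)] by metis
  show "\<exists>C. \<forall>y. 0 \<le> y \<and> y < 1 \<longrightarrow> cmod ((deriv ^^ j) (\<lambda>z. H z + G z) (of_real y)) \<le> C * (1 - y) powr (- E - real j)"
  proof (intro exI allI impI)
    fix y :: real assume y: "0 \<le> y \<and> y < 1"
    have "(deriv ^^ j) (\<lambda>z. H z + G z) (of_real y) = (deriv ^^ j) H (of_real y) + (deriv ^^ j) G (of_real y)"
      by (rule higher_deriv_add[OF grows_holomorphic[OF assms(1)] grows_holomorphic[OF assms(2)]]) (use y in auto)
    thus "cmod ((deriv ^^ j) (\<lambda>z. H z + G z) (of_real y)) \<le> (C + D) * (1 - y) powr (- E - real j)"
      using C[of y] D[of y] y norm_triangle_ineq[of "(deriv ^^ j) H (of_real y)" "(deriv ^^ j) G (of_real y)"]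
      by (simp add: algebra_simps)
  qed
qed

lemma grows_cmult:
  assumes "grows H E"
  shows "grows (\<lambda>z. c * H z) E"
proof (rule growsI)
  show "(\<lambda>z. c * H z) holomorphic_on ball 0 1"
    using assms by (intro holomorphic_intros grows_holomorphic)
  fix j
  obtain C where C: "\<And>y. 0 \<le> y \<Longrightarrow> y < 1 \<Longrightarrow> cmod ((deriv ^^ j) H (of_real y)) \<le> C * (1 - y) powr (- E - real j)"
    using growsE[OF assms(1)] by metis
  show "\<exists>C. \<forall>y. 0 \<le> y \<and> y < 1 \<longrightarrow> cmod ((deriv ^^ j) (\<lambda>z. c * H z) (of_real y)) \<le> C * (1 - y) powr (- E - real j)"
  proof (intro exI allI impI)
    fix y :: real assume y: "0 \<le> y \<and> y < 1"
    have "(deriv ^^ j) (\<lambda>z. c * H z) (of_real y) = c * (deriv ^^ j) H (of_real y)"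
      by (rule higher_deriv_cmult[OF grows_holomorphic[OF assms(1)]]) (use y in auto)
    thus "cmod ((deriv ^^ j) (\<lambda>z. c * H z) (of_real y)) \<le> (cmod c * C) * (1 - y) powr (- E - real j)"
      using C[of y] y by (simp add: norm_mult mult.assoc mult_left_mono)
  qed
qed

lemma higher_deriv_mult_ident:
  assumes "H holomorphic_on ball 0 1" "z \<in> ball 0 1"
  shows "(deriv ^^ j) (\<lambda>z. z * H z) z = z * (deriv ^^ j) H z + of_nat j * (deriv ^^ (j - 1)) H z"
proof (cases j)
  case (Suc m)
  have "(deriv ^^ j) (\<lambda>z. z * H z) z = 
      (\<Sum>i = 0..j. of_nat (j choose i) * (deriv ^^ i) (\<lambda>z. z) z * (deriv ^^ (j - i)) H z)"
    by (rule higher_deriv_mult) (use assms in \<open>auto intro: holomorphic_intros\<close>)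
  also have "\<dots> = (\<Sum>i\<in>{0, 1}. of_nat (j choose i) * (deriv ^^ i) (\<lambda>z. z) z * (deriv ^^ (j - i)) H z)"
    by (rule sum.mono_neutral_right) (use Suc in auto)
  finally show ?thesis using Suc by (simp del: funpow.simps)
qed auto

text \<open>The factor \<open>1 - z\<close> makes up for the power that a derivative costs.\<close>

lemma grows_one_minus_mult:
  assumes "grows H (E + 1)"
  shows "grows (\<lambda>z. (1 - z) * H z) E"
proof (rule growsI)
  show "(\<lambda>z. (1 - z) * H z) holomorphic_on ball 0 1"
    using assms by (intro holomorphic_intros grows_holomorphic)
  fix j
  obtain C where C: "\<And>y. 0 \<le> y \<Longrightarrow> y < 1 \<Longrightarrow> cmod ((deriv ^^ j) H (of_real y)) \<le> C * (1 - y) powr (- (E + 1) - real j)"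
    using growsE[OF assms(1)] by metis
  obtain D where D: "\<And>y. 0 \<le> y \<Longrightarrow> y < 1 \<Longrightarrow> cmod ((deriv ^^ (j - 1)) H (of_real y)) \<le> D * (1 - y) powr (- (E + 1) - real (j - 1))"
    using growsE[OF assms(1), of "j - 1"] by metis
  note hol = grows_holomorphic[OF assms(1)]
  show "\<exists>C. \<forall>y. 0 \<le> y \<and> y < 1 \<longrightarrow> cmod ((deriv ^^ j) (\<lambda>z. (1 - z) * H z) (of_real y)) \<le> C * (1 - y) powr (- E - real j)"
  proof (intro exI allI impI)
    fix y :: real assume y: "0 \<le> y \<and> y < 1"
    let ?y = "complex_of_real y"
    have "(deriv ^^ j) (\<lambda>z. (1 - z) * H z) ?y = (deriv ^^ j) (\<lambda>z. H z - z * H z) ?y"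
      by (simp add: algebra_simps)
    also have "\<dots> = (deriv ^^ j) H ?y - (deriv ^^ j) (\<lambda>z. z * H z) ?y"
      by (rule higher_deriv_diff[of _ "ball 0 1"]) (use y hol in \<open>auto intro!: holomorphic_intros\<close>)
    also have "\<dots> = (1 - ?y) * (deriv ^^ j) H ?y - of_nat j * (deriv ^^ (j - 1)) H ?y"
      using y by (simp add: higher_deriv_mult_ident[OF hol] algebra_simps)
    also have "cmod \<dots> \<le> cmod ((1 - ?y) * (deriv ^^ j) H ?y) + cmod (of_nat j * (deriv ^^ (j - 1)) H ?y)"
      by (rule norm_triangle_ineq4)
    also have "\<dots> = cmod (1 - ?y) * cmod ((deriv ^^ j) H ?y) + real j * cmod ((deriv ^^ (j - 1)) H ?y)"
      by (simp only: norm_mult norm_of_nat)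
    also have "cmod (1 - ?y) = \<bar>1 - y\<bar>"
      using norm_of_real[of "1 - y", where 'a = complex] by (simp only: of_real_diff of_real_1)
    also have "\<bar>1 - y\<bar> = 1 - y" using y by simp
    also have "(1 - y) * cmod ((deriv ^^ j) H ?y) \<le> (1 - y) * (C * (1 - y) powr (- (E + 1) - real j))"
      using y C[of y] by (intro mult_left_mono) auto
    also have "(1 - y) * (C * (1 - y) powr (- (E + 1) - real j)) = C * (1 - y) powr (- E - real j)"
    proof -
      have "(1 - y) * (1 - y) powr (- (E + 1) - real j) = (1 - y) powr (1 + (- (E + 1) - real j))"
        using y by (intro powr_mult_base) auto
      also have "1 + (- (E + 1) - real j) = - E - real j" by simp
      finally show ?thesis by (simp add: mult_ac)
    qed
    also have "real j * cmod ((deriv ^^ (j - 1)) H ?y) \<le> real j * D * (1 - y) powr (- E - real j)"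
    proof (cases j)
      case (Suc m)
      have "- (E + 1) - real (j - 1) = - E - real j" using Suc by simp
      thus ?thesis using D[of y] y by (simp add: mult.assoc mult_left_mono)
    qed auto
    finally show "cmod ((deriv ^^ j) (\<lambda>z. (1 - z) * H z) ?y) \<le> (C + real j * D) * (1 - y) powr (- E - real j)"
      by (simp add: algebra_simps)
  qed
qed

lemma grows_mult_ident:
  assumes "grows H E"
  shows "grows (\<lambda>z. z * H z) E"
proof -
  have "grows (\<lambda>z. H z + (- 1) * ((1 - z) * H z)) E"
    by (intro grows_add grows_cmult grows_one_minus_mult assms grows_mono[OF assms]) simp
  thus ?thesis by (rule grows_cong) (simp add: algebra_simps)
qed

text \<open>The coefficients are dominated by those of the binomial series of \<open>(1 - r)\<^bsup>- e\<^esup>\<close>.\<close>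

lemma power_series_growth:
  fixes c :: "nat \<Rightarrow> complex"
  assumes e: "e > 0" and c: "\<And>n. cmod (c n) \<le> K * (real n + 1) powr (e - 1)"
  obtains C where "\<And>r. 0 \<le> r \<Longrightarrow> r < 1 \<Longrightarrow> summable (\<lambda>n. cmod (c n) * r ^ n)"
    "\<And>r. 0 \<le> r \<Longrightarrow> r < 1 \<Longrightarrow> (\<Sum>n. cmod (c n) * r ^ n) \<le> C * (1 - r) powr (- e)"
proof -
  have K0: "K \<ge> 0" using order_trans[OF norm_ge_zero c[of 0]] by simp
  have "complex_of_real e \<notin> \<int>\<^sub>\<le>\<^sub>0" using nonpos_Int_Re_le[of "of_real e"] e by auto
  then obtain D where D: "D > 0" "\<And>n. fact n * (real n + 1) powr (e - 1) \<le> D * cmod (pochhammer (complex_of_real e) n)"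
    using norm_pochhammer_lower[of "complex_of_real e"] by auto
  have pe: "cmod (pochhammer (complex_of_real e) n) = pochhammer e n" for n
    using e pochhammer_pos[of e n] by (simp add: pochhammer_of_real)
  have le: "cmod (c n) * r ^ n \<le> K * D * (pochhammer e n / fact n * r ^ n)" if "r \<ge> 0" for n r
  proof -
    have "(real n + 1) powr (e - 1) \<le> D * (pochhammer e n / fact n)"
      using D(2)[of n] pe[of n] by (simp add: field_simps)
    hence "cmod (c n) \<le> K * (D * (pochhammer e n / fact n))"
      using c[of n] K0 by (meson mult_left_mono order_trans)
    hence "cmod (c n) * r ^ n \<le> K * (D * (pochhammer e n / fact n)) * r ^ n"
      using that by (intro mult_right_mono) auto
    thus ?thesis by (simp add: mult_ac)
  qed
  have bs: "(\<lambda>n. K * D * (pochhammer e n / fact n * r ^ n)) sums (K * D * (1 - r) powr (- e))" 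
    if "0 \<le> r" "r < 1" for r
    by (intro sums_mult binomial_series_real) (use that in auto)
  have sm: "summable (\<lambda>n. cmod (c n) * r ^ n)" if "0 \<le> r" "r < 1" for r
    by (rule summable_comparison_test_ev[OF _ sums_summable[OF bs[OF that]]])
       (use le that in \<open>auto simp: abs_mult\<close>)
  show ?thesis
  proof (rule that[OF sm])
    fix r :: real assume r: "0 \<le> r" "r < 1"
    have "(\<Sum>n. cmod (c n) * r ^ n) \<le> (\<Sum>n. K * D * (pochhammer e n / fact n * r ^ n))"
      by (intro suminf_le le sm sums_summable[OF bs] r)
    thus "(\<Sum>n. cmod (c n) * r ^ n) \<le> K * D * (1 - r) powr (- e)" using bs[OF r] by (simp add: sums_iff)
  qed
qed

lemma grows_power_series:
  fixes c :: "nat \<Rightarrow> complex"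
  assumes e: "e > 0" and c: "\<And>n. cmod (c n) \<le> K * (real n + 1) powr (e - 1)"
      and H: "\<And>z. cmod z < 1 \<Longrightarrow> (\<lambda>n. c n * z ^ n) sums H z"
    shows "grows H e"
proof (rule growsI)
  have hol: "H holomorphic_on ball 0 1" 
    if "\<And>z. cmod z < 1 \<Longrightarrow> (\<lambda>n. c n * z ^ n) sums H z" for c H
  proof (rule power_series_holomorphic)
    fix w :: complex assume "w \<in> ball 0 1"
    thus "(\<lambda>n. c n * (w - 0) ^ n) sums H w" using that[of w] by simp
  qed
  show "H holomorphic_on ball 0 1" by (rule hol[OF H])
  fix j
  show "\<exists>C. \<forall>y. 0 \<le> y \<and> y < 1 \<longrightarrow> cmod ((deriv ^^ j) H (of_real y)) \<le> C * (1 - y) powr (- e - real j)"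
    using e c H
  proof (induction j arbitrary: H c e K)
    case (0 H c e K)
    obtain C where C: "\<And>r. 0 \<le> r \<Longrightarrow> r < 1 \<Longrightarrow> summable (\<lambda>n. cmod (c n) * r ^ n)"
        "\<And>r. 0 \<le> r \<Longrightarrow> r < 1 \<Longrightarrow> (\<Sum>n. cmod (c n) * r ^ n) \<le> C * (1 - r) powr (- e)"
      using power_series_growth[OF 0(1,2)] by metis
    show ?case
    proof (intro exI allI impI)
      fix y :: real assume y: "0 \<le> y \<and> y < 1"
      have "H (of_real y) = (\<Sum>n. c n * of_real y ^ n)" using 0(3)[of "of_real y"] y by (simp add: sums_iff)
      also have "cmod \<dots> \<le> (\<Sum>n. cmod (c n * of_real y ^ n))"
        by (rule summable_norm) (use C(1)[of y] y in \<open>simp add: norm_mult norm_power\<close>)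
      also have "\<dots> \<le> C * (1 - y) powr (- e)" using C(2)[of y] y by (simp add: norm_mult norm_power)
      finally show "cmod ((deriv ^^ 0) H (of_real y)) \<le> C * (1 - y) powr (- e - real 0)" by simp
    qed
  next
    case (Suc j H c e K)
    have K0: "K \<ge> 0" using order_trans[OF norm_ge_zero Suc(3)[of 0]] by simp
    have "\<exists>C. \<forall>y. 0 \<le> y \<and> y < 1 \<longrightarrow> cmod ((deriv ^^ j) (deriv H) (of_real y)) \<le> C * (1 - y) powr (- (e + 1) - real j)"
    proof (rule Suc.IH)
      show "e + 1 > 0" using Suc(2) by simp
      fix n
      have "(real n + 2) powr (e - 1) \<le> 2 powr \<bar>e - 1\<bar> * (real n + 1) powr (e - 1)"
      proof -
        have "((real n + 2) / (real n + 1)) powr (e - 1) \<le> ((real n + 2) / (real n + 1)) powr \<bar>e - 1\<bar>"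
          by (intro powr_mono) (auto simp: field_simps)
        also have "\<dots> \<le> 2 powr \<bar>e - 1\<bar>" by (intro powr_mono2) (auto simp: field_simps)
        finally show ?thesis by (simp add: powr_divide field_simps)
      qed
      hence "K * (real n + 2) powr (e - 1) \<le> K * (2 powr \<bar>e - 1\<bar> * (real n + 1) powr (e - 1))"
        using K0 by (intro mult_left_mono)
      moreover have "cmod (c (Suc n)) \<le> K * (real n + 2) powr (e - 1)" using Suc(3)[of "Suc n"] by (simp add: add_ac)
      ultimately have "(real n + 1) * cmod (c (Suc n)) \<le> (real n + 1) * (K * (2 powr \<bar>e - 1\<bar> * (real n + 1) powr (e - 1)))"
        by (intro mult_left_mono) auto
      also have "\<dots> = K * 2 powr \<bar>e - 1\<bar> * (real n + 1) powr (e + 1 - 1)"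
        by (simp add: powr_diff)
      finally show "cmod (diffs c n) \<le> K * 2 powr \<bar>e - 1\<bar> * (real n + 1) powr (e + 1 - 1)"
        by (simp add: diffs_def norm_mult add_ac del: of_nat_Suc flip: of_nat_Suc)
    next
      fix z :: complex assume z: "cmod z < 1"
      have "(H has_field_derivative deriv H z) (at z)"
        using hol[OF Suc(4)] z by (intro holomorphic_derivI[of _ "ball 0 1"]) auto
      thus "(\<lambda>n. diffs c n * z ^ n) sums deriv H z"
        using Suc(4) z by (intro termdiffs_sums_strong[of 1 c H]) auto
    qed
    moreover have "- (e + 1) - real j = - e - real (Suc j)" by simp
    ultimately show ?case unfolding funpow_Suc_right o_def by metis
  qed
qed

text \<open>Splitting off \<open>(k + 1)\<^bsup>e\<^esup> \<le> (n + 1)\<^bsup>e\<^esup>\<close> leaves a convergent series, whatever the sign of \<open>A\<close>.\<close>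

lemma powr_sum_bound:
  fixes A e :: real
  assumes "e > 0" "e > A"
  obtains K where "K \<ge> 0" "\<And>n. (\<Sum>k\<le>n. (real k + 1) powr (A - 1)) \<le> K * (real n + 1) powr e"
proof (rule that)
  have sm: "summable (\<lambda>k. (real k + 1) powr (A - e - 1))" using assms by (intro summable_Suc_powr) auto
  show "0 \<le> (\<Sum>k. (real k + 1) powr (A - e - 1))" by (intro suminf_nonneg sm) auto
  fix n
  have "(\<Sum>k\<le>n. (real k + 1) powr (A - 1)) \<le> (\<Sum>k\<le>n. (real k + 1) powr (A - e - 1) * (real n + 1) powr e)"
  proof (intro sum_mono)
    fix k assume k: "k \<in> {..n}"
    have "(real k + 1) powr (A - 1) = (real k + 1) powr (A - e - 1) * (real k + 1) powr e"
      by (simp only: powr_add[symmetric]) simp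
    also have "\<dots> \<le> (real k + 1) powr (A - e - 1) * (real n + 1) powr e"
      using k assms by (intro mult_left_mono powr_mono2) auto
    finally show "(real k + 1) powr (A - 1) \<le> (real k + 1) powr (A - e - 1) * (real n + 1) powr e" .
  qed
  also have "\<dots> = (\<Sum>k\<le>n. (real k + 1) powr (A - e - 1)) * (real n + 1) powr e"
    by (simp add: sum_distrib_right)
  also have "\<dots> \<le> (\<Sum>k. (real k + 1) powr (A - e - 1)) * (real n + 1) powr e"
    by (intro mult_right_mono sum_le_suminf sm) auto
  finally show "(\<Sum>k\<le>n. (real k + 1) powr (A - 1)) \<le> (\<Sum>k. (real k + 1) powr (A - e - 1)) * (real n + 1) powr e" .
qed

text \<open>Near \<open>t = 0\<close> the kernel is, up to logarithms, a combination of \<open>1\<close>, \<open>t\<^bsup>\<beta>' - \<alpha>'\<^esup>\<close> and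
  \<open>t\<^bsup>\<gamma> - \<alpha> - \<alpha>' - \<beta>\<^esup>\<close>; the exponent is the rate of growth of the largest of them.\<close>

definition F3_exponent :: "complex \<Rightarrow> complex \<Rightarrow> complex \<Rightarrow> complex \<Rightarrow> complex \<Rightarrow> real" where
  "F3_exponent \<alpha> \<alpha>' \<beta> \<beta>' \<gamma> = Max {0, Re (\<alpha>' - \<beta>'), Re (\<alpha> + \<alpha>' + \<beta> - \<gamma>)}"

text \<open>For \<open>Re \<alpha>' \<ge> 1\<close> the powers of \<open>n - k + 1\<close> are bounded by those of \<open>n + 1\<close>, and what remains is a sum
  of powers of \<open>k + 1\<close>. For small \<open>Re \<alpha>'\<close> the sum of the absolute values can be larger than this, since there the
  terms cancel.\<close>

lemma F3_coeff_bound: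
  assumes \<gamma>: "\<gamma> \<notin> \<int>\<^sub>\<le>\<^sub>0" and \<alpha>': "Re \<alpha>' \<ge> 1" and E: "E > F3_exponent \<alpha> \<alpha>' \<beta> \<beta>' \<gamma>"
  obtains K where "\<And>n. (\<Sum>k\<le>n. cmod (F3_term \<alpha> \<alpha>' \<beta> \<beta>' \<gamma> k (n - k))) \<le> K * (real n + 1) powr (E - 1)"
proof -
  define A where "A = Re (\<alpha> + \<beta> - \<gamma> + \<beta>')"
  \<comment> \<open>What is left for \<open>e\<close> after the powers of \<open>n\<close> with exponents \<open>Re \<alpha>' - 1\<close> and \<open>- Re \<beta>'\<close>;
    that it is positive and exceeds \<open>A\<close> are two of the three conditions on \<open>E\<close>.\<close>
  define e where "e = E - Re (\<alpha>' - \<beta>')"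
  have e: "e > 0" "e > A" using E by (auto simp: F3_exponent_def e_def A_def)
  obtain C where C: "C > 0"
    "\<And>k l. cmod (F3_term \<alpha> \<alpha>' \<beta> \<beta>' \<gamma> k l) \<le> C * ((real k + 1) powr (A - 1) *
        (real l + 1) powr (Re \<alpha>' - 1) * (real (k + l) + 1) powr (- Re \<beta>'))"
    using norm_F3_term[OF \<gamma>] unfolding A_def by blast
  obtain K where K: "K \<ge> 0" "\<And>n. (\<Sum>k\<le>n. (real k + 1) powr (A - 1)) \<le> K * (real n + 1) powr e"
    using powr_sum_bound[OF e] by metis
  show ?thesis
  proof (rule that)
    fix n
    have "(\<Sum>k\<le>n. cmod (F3_term \<alpha> \<alpha>' \<beta> \<beta>' \<gamma> k (n - k))) \<le> 
       (\<Sum>k\<le>n. C * (real n + 1) powr (Re \<alpha>' - 1) * (real n + 1) powr (- Re \<beta>') * (real k + 1) powr (A - 1))"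
    proof (intro sum_mono)
      fix k assume k: "k \<in> {..n}"
      have "cmod (F3_term \<alpha> \<alpha>' \<beta> \<beta>' \<gamma> k (n - k)) \<le> C * ((real k + 1) powr (A - 1) *
        (real (n - k) + 1) powr (Re \<alpha>' - 1) * (real n + 1) powr (- Re \<beta>'))"
        using C(2)[of k "n - k"] k by simp
      also have "\<dots> \<le> C * ((real k + 1) powr (A - 1) *
        (real n + 1) powr (Re \<alpha>' - 1) * (real n + 1) powr (- Re \<beta>'))"
        using k \<alpha>' C(1) by (intro mult_left_mono mult_right_mono powr_mono2) auto
      finally show "cmod (F3_term \<alpha> \<alpha>' \<beta> \<beta>' \<gamma> k (n - k)) \<le> 
        C * (real n + 1) powr (Re \<alpha>' - 1) * (real n + 1) powr (- Re \<beta>') * (real k + 1) powr (A - 1)"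
        by (simp add: mult_ac)
    qed
    also have "\<dots> = C * (real n + 1) powr (Re \<alpha>' - 1) * (real n + 1) powr (- Re \<beta>') * (\<Sum>k\<le>n. (real k + 1) powr (A - 1))"
      by (simp add: sum_distrib_left)
    also have "\<dots> \<le> C * (real n + 1) powr (Re \<alpha>' - 1) * (real n + 1) powr (- Re \<beta>') * (K * (real n + 1) powr e)"
      using C(1) by (intro mult_left_mono K) auto
    also have "\<dots> = C * K * ((real n + 1) powr (Re \<alpha>' - 1) * (real n + 1) powr (- Re \<beta>') * (real n + 1) powr e)"
      by (simp add: mult_ac)
    also have "(real n + 1) powr (Re \<alpha>' - 1) * (real n + 1) powr (- Re \<beta>') * (real n + 1) powr e = (real n + 1) powr (E - 1)"
      by (simp only: powr_add[symmetric]) (simp add: e_def)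
    finally show "(\<Sum>k\<le>n. cmod (F3_term \<alpha> \<alpha>' \<beta> \<beta>' \<gamma> k (n - k))) \<le> C * K * (real n + 1) powr (E - 1)" .
  qed
qed

lemma F3_coeff_0: "F3_coeff \<alpha> \<alpha>' \<beta> \<beta>' \<gamma> 0 = 1"
  by (simp add: F3_coeff_def F3_term_def)

text \<open>The shift leaves \<open>\<gamma> - \<beta>'\<close> unchanged, and the identity holds term by term because
  \<open>(\<alpha>')\<^sub>l / l!\<close> is the difference of \<open>(\<alpha>' + 1)\<^sub>l / l!\<close> and \<open>(\<alpha>' + 1)\<^sub>l\<^sub>-\<^sub>1 / (l - 1)!\<close>.\<close>

lemma F3_coeff_contiguous_Suc:
  assumes \<gamma>: "\<gamma> \<notin> \<int>\<^sub>\<le>\<^sub>0"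
  shows "\<gamma> * F3_coeff \<alpha> \<alpha>' \<beta> \<beta>' \<gamma> (Suc m) = 
     (of_nat (Suc m) + \<gamma>) * F3_coeff \<alpha> (\<alpha>' + 1) \<beta> (\<beta>' + 1) (\<gamma> + 1) (Suc m) +
     (\<beta>' - of_nat m - \<gamma>) * F3_coeff \<alpha> (\<alpha>' + 1) \<beta> (\<beta>' + 1) (\<gamma> + 1) m"
proof -
  have pz: "pochhammer \<gamma> n \<noteq> 0" for n using \<gamma> pochhammer_eq_0_imp_nonpos_Int by blast
  have g0: "\<gamma> \<noteq> 0" using \<gamma> by auto
  have pS: "pochhammer \<gamma> (Suc n) = \<gamma> * pochhammer (\<gamma> + 1) n" for n by (rule pochhammer_rec)
  have pz1: "pochhammer (\<gamma> + 1) n \<noteq> 0" for n using pz[of "Suc n"] pS[of n] by auto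
  have gm: "\<gamma> + 1 + of_nat m \<noteq> 0" using pz1[of "Suc m"] by (simp add: pochhammer_Suc)
  let ?t = "F3_term \<alpha> \<alpha>' \<beta> \<beta>' \<gamma>" and ?p = "F3_term \<alpha> (\<alpha>' + 1) \<beta> (\<beta>' + 1) (\<gamma> + 1)"
  have last: "\<gamma> * ?t (Suc m) 0 = (of_nat (Suc m) + \<gamma>) * ?p (Suc m) 0"
  proof -
    have 1: "pochhammer \<gamma> (Suc m + 0) = \<gamma> * pochhammer (\<gamma> + 1) m" using pS[of m] by simp
    have 2: "pochhammer (\<gamma> + 1) (Suc m + 0) = pochhammer (\<gamma> + 1) m * (of_nat (Suc m) + \<gamma>)"
      by (simp add: pochhammer_Suc add_ac)
    have 3: "of_nat (Suc m) + \<gamma> \<noteq> 0" using gm by (simp add: add_ac)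
    show ?thesis unfolding F3_term_def 1 2 using g0 3 by (simp del: of_nat_Suc)
  qed
  have mid: "\<gamma> * ?t k (Suc m - k) = (of_nat (Suc m) + \<gamma>) * ?p k (Suc m - k) + (\<beta>' - of_nat m - \<gamma>) * ?p k (m - k)" 
    if k: "k \<le> m" for k
  proof -
    define j where "j = m - k"
    have m: "m = k + j" "Suc m - k = Suc j" "m - k = j" using k by (auto simp: j_def)
    define P where "P = pochhammer (\<gamma> + 1) m"
    define a where "a = pochhammer \<alpha> k * pochhammer \<beta> k / (fact k * P)"
    define b where "b = pochhammer (\<alpha>' + 1) j / fact j"
    define x where "x = pochhammer (\<gamma> - \<beta>' + of_nat k) j"
    define w where "w = \<gamma> - \<beta>' + of_nat k + of_nat j"
    have P: "P \<noteq> 0" using pz1 by (simp add: P_def)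
    have g1: "\<gamma> + 1 - (\<beta>' + 1) = \<gamma> - \<beta>'" by simp
    have t: "\<gamma> * ?t k (Suc j) = a * (\<alpha>' * b / of_nat (Suc j)) * (x * w)"
    proof -
      have "\<gamma> * ?t k (Suc j) = \<gamma> * (pochhammer \<alpha> k * pochhammer \<beta> k * (\<alpha>' * pochhammer (\<alpha>' + 1) j) * (x * w)) /
         (\<gamma> * P * fact k * fact (Suc j))"
        unfolding F3_term_def x_def w_def P_def m(1) add_Suc_right pS
        by (simp add: pochhammer_rec[of \<alpha>'] pochhammer_Suc[of "\<gamma> - \<beta>' + of_nat k"])
      also have "\<dots> = a * (\<alpha>' * b / of_nat (Suc j)) * (x * w)"
        using g0 unfolding a_def b_def fact_Suc by (simp add: mult_ac del: of_nat_Suc)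
      finally show ?thesis .
    qed
    have p1: "(of_nat (Suc m) + \<gamma>) * ?p k (Suc j) = a * (b * (\<alpha>' + 1 + of_nat j) / of_nat (Suc j)) * (x * w)"
    proof -
      have "pochhammer (\<gamma> + 1) (k + Suc j) = P * (of_nat (Suc m) + \<gamma>)"
        unfolding P_def m(1) add_Suc_right by (simp add: pochhammer_Suc add_ac)
      hence "(of_nat (Suc m) + \<gamma>) * ?p k (Suc j) = 
          (of_nat (Suc m) + \<gamma>) * (pochhammer \<alpha> k * pochhammer \<beta> k * (pochhammer (\<alpha>' + 1) j * (\<alpha>' + 1 + of_nat j)) * (x * w)) /
         (P * (of_nat (Suc m) + \<gamma>) * fact k * fact (Suc j))"
        unfolding F3_term_def g1 x_def w_def
        by (simp add: pochhammer_Suc[of "\<alpha>' + 1"] pochhammer_Suc[of "\<gamma> - \<beta>' + of_nat k"])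
      also have "\<dots> = a * (b * (\<alpha>' + 1 + of_nat j) / of_nat (Suc j)) * (x * w)"
      proof -
        have "of_nat (Suc m) + \<gamma> \<noteq> 0" using gm by (simp add: add_ac)
        thus ?thesis unfolding a_def b_def fact_Suc by (simp add: mult_ac del: of_nat_Suc)
      qed
      finally show ?thesis .
    qed
    have p2: "(\<beta>' - of_nat m - \<gamma>) * ?p k j = - a * b * x * w"
    proof -
      have "?p k j = a * b * x"
        unfolding F3_term_def g1 x_def a_def b_def P_def m(1) by (simp add: mult_ac)
      moreover have "\<beta>' - of_nat m - \<gamma> = - w" by (simp add: w_def m(1))
      ultimately show ?thesis by (simp only:) simp
    qed
    have s: "of_nat (Suc j) \<noteq> (0::complex)" by (rule of_nat_neq_0)
    show ?thesis unfolding m(2,3) t p1 p2 using s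
      by (simp add: divide_simps del: of_nat_Suc) (simp add: algebra_simps)
  qed
  have "\<gamma> * F3_coeff \<alpha> \<alpha>' \<beta> \<beta>' \<gamma> (Suc m) = (\<Sum>k\<le>m. \<gamma> * ?t k (Suc m - k)) + \<gamma> * ?t (Suc m) 0"
    by (simp add: F3_coeff_def sum_distrib_left distrib_left)
  also have "\<dots> = (\<Sum>k\<le>m. (of_nat (Suc m) + \<gamma>) * ?p k (Suc m - k) + (\<beta>' - of_nat m - \<gamma>) * ?p k (m - k)) + 
       (of_nat (Suc m) + \<gamma>) * ?p (Suc m) 0"
    unfolding last by (intro arg_cong2[of _ _ _ _ "(+)"] sum.cong mid refl) auto
  also have "\<dots> = (of_nat (Suc m) + \<gamma>) * F3_coeff \<alpha> (\<alpha>' + 1) \<beta> (\<beta>' + 1) (\<gamma> + 1) (Suc m) +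
     (\<beta>' - of_nat m - \<gamma>) * F3_coeff \<alpha> (\<alpha>' + 1) \<beta> (\<beta>' + 1) (\<gamma> + 1) m"
    unfolding F3_coeff_def sum.atMost_Suc by (simp add: sum.distrib sum_distrib_left distrib_left del: of_nat_Suc)
  finally show ?thesis .
qed

lemma holomorphic_F3_diag:
  assumes "\<gamma> \<notin> \<int>\<^sub>\<le>\<^sub>0"
  shows "F3_diag \<alpha> \<alpha>' \<beta> \<beta>' \<gamma> holomorphic_on ball 0 1"
proof (rule power_series_holomorphic)
  fix w :: complex assume "w \<in> ball 0 1"
  thus "(\<lambda>n. F3_coeff \<alpha> \<alpha>' \<beta> \<beta>' \<gamma> n * (w - 0) ^ n) sums F3_diag \<alpha> \<alpha>' \<beta> \<beta>' \<gamma> w"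
    using F3_diag_sums(1)[OF assms, of w] by simp
qed

text \<open>In the variable \<open>t = 1 - y\<close>, and for \<open>K = y\<^bsup>\<gamma> - 1\<^esup> F3_diag(y) / \<Gamma>(\<gamma>)\<close>, the relation says that \<open>K\<close> arises
  from its shifted version by the operator \<open>\<beta>' - t d/dt\<close>. On Mellin transforms this is multiplication by
  \<open>\<rho> + \<beta>'\<close>, which explains why only one Gamma factor of the multiplier changes.\<close>

lemma F3_diag_contiguous:
  fixes \<alpha> \<alpha>' \<beta> \<beta>' \<gamma> y :: complex
  assumes \<gamma>: "Re \<gamma> > 0" and y: "cmod y < 1"
  defines "H \<equiv> F3_diag \<alpha> (\<alpha>' + 1) \<beta> (\<beta>' + 1) (\<gamma> + 1)"
  shows "\<gamma> * F3_diag \<alpha> \<alpha>' \<beta> \<beta>' \<gamma> y = \<gamma> * ((1 - y) * H y) + \<beta>' * (y * H y) + (y * ((1 - y) * deriv H y))"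
proof -
  have g: "\<gamma> \<notin> \<int>\<^sub>\<le>\<^sub>0" "\<gamma> + 1 \<notin> \<int>\<^sub>\<le>\<^sub>0"
    using \<gamma> nonpos_Int_Re_le[of \<gamma>] nonpos_Int_Re_le[of "\<gamma> + 1"] by auto
  define c where "c = F3_coeff \<alpha> (\<alpha>' + 1) \<beta> (\<beta>' + 1) (\<gamma> + 1)"
  have H: "(\<lambda>n. c n * z ^ n) sums H z" if "cmod z < 1" for z
    unfolding c_def H_def by (intro F3_diag_sums g that)
  have "(H has_field_derivative deriv H y) (at y)"
    using holomorphic_F3_diag[OF g(2)] y unfolding H_def by (intro holomorphic_derivI[of _ "ball 0 1"]) auto
  hence "(\<lambda>n. diffs c n * y ^ n) sums deriv H y"
    using H y by (intro termdiffs_sums_strong[of 1 c H]) auto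
  hence "(\<lambda>n. y * (diffs c n * y ^ n)) sums (y * deriv H y)" by (rule sums_mult)
  hence "(\<lambda>n. of_nat (Suc n) * c (Suc n) * y ^ Suc n) sums (y * deriv H y)"
    by (simp add: diffs_def mult_ac)
  hence D: "(\<lambda>n. of_nat n * c n * y ^ n) sums (y * deriv H y)"
    using sums_Suc[of "\<lambda>n. of_nat n * c n * y ^ n"] by simp
  have 1: "(\<lambda>n. \<gamma> * (c n * y ^ n) + of_nat n * c n * y ^ n) sums (\<gamma> * H y + y * deriv H y)"
    by (intro sums_add sums_mult H y D)
  have "(\<lambda>n. y * ((\<beta>' - \<gamma>) * (c n * y ^ n) - of_nat n * c n * y ^ n)) sums (y * ((\<beta>' - \<gamma>) * H y - y * deriv H y))"
    by (intro sums_diff sums_mult H y D)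
  hence "(\<lambda>n. (case Suc n of 0 \<Rightarrow> 0 | Suc m \<Rightarrow> (\<beta>' - of_nat m - \<gamma>) * c m * y ^ Suc m)) sums (y * ((\<beta>' - \<gamma>) * H y - y * deriv H y))"
    by (simp add: algebra_simps)
  hence 2: "(\<lambda>n. (case n of 0 \<Rightarrow> 0 | Suc m \<Rightarrow> (\<beta>' - of_nat m - \<gamma>) * c m * y ^ Suc m)) sums (y * ((\<beta>' - \<gamma>) * H y - y * deriv H y))"
    using sums_Suc[of "\<lambda>n. (case n of 0 \<Rightarrow> 0 | Suc m \<Rightarrow> (\<beta>' - of_nat m - \<gamma>) * c m * y ^ Suc m)"] by simp
  have "(\<lambda>n. \<gamma> * (F3_coeff \<alpha> \<alpha>' \<beta> \<beta>' \<gamma> n * y ^ n)) sums 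
     (\<gamma> * H y + y * deriv H y + y * ((\<beta>' - \<gamma>) * H y - y * deriv H y))"
  proof (rule sums_cong[THEN iffD2, OF _ sums_add[OF 1 2]])
    fix n
    show "\<gamma> * (F3_coeff \<alpha> \<alpha>' \<beta> \<beta>' \<gamma> n * y ^ n) = \<gamma> * (c n * y ^ n) + of_nat n * c n * y ^ n +
       (case n of 0 \<Rightarrow> 0 | Suc m \<Rightarrow> (\<beta>' - of_nat m - \<gamma>) * c m * y ^ Suc m)"
    proof (cases n)
      case 0
      thus ?thesis by (simp add: c_def F3_coeff_0)
    next
      case (Suc m)
      have "\<gamma> * (F3_coeff \<alpha> \<alpha>' \<beta> \<beta>' \<gamma> n * y ^ n) = (\<gamma> * F3_coeff \<alpha> \<alpha>' \<beta> \<beta>' \<gamma> (Suc m)) * y ^ Suc m"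
        by (simp add: Suc)
      thus ?thesis unfolding F3_coeff_contiguous_Suc[OF g(1)] c_def[symmetric] Suc
        by (simp add: algebra_simps)
    qed
  qed
  moreover have "(\<lambda>n. \<gamma> * (F3_coeff \<alpha> \<alpha>' \<beta> \<beta>' \<gamma> n * y ^ n)) sums (\<gamma> * F3_diag \<alpha> \<alpha>' \<beta> \<beta>' \<gamma> y)"
    by (intro sums_mult F3_diag_sums g y)
  ultimately have "\<gamma> * F3_diag \<alpha> \<alpha>' \<beta> \<beta>' \<gamma> y = \<gamma> * H y + y * deriv H y + y * ((\<beta>' - \<gamma>) * H y - y * deriv H y)"
    using sums_unique2 by blast
  thus ?thesis by (simp add: algebra_simps)
qed

text \<open>The exponent is invariant under the simultaneous shift of \<open>\<alpha>'\<close>, \<open>\<beta>'\<close>, \<open>\<gamma>\<close>, so that enough shifts lead to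
  the case \<open>Re \<alpha>' \<ge> 1\<close>.\<close>

theorem grows_F3_diag:
  assumes "Re \<gamma> > 0" "E > F3_exponent \<alpha> \<alpha>' \<beta> \<beta>' \<gamma>"
  shows "grows (F3_diag \<alpha> \<alpha>' \<beta> \<beta>' \<gamma>) E"
proof -
  obtain r :: nat where r: "1 - Re \<alpha>' \<le> real r" using real_arch_simple by blast
  hence "Re \<alpha>' + r \<ge> 1" by simp
  thus ?thesis using assms
  proof (induction r arbitrary: \<alpha>' \<beta>' \<gamma>)
    case 0
    have g: "\<gamma> \<notin> \<int>\<^sub>\<le>\<^sub>0" using 0 nonpos_Int_Re_le[of \<gamma>] by auto
    have E: "E > 0" using 0 by (auto simp: F3_exponent_def)
    obtain K where K: "\<And>n. (\<Sum>k\<le>n. cmod (F3_term \<alpha> \<alpha>' \<beta> \<beta>' \<gamma> k (n - k))) \<le> K * (real n + 1) powr (E - 1)"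
      using F3_coeff_bound[OF g _ 0(3)] 0 by auto
    show ?case
    proof (rule grows_power_series[OF E _ F3_diag_sums(1)[OF g]])
      show "cmod (F3_coeff \<alpha> \<alpha>' \<beta> \<beta>' \<gamma> n) \<le> K * (real n + 1) powr (E - 1)" for n
        unfolding F3_coeff_def by (rule order_trans[OF norm_sum K])
    qed
  next
    case (Suc r)
    define H where "H = F3_diag \<alpha> (\<alpha>' + 1) \<beta> (\<beta>' + 1) (\<gamma> + 1)"
    have g0: "\<gamma> \<noteq> 0" using Suc.prems by auto
    have H: "grows H E" unfolding H_def
      by (rule Suc.IH) (use Suc.prems in \<open>auto simp: F3_exponent_def\<close>)
    have "grows (\<lambda>y. (1 / \<gamma>) * (\<gamma> * ((1 - y) * H y) + \<beta>' * (y * H y) + (y * ((1 - y) * deriv H y)))) E"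
      by (intro grows_cmult grows_add grows_mult_ident grows_one_minus_mult grows_deriv H grows_mono[OF H]) auto
    thus ?case
    proof (rule grows_cong)
      fix z :: complex assume "cmod z < 1"
      from F3_diag_contiguous[OF Suc.prems(2) this, of \<alpha> \<alpha>' \<beta> \<beta>']
      show "(1 / \<gamma>) * (\<gamma> * ((1 - z) * H z) + \<beta>' * (z * H z) + (z * ((1 - z) * deriv H z))) = F3_diag \<alpha> \<alpha>' \<beta> \<beta>' \<gamma> z"
        unfolding H_def[symmetric] using g0 by (simp add: field_simps)
    qed
  qed
qed

section \<open>Beta integrals with complex parameters\<close>

lemma set_integrable_of_continuous_bound:
  fixes f :: "real \<Rightarrow> complex" and g :: "real \<Rightarrow> real"
  assumes g: "set_integrable lborel {0<..<1} g" and f: "continuous_on {0<..<1} f"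
      and le: "\<And>y. 0 < y \<Longrightarrow> y < 1 \<Longrightarrow> cmod (f y) \<le> g y"
    shows "set_integrable lborel {0<..<1} f"
proof (rule set_integrable_bound[OF g])
  have "(\<lambda>y. indicator {0<..<1} y *\<^sub>R f y) \<in> borel_measurable borel"
    by (rule borel_measurable_continuous_on_indicator) (use f in auto)
  thus "set_borel_measurable lborel {0<..<1} f" by (simp add: set_borel_measurable_def)
  show "AE y in lborel. y \<in> {0<..<1} \<longrightarrow> cmod (f y) \<le> norm (g y)"
    using le by (intro AE_I2) (force intro: order_trans[OF _ abs_ge_self])
qed

lemma set_integrable_Beta_open:
  assumes "a > 0" "b > (0::real)"
  shows "set_integrable lborel {0<..<1} (\<lambda>t. t powr (a - 1) * (1 - t) powr (b - 1))"
  by (rule set_integrable_subset[OF integrable_Beta[OF assms]]) auto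

lemma norm_Beta_integrand:
  assumes "0 < y" "y < 1"
  shows "cmod (of_real y powr a * of_real (1 - y) powr b) = y powr Re a * (1 - y) powr Re b"
  using assms by (simp add: norm_mult norm_powr_real_powr del: of_real_diff)

lemma continuous_on_Beta_integrand:
  "continuous_on {0<..<1} (\<lambda>y. complex_of_real y powr a * of_real (1 - y) powr b)"
  by (intro continuous_intros) (auto simp: complex_nonpos_Reals_iff)

lemma set_integrable_Beta_mult:
  fixes H :: "real \<Rightarrow> complex"
  assumes H: "continuous_on {0<..<1} H" "\<And>y. 0 < y \<Longrightarrow> y < 1 \<Longrightarrow> cmod (H y) \<le> C * (1 - y) powr (- E)"
      and a: "Re a > 0" and b: "Re b > E"
  shows "set_integrable lborel {0<..<1} (\<lambda>y. of_real y powr (a - 1) * of_real (1 - y) powr (b - 1) * H y)"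
proof (rule set_integrable_of_continuous_bound)
  show "set_integrable lborel {0<..<1} (\<lambda>y. C * (y powr (Re a - 1) * (1 - y) powr (Re b - E - 1)))"
    using a b by (intro set_integrable_mult_right set_integrable_Beta_open) auto
  show "continuous_on {0<..<1} (\<lambda>y. complex_of_real y powr (a - 1) * of_real (1 - y) powr (b - 1) * H y)"
    by (intro continuous_on_mult continuous_on_Beta_integrand H)
  fix y :: real assume y: "0 < y" "y < 1"
  have "cmod (of_real y powr (a - 1) * of_real (1 - y) powr (b - 1) * H y) = 
      y powr (Re a - 1) * (1 - y) powr (Re b - 1) * cmod (H y)"
    by (simp only: norm_mult[of _ "H y"] norm_Beta_integrand[OF y]) simp
  also have "\<dots> \<le> y powr (Re a - 1) * (1 - y) powr (Re b - 1) * (C * (1 - y) powr (- E))"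
    by (intro mult_left_mono H y) auto
  also have "\<dots> = C * (y powr (Re a - 1) * ((1 - y) powr (Re b - 1) * (1 - y) powr (- E)))"
    by (simp add: mult_ac)
  also have "(1 - y) powr (Re b - 1) * (1 - y) powr (- E) = (1 - y) powr (Re b - E - 1)"
    by (simp only: powr_add[symmetric]) (simp add: algebra_simps)
  finally show "cmod (of_real y powr (a - 1) * of_real (1 - y) powr (b - 1) * H y) \<le> 
      C * (y powr (Re a - 1) * (1 - y) powr (Re b - E - 1))" .
qed

lemma set_integrable_Beta_complex:
  assumes a: "Re a > 0" and b: "Re b > 0"
  shows "set_integrable lborel {0<..<1} (\<lambda>y. of_real y powr (a - 1) * of_real (1 - y) powr (b - 1))"
  using set_integrable_Beta_mult[of "\<lambda>_. 1" 1 0 a b] assms by simp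

lemma integral_01_of_derivative:
  fixes F f :: "real \<Rightarrow> complex"
  assumes "\<And>y. 0 < y \<Longrightarrow> y < 1 \<Longrightarrow> (F has_vector_derivative f y) (at y)"
      and "continuous_on {0<..<1} f" "set_integrable lborel {0<..<1} f"
      and "(F \<longlongrightarrow> A) (at_right 0)" "(F \<longlongrightarrow> B) (at_left 1)"
    shows "(LINT y:{0<..<1}|lborel. f y) = B - A"
proof -
  have "(LBINT x=ereal 0..ereal 1. f x) = B - A"
  proof (rule interval_integral_FTC_integrable)
    fix x :: real assume "ereal 0 < ereal x" "ereal x < ereal 1"
    thus "(F has_vector_derivative f x) (at x)" "isCont f x"
      using assms by (auto simp: continuous_on_eq_continuous_at)
  qed (use assms in \<open>auto simp: ereal_tendsto_simps1 simp del: zero_ereal_def one_ereal_def\<close>)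
  thus ?thesis by (simp add: interval_integral_Ioo)
qed

lemma of_real_powr_has_vector_derivative:
  assumes "0 < y"
  shows "((\<lambda>y. complex_of_real y powr s) has_vector_derivative s * of_real y powr (s - 1)) (at y)"
proof -
  have "((\<lambda>z. z powr s) has_field_derivative (s * of_real y powr (s - 1))) (at (complex_of_real y))"
    using assms by (intro has_field_derivative_powr) (auto simp: complex_nonpos_Reals_iff)
  from has_vector_derivative_real_field[OF this] show ?thesis .
qed

lemma tendsto_at_right_0_of_real_powr:
  assumes "Re s > 0"
  shows "((\<lambda>y. complex_of_real y powr s) \<longlongrightarrow> 0) (at_right 0)"
proof (rule Lim_null_comparison)
  have "eventually (\<lambda>y::real. y > 0) (at_right 0)" by (rule eventually_at_right_less)
  thus "\<forall>\<^sub>F y in at_right 0. cmod (complex_of_real y powr s) \<le> y powr Re s"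
    by eventually_elim (simp add: norm_powr_real_powr)
  show "((\<lambda>y. y powr Re s) \<longlongrightarrow> 0) (at_right 0)" using assms by real_asymp
qed

lemma power_integral_01:
  assumes s: "Re s > 0"
  shows "(LINT y:{0<..<1}|lborel. of_real y powr (s - 1)) = 1 / s"
    and "set_integrable lborel {0<..<1} (\<lambda>y. complex_of_real y powr (s - 1))"
proof -
  have s0: "s \<noteq> 0" using s by auto
  have eq: "complex_of_real y powr (s - 1) * of_real (1 - y) powr (1 - 1) = complex_of_real y powr (s - 1)"
    if "y \<in> {0<..<1}" for y using that by simp
  have "set_integrable lborel {0<..<1} (\<lambda>y. complex_of_real y powr (s - 1) * of_real (1 - y) powr (1 - 1))"
    by (rule set_integrable_Beta_complex) (use s in auto)
  thus int: "set_integrable lborel {0<..<1} (\<lambda>y. complex_of_real y powr (s - 1))"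
    by (rule set_integrable_cong[OF refl refl, THEN iffD1, rotated]) (rule eq)
  have "(LINT y:{0<..<1}|lborel. of_real y powr (s - 1)) = 1 / s - 0"
  proof (rule integral_01_of_derivative[where F = "\<lambda>y. (1 / s) * of_real y powr s", OF _ _ int])
    fix y :: real assume y: "0 < y"
    have "((\<lambda>y. (1 / s) * complex_of_real y powr s) has_vector_derivative (1 / s) * (s * of_real y powr (s - 1))) (at y)"
      using y by (intro has_vector_derivative_mult_right of_real_powr_has_vector_derivative)
    thus "((\<lambda>y. (1 / s) * complex_of_real y powr s) has_vector_derivative of_real y powr (s - 1)) (at y)"
      using s0 by simp
  next
    show "continuous_on {0<..<1} (\<lambda>y. complex_of_real y powr (s - 1))"
      by (intro continuous_intros) (auto simp: complex_nonpos_Reals_iff)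
    show "((\<lambda>y. (1 / s) * complex_of_real y powr s) \<longlongrightarrow> 0) (at_right 0)"
      using tendsto_mult[OF tendsto_const tendsto_at_right_0_of_real_powr[OF s], of "1 / s"] by simp
    have "isCont (\<lambda>y. (1 / s) * complex_of_real y powr s) 1"
      by (intro continuous_intros) auto
    hence "((\<lambda>y. (1 / s) * complex_of_real y powr s) \<longlongrightarrow> (1 / s) * complex_of_real 1 powr s) (at_left 1)"
      unfolding isCont_def by (rule filterlim_mono) (auto simp: at_le)
    thus "((\<lambda>y. (1 / s) * complex_of_real y powr s) \<longlongrightarrow> 1 / s) (at_left 1)" by simp
  qed
  thus "(LINT y:{0<..<1}|lborel. of_real y powr (s - 1)) = 1 / s" by simp
qed

lemma set_integral_sums:
  fixes f :: "nat \<Rightarrow> real \<Rightarrow> complex"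
  assumes int: "\<And>i. set_integrable lborel A (f i)"
      and sm: "\<And>y. y \<in> A \<Longrightarrow> summable (\<lambda>i. cmod (f i y))"
      and sn: "summable (\<lambda>i. LINT y:A|lborel. cmod (f i y))"
    shows "(\<lambda>i. LINT y:A|lborel. f i y) sums (LINT y:A|lborel. (\<Sum>i. f i y))"
proof -
  have eq: "(\<Sum>i. indicator A y *\<^sub>R f i y) = indicator A y *\<^sub>R (\<Sum>i. f i y)" for y
    by (cases "y \<in> A") auto
  have "(\<lambda>i. LINT y|lborel. indicator A y *\<^sub>R f i y) sums (LINT y|lborel. (\<Sum>i. indicator A y *\<^sub>R f i y))"
  proof (rule sums_integral)
    show "integrable lborel (\<lambda>y. indicator A y *\<^sub>R f i y)" for i
      using int[of i] by (simp add: set_integrable_def)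
    show "AE y in lborel. summable (\<lambda>i. cmod (indicator A y *\<^sub>R f i y))"
    proof (rule AE_I2)
      fix y show "summable (\<lambda>i. cmod (indicator A y *\<^sub>R f i y))"
        using sm[of y] by (cases "y \<in> A") auto
    qed
    have "(LINT y|lborel. cmod (indicator A y *\<^sub>R f i y)) = (LINT y:A|lborel. cmod (f i y))" for i
      unfolding set_lebesgue_integral_def by (intro Bochner_Integration.integral_cong) (auto simp: indicator_def)
    thus "summable (\<lambda>i. LINT y|lborel. cmod (indicator A y *\<^sub>R f i y))" using sn by simp
  qed
  thus ?thesis unfolding set_lebesgue_integral_def eq .
qed

lemma powr_minus_one_integral_01:
  assumes "s > (0::real)"
  shows "(LINT y:{0<..<1}|lborel. y powr (s - 1)) = 1 / s"
proof -
  have "complex_of_real (LINT y:{0<..<1}|lborel. y powr (s - 1)) = (LINT y:{0<..<1}|lborel. of_real (y powr (s - 1)))"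
    by (rule set_integral_complex_of_real[symmetric])
  also have "\<dots> = (LINT y:{0<..<1}|lborel. of_real y powr (of_real s - 1))"
  proof (rule set_lebesgue_integral_cong, simp, intro allI impI)
    fix y :: real assume "y \<in> {0<..<1}"
    thus "complex_of_real (y powr (s - 1)) = of_real y powr (of_real s - 1)"
      using powr_of_real[of y "s - 1"] by simp
  qed
  also have "\<dots> = of_real (1 / s)" using assms by (subst power_integral_01) auto
  finally show ?thesis by (simp only: of_real_eq_iff)
qed

text \<open>Expansion of \<open>(1 - y)\<^bsup>b - 1\<^esup>\<close> and termwise integration give a hypergeometric series at \<open>1\<close>, which
  Gauss's theorem sums.\<close>

theorem Beta_integral_complex:
  assumes a: "Re a > 0" and b: "Re b > 0"
  shows "(LINT y:{0<..<1}|lborel. of_real y powr (a - 1) * of_real (1 - y) powr (b - 1)) = Beta a b"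
proof -
  \<comment> \<open>The coefficients of \<open>(1 - y)\<^bsup>b - 1\<^esup>\<close>.\<close>
  define q where "q = (\<lambda>j. pochhammer (1 - b) j / fact j)"
  define f where "f = (\<lambda>j y. q j * complex_of_real y powr (a + of_nat j - 1))"
  have split: "complex_of_real y powr (a + of_nat j - 1) = of_real y powr (a - 1) * of_real y ^ j" 
    if "0 < y" for y j
    using that by (simp add: powr_add powr_diff powr_nat')
  have ser: "(\<lambda>j. f j y) sums (of_real y powr (a - 1) * of_real (1 - y) powr (b - 1))" if "y \<in> {0<..<1}" for y
  proof -
    have "(\<lambda>j. of_real y powr (a - 1) * (q j * of_real y ^ j)) sums 
        (of_real y powr (a - 1) * (1 - of_real y) powr (- (1 - b)))"
      unfolding q_def by (intro sums_mult binomial_series_complex) (use that in auto)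
    moreover have "of_real y powr (a - 1) * (q j * of_real y ^ j) = f j y" for j
      using that unfolding f_def by (subst split) auto
    ultimately show ?thesis by simp
  qed
  obtain C where C: "C > 0" "\<And>n. cmod (pochhammer (1 - b) n) \<le> C * (fact n * (real n + 1) powr (Re (1 - b) - 1))"
    using norm_pochhammer_upper by blast
  have q: "cmod (q j) \<le> C * (real j + 1) powr (- Re b)" for j
    using C(2)[of j] by (simp add: q_def norm_divide field_simps)
  have int: "set_integrable lborel {0<..<1} (f j)" for j
    unfolding f_def using a by (intro set_integrable_mult_right power_integral_01) auto
  have val: "(LINT y:{0<..<1}|lborel. f j y) = q j / (a + of_nat j)" for j
    unfolding f_def using a by (subst set_integral_mult_right, subst power_integral_01) auto
  have nval: "(LINT y:{0<..<1}|lborel. cmod (f j y)) = cmod (q j) / (Re a + j)" for j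
  proof -
    have "(LINT y:{0<..<1}|lborel. cmod (f j y)) = (LINT y:{0<..<1}|lborel. cmod (q j) * y powr (Re a + j - 1))"
      by (rule set_lebesgue_integral_cong) (auto simp: f_def norm_mult norm_powr_real_powr)
    also have "\<dots> = cmod (q j) / (Re a + j)"
      using a by (subst set_integral_mult_right, subst powr_minus_one_integral_01) auto
    finally show ?thesis .
  qed
  have "(\<lambda>j. LINT y:{0<..<1}|lborel. f j y) sums (LINT y:{0<..<1}|lborel. (\<Sum>j. f j y))"
  proof (rule set_integral_sums[OF int])
    fix y :: real assume y: "y \<in> {0<..<1}"
    show "summable (\<lambda>j. cmod (f j y))"
    proof (rule summable_comparison_test_ev)
      show "summable (\<lambda>j. (C * y powr (Re a - 1)) * ((real j + 1) powr (- Re b) * y ^ j))"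
        using y by (intro summable_mult summable_powr_geometric) auto
      show "\<forall>\<^sub>F j in sequentially. norm (cmod (f j y)) \<le> (C * y powr (Re a - 1)) * ((real j + 1) powr (- Re b) * y ^ j)"
      proof (intro always_eventually allI)
        fix j
        have "cmod (f j y) = cmod (q j) * (y powr (Re a - 1) * y ^ j)"
          using y unfolding f_def by (subst split) (auto simp: norm_mult norm_powr_real_powr norm_power)
        also have "\<dots> \<le> (C * (real j + 1) powr (- Re b)) * (y powr (Re a - 1) * y ^ j)"
          using y by (intro mult_right_mono q) auto
        finally show "norm (cmod (f j y)) \<le> (C * y powr (Re a - 1)) * ((real j + 1) powr (- Re b) * y ^ j)"
          by (simp add: mult_ac)
      qed
    qed
  next
    show "summable (\<lambda>j. LINT y:{0<..<1}|lborel. cmod (f j y))"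
    proof (rule summable_comparison_test_ev)
      show "summable (\<lambda>j. (C * max 1 (1 / Re a)) * (real j + 1) powr (- Re b - 1))"
        using b by (intro summable_mult summable_Suc_powr) auto
      show "\<forall>\<^sub>F j in sequentially. norm (LINT y:{0<..<1}|lborel. cmod (f j y)) \<le> (C * max 1 (1 / Re a)) * (real j + 1) powr (- Re b - 1)"
      proof (intro always_eventually allI)
        fix j
        have "real j + 1 \<le> max 1 (1 / Re a) * (Re a + j)"
        proof -
          have "1 / Re a \<le> max 1 (1 / Re a)" by simp
          hence "1 \<le> max 1 (1 / Re a) * Re a" using a by (simp only: pos_divide_le_eq)
          moreover have "1 * real j \<le> max 1 (1 / Re a) * real j" by (intro mult_right_mono) auto
          ultimately show ?thesis by (simp add: distrib_left)
        qed
        hence "1 / (Re a + j) \<le> max 1 (1 / Re a) / (real j + 1)" using a by (simp add: divide_simps)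
        hence "cmod (q j) * (1 / (Re a + j)) \<le> (C * (real j + 1) powr (- Re b)) * (max 1 (1 / Re a) / (real j + 1))"
          using a C(1) by (intro mult_mono q) auto
        thus "norm (LINT y:{0<..<1}|lborel. cmod (f j y)) \<le> (C * max 1 (1 / Re a)) * (real j + 1) powr (- Re b - 1)"
          unfolding nval using a by (simp add: powr_diff mult_ac)
      qed
    qed
  qed
  moreover have "(LINT y:{0<..<1}|lborel. (\<Sum>j. f j y)) = 
      (LINT y:{0<..<1}|lborel. of_real y powr (a - 1) * of_real (1 - y) powr (b - 1))"
    by (rule set_lebesgue_integral_cong) (use ser in \<open>auto simp: sums_iff\<close>)
  ultimately have S: "(\<lambda>j. q j / (a + of_nat j)) sums 
      (LINT y:{0<..<1}|lborel. of_real y powr (a - 1) * of_real (1 - y) powr (b - 1))" by (simp add: val)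
  have an: "a + of_nat j \<noteq> 0" for j using a by (auto simp: complex_eq_iff)
  have a': "a \<notin> \<int>\<^sub>\<le>\<^sub>0" using nonpos_Int_Re_le[of a] a by auto
  have g: "q j / (a + of_nat j) = Gamma a * gauss_term (1 - b) a (a + 1) j" for j
  proof -
    have "rGamma a = pochhammer a j * ((a + of_nat j) * rGamma (a + of_nat j + 1))"
      unfolding rGamma_plus1 by (rule pochhammer_rGamma)
    moreover have "Gamma a * rGamma a = 1" using a' by (simp add: Gamma_def rGamma_eq_zero_iff)
    ultimately have *: "1 / (a + of_nat j) = Gamma a * (pochhammer a j * rGamma (a + 1 + of_nat j))"
      using an[of j] by (simp add: field_simps add_ac)
    have "q j / (a + of_nat j) = q j * (1 / (a + of_nat j))" by simp
    also have "\<dots> = Gamma a * gauss_term (1 - b) a (a + 1) j"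
      unfolding * gauss_term_def q_def by (simp add: mult_ac)
    finally show ?thesis .
  qed
  have re: "Re (a + 1 - (1 - b) - a) > 0" using b by simp
  have "(\<lambda>j. Gamma a * gauss_term (1 - b) a (a + 1) j) sums (Gamma a * suminf (gauss_term (1 - b) a (a + 1)))"
    by (intro sums_mult summable_sums summable_norm_cancel[OF summable_norm_gauss_term] re)
  also have "suminf (gauss_term (1 - b) a (a + 1)) = Gamma b * rGamma (a + b)"
    using gauss_sum[OF re] by (simp add: add_ac)
  finally have "(\<lambda>j. q j / (a + of_nat j)) sums (Gamma a * (Gamma b * rGamma (a + b)))" by (simp add: g)
  thus ?thesis using S sums_unique2 by (auto simp: Beta_altdef mult_ac)
qed

lemma Beta_integral_real_open:
  assumes a: "a > 0" and b: "b > (0::real)"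
  shows "(LINT y:{0<..<1}|lborel. y powr (a - 1) * (1 - y) powr (b - 1)) = Beta a b"
proof -
  have "complex_of_real (LINT y:{0<..<1}|lborel. y powr (a - 1) * (1 - y) powr (b - 1)) = 
      (LINT y:{0<..<1}|lborel. of_real (y powr (a - 1) * (1 - y) powr (b - 1)))"
    by (rule set_integral_complex_of_real[symmetric])
  also have "\<dots> = (LINT y:{0<..<1}|lborel. of_real y powr (of_real a - 1) * of_real (1 - y) powr (of_real b - 1))"
  proof (rule set_lebesgue_integral_cong, simp, intro allI impI)
    fix y :: real assume "y \<in> {0<..<1}"
    thus "complex_of_real (y powr (a - 1) * (1 - y) powr (b - 1)) = 
        of_real y powr (of_real a - 1) * of_real (1 - y) powr (of_real b - 1)"
      using powr_of_real[of y "a - 1"] powr_of_real[of "1 - y" "b - 1"] by simp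
  qed
  also have "\<dots> = of_real (Beta a b)" using assms by (subst Beta_integral_complex) (auto simp: Beta_complex_of_real)
  finally show ?thesis by (simp only: of_real_eq_iff)
qed

lemma Beta_plus_of_nat:
  fixes a b :: complex
  assumes "a \<notin> \<int>\<^sub>\<le>\<^sub>0"
  shows "Beta (a + of_nat n) b = pochhammer a n * Gamma a * Gamma b * rGamma (a + b + of_nat n)"
proof -
  have "Gamma (a + of_nat n) = pochhammer a n * Gamma a"
    using assms by (simp add: pochhammer_Gamma Gamma_eq_zero_iff)
  thus ?thesis by (simp add: Beta_altdef add_ac)
qed

lemma Beta_plus_of_nat_upper:
  fixes a b :: complex
  assumes "a \<notin> \<int>\<^sub>\<le>\<^sub>0" "a + b \<notin> \<int>\<^sub>\<le>\<^sub>0"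
  obtains C where "C \<ge> 0" "\<And>n. cmod (Beta (a + of_nat n) b) \<le> C * (real n + 1) powr (- Re b)"
proof -
  obtain C where C: "C > 0" "\<And>n. cmod (pochhammer a n / pochhammer (a + b) n) \<le> C * (real n + 1) powr (Re a - Re (a + b))"
    using norm_pochhammer_ratio[OF assms(2)] by blast
  have pz: "pochhammer (a + b) n \<noteq> 0" for n using assms(2) pochhammer_eq_0_imp_nonpos_Int by blast
  define B where "B = Gamma a * Gamma b * rGamma (a + b)"
  show ?thesis
  proof (rule that)
    fix n
    have "Beta (a + of_nat n) b = B * (pochhammer a n / pochhammer (a + b) n)"
      unfolding Beta_plus_of_nat[OF assms(1)] B_def using pz[of n] pochhammer_rGamma[of "a + b" n] by simp
    hence "cmod (Beta (a + of_nat n) b) = cmod B * cmod (pochhammer a n / pochhammer (a + b) n)"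
      by (simp only: norm_mult)
    also have "\<dots> \<le> cmod B * (C * (real n + 1) powr (- Re b))"
      using C(2)[of n] by (intro mult_left_mono) auto
    finally show "cmod (Beta (a + of_nat n) b) \<le> cmod B * C * (real n + 1) powr (- Re b)" by (simp add: mult_ac)
  qed (use C(1) in auto)
qed

section \<open>The Mellin transform of the kernel\<close>

text \<open>The factor by which the MSM integral multiplies a power with exponent \<open>\<rho> - 1\<close>. Reciprocals are
  written with \<open>rGamma\<close>, which is entire.\<close>

definition MSM_multiplier :: "complex \<Rightarrow> complex \<Rightarrow> complex \<Rightarrow> complex \<Rightarrow> complex \<Rightarrow> complex \<Rightarrow> complex" where
  "MSM_multiplier \<alpha> \<alpha>' \<beta> \<beta>' \<gamma> \<rho> =
     Gamma \<rho> * Gamma (\<rho> + \<beta>' - \<alpha>') * Gamma (\<rho> + \<gamma> - \<alpha> - \<alpha>' - \<beta>) *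
     rGamma (\<rho> + \<beta>') * rGamma (\<rho> + \<gamma> - \<alpha> - \<alpha>') * rGamma (\<rho> + \<gamma> - \<alpha>' - \<beta>)"

definition F3_kernel :: "complex \<Rightarrow> complex \<Rightarrow> complex \<Rightarrow> complex \<Rightarrow> complex \<Rightarrow> complex \<Rightarrow> real \<Rightarrow> complex" where
  "F3_kernel \<alpha> \<alpha>' \<beta> \<beta>' \<gamma> \<rho> y =
     of_real y powr (\<gamma> - 1) * of_real (1 - y) powr (\<rho> - 1) * F3_diag \<alpha> \<alpha>' \<beta> \<beta>' \<gamma> (of_real y)"

lemma continuous_on_F3_diag:
  assumes "Re \<gamma> > 0"
  shows "continuous_on {0<..<1} (\<lambda>y. F3_diag \<alpha> \<alpha>' \<beta> \<beta>' \<gamma> (complex_of_real y))"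
proof -
  have g: "\<gamma> \<notin> \<int>\<^sub>\<le>\<^sub>0" using nonpos_Int_Re_le[of \<gamma>] assms by auto
  show ?thesis
    by (rule continuous_on_compose2[OF holomorphic_on_imp_continuous_on[OF holomorphic_F3_diag[OF g]]])
       (auto intro!: continuous_intros)
qed

lemma F3_kernel_integrable:
  assumes \<gamma>: "Re \<gamma> > 0" and \<rho>: "Re \<rho> > F3_exponent \<alpha> \<alpha>' \<beta> \<beta>' \<gamma>"
  shows "set_integrable lborel {0<..<1} (F3_kernel \<alpha> \<alpha>' \<beta> \<beta>' \<gamma> \<rho>)"
proof -
  obtain E where E: "F3_exponent \<alpha> \<alpha>' \<beta> \<beta>' \<gamma> < E" "E < Re \<rho>" using dense[OF \<rho>] by blast
  obtain C where "\<And>y. 0 \<le> y \<Longrightarrow> y < 1 \<Longrightarrow> cmod ((deriv ^^ 0) (F3_diag \<alpha> \<alpha>' \<beta> \<beta>' \<gamma>) (of_real y)) \<le> C * (1 - y) powr (- E - real 0)"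
    using growsE[OF grows_F3_diag[OF \<gamma> E(1)]] by blast
  hence "\<And>y. 0 < y \<Longrightarrow> y < 1 \<Longrightarrow> cmod (F3_diag \<alpha> \<alpha>' \<beta> \<beta>' \<gamma> (of_real y)) \<le> C * (1 - y) powr (- E)"
    by fastforce
  from set_integrable_Beta_mult[OF continuous_on_F3_diag[OF \<gamma>] this \<gamma> E(2)]
  show ?thesis unfolding F3_kernel_def .
qed

text \<open>Termwise integration yields a double series; Gauss's theorem sums its rows, and then the series of
  the row sums.\<close>

lemma F3_mellin_base:
  assumes \<gamma>: "Re \<gamma> > 0" and \<rho>: "Re \<rho> > F3_exponent \<alpha> \<alpha>' \<beta> \<beta>' \<gamma>" and \<alpha>': "Re \<alpha>' \<ge> 1"
  shows "(LINT y:{0<..<1}|lborel. F3_kernel \<alpha> \<alpha>' \<beta> \<beta>' \<gamma> \<rho> y) = Gamma \<gamma> * MSM_multiplier \<alpha> \<alpha>' \<beta> \<beta>' \<gamma> \<rho>"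
proof -
  obtain E where E: "F3_exponent \<alpha> \<alpha>' \<beta> \<beta>' \<gamma> < E" "E < Re \<rho>" using dense[OF \<rho>] by blast
  have \<rho>0: "Re \<rho> > 0" and \<rho>1: "Re \<rho> > Re (\<alpha>' - \<beta>')" and \<rho>2: "Re \<rho> > Re (\<alpha> + \<alpha>' + \<beta> - \<gamma>)" 
    using \<rho> by (auto simp: F3_exponent_def)
  have E0: "E > 0" using E by (auto simp: F3_exponent_def)
  have g: "\<gamma> \<notin> \<int>\<^sub>\<le>\<^sub>0" using nonpos_Int_Re_le[of \<gamma>] \<gamma> by auto
  have gr: "\<gamma> + \<rho> \<notin> \<int>\<^sub>\<le>\<^sub>0" using nonpos_Int_Re_le[of "\<gamma> + \<rho>"] \<gamma> \<rho>0 by auto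
  have pz: "pochhammer \<gamma> n \<noteq> 0" for n using g pochhammer_eq_0_imp_nonpos_Int by blast
  let ?t = "F3_term \<alpha> \<alpha>' \<beta> \<beta>' \<gamma>" and ?c = "F3_coeff \<alpha> \<alpha>' \<beta> \<beta>' \<gamma>"
  obtain K where K: "\<And>n. (\<Sum>k\<le>n. cmod (?t k (n - k))) \<le> K * (real n + 1) powr (E - 1)"
    using F3_coeff_bound[OF g \<alpha>' E(1)] by auto
  have c: "cmod (?c n) \<le> K * (real n + 1) powr (E - 1)" for n
    unfolding F3_coeff_def by (rule order_trans[OF norm_sum K])
  have K0: "K \<ge> 0" using order_trans[OF norm_ge_zero c[of 0]] by simp
  obtain C where C: "\<And>r. 0 \<le> r \<Longrightarrow> r < 1 \<Longrightarrow> summable (\<lambda>n. cmod (?c n) * r ^ n)"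
    using power_series_growth[OF E0 c] by metis
  have Reg: "complex_of_real (Re \<gamma>) \<notin> \<int>\<^sub>\<le>\<^sub>0" "complex_of_real (Re \<gamma>) + of_real (Re \<rho>) \<notin> \<int>\<^sub>\<le>\<^sub>0"
    using nonpos_Int_Re_le[of "complex_of_real (Re \<gamma>)"] nonpos_Int_Re_le[of "complex_of_real (Re \<gamma>) + of_real (Re \<rho>)"] \<gamma> \<rho>0 by auto
  obtain D where D: "D \<ge> 0" "\<And>n. cmod (Beta (of_real (Re \<gamma>) + of_nat n) (of_real (Re \<rho>))) \<le> D * (real n + 1) powr (- Re \<rho>)"
    using Beta_plus_of_nat_upper[OF Reg] by auto
  have D': "Beta (Re \<gamma> + real n) (Re \<rho>) \<le> D * (real n + 1) powr (- Re \<rho>)" for n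
  proof -
    have "complex_of_real (Re \<gamma>) + of_nat n = of_real (Re \<gamma> + real n)" by simp
    hence "cmod (Beta (of_real (Re \<gamma>) + of_nat n) (of_real (Re \<rho>))) = \<bar>Beta (Re \<gamma> + real n) (Re \<rho>)\<bar>"
      by (simp only: Beta_complex_of_real norm_of_real)
    thus ?thesis using D(2)[of n] by simp
  qed
  define f where "f = (\<lambda>n y. ?c n * (complex_of_real y powr (\<gamma> + of_nat n - 1) * of_real (1 - y) powr (\<rho> - 1)))"
  have f_split: "f n y = of_real y powr (\<gamma> - 1) * of_real (1 - y) powr (\<rho> - 1) * (?c n * of_real y ^ n)"
    if "0 < y" for n y
  proof -
    have "complex_of_real y powr (\<gamma> + of_nat n - 1) = of_real y powr (\<gamma> - 1) * of_real y ^ n"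
      using that by (simp add: powr_add powr_diff powr_nat')
    thus ?thesis by (simp add: f_def mult_ac)
  qed
  have int: "set_integrable lborel {0<..<1} (f n)" for n
    unfolding f_def using \<gamma> \<rho>0 by (intro set_integrable_mult_right set_integrable_Beta_complex) auto
  have val: "(LINT y:{0<..<1}|lborel. f n y) = ?c n * Beta (\<gamma> + of_nat n) \<rho>" for n
    unfolding f_def using \<gamma> \<rho>0 by (subst set_integral_mult_right, subst Beta_integral_complex) auto
  have nval: "(LINT y:{0<..<1}|lborel. cmod (f n y)) = cmod (?c n) * Beta (Re \<gamma> + n) (Re \<rho>)" for n
  proof -
    have "(LINT y:{0<..<1}|lborel. cmod (f n y)) = 
        (LINT y:{0<..<1}|lborel. cmod (?c n) * (y powr (Re \<gamma> + n - 1) * (1 - y) powr (Re \<rho> - 1)))"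
    proof (rule set_lebesgue_integral_cong, simp, intro allI impI)
      fix y :: real assume "y \<in> {0<..<1}"
      thus "cmod (f n y) = cmod (?c n) * (y powr (Re \<gamma> + n - 1) * (1 - y) powr (Re \<rho> - 1))"
        unfolding f_def norm_mult[of "?c n"] by (subst norm_Beta_integrand) auto
    qed
    also have "\<dots> = cmod (?c n) * Beta (Re \<gamma> + n) (Re \<rho>)"
      using \<gamma> \<rho>0 by (subst set_integral_mult_right, subst Beta_integral_real_open) auto
    finally show ?thesis .
  qed
  have sm_c: "summable (\<lambda>n. K * D * (real n + 1) powr (E - 1 - Re \<rho>))"
    using E(2) by (intro summable_mult summable_Suc_powr) auto
  have prodb: "(K * (real n + 1) powr (E - 1)) * (D * (real n + 1) powr (- Re \<rho>)) = K * D * (real n + 1) powr (E - 1 - Re \<rho>)" for n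
  proof -
    have "(real n + 1) powr (E - 1) * (real n + 1) powr (- Re \<rho>) = (real n + 1) powr (E - 1 - Re \<rho>)"
      by (simp only: powr_add[symmetric]) simp
    thus ?thesis by (simp add: mult_ac)
  qed
  have "(\<lambda>n. LINT y:{0<..<1}|lborel. f n y) sums (LINT y:{0<..<1}|lborel. (\<Sum>n. f n y))"
  proof (rule set_integral_sums[OF int])
    fix y :: real assume y: "y \<in> {0<..<1}"
    have "summable (\<lambda>n. cmod (of_real y powr (\<gamma> - 1) * of_real (1 - y) powr (\<rho> - 1)) * (cmod (?c n) * y ^ n))"
      using y by (intro summable_mult C) auto
    moreover have "cmod (f n y) = cmod (of_real y powr (\<gamma> - 1) * of_real (1 - y) powr (\<rho> - 1)) * (cmod (?c n) * y ^ n)" for n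
      using y by (subst f_split) (auto simp: norm_mult norm_power)
    ultimately show "summable (\<lambda>n. cmod (f n y))" by simp
  next
    show "summable (\<lambda>n. LINT y:{0<..<1}|lborel. cmod (f n y))"
    proof (rule summable_comparison_test_ev[OF _ sm_c])
      show "\<forall>\<^sub>F n in sequentially. norm (LINT y:{0<..<1}|lborel. cmod (f n y)) \<le> K * D * (real n + 1) powr (E - 1 - Re \<rho>)"
      proof (intro always_eventually allI)
        fix n :: nat
        have B0: "Beta (Re \<gamma> + n) (Re \<rho>) \<ge> 0" 
          unfolding Beta_def using \<gamma> \<rho>0
          by (intro divide_nonneg_nonneg mult_nonneg_nonneg less_imp_le[OF Gamma_real_pos]) auto
        have "cmod (?c n) * Beta (Re \<gamma> + n) (Re \<rho>) \<le> (K * (real n + 1) powr (E - 1)) * (D * (real n + 1) powr (- Re \<rho>))"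
          using K0 B0 by (intro mult_mono c D') auto
        thus "norm (LINT y:{0<..<1}|lborel. cmod (f n y)) \<le> K * D * (real n + 1) powr (E - 1 - Re \<rho>)"
          unfolding nval prodb using B0 by simp
      qed
    qed
  qed
  moreover have "(LINT y:{0<..<1}|lborel. (\<Sum>n. f n y)) = (LINT y:{0<..<1}|lborel. F3_kernel \<alpha> \<alpha>' \<beta> \<beta>' \<gamma> \<rho> y)"
  proof (rule set_lebesgue_integral_cong, simp, intro allI impI)
    fix y :: real assume y: "y \<in> {0<..<1}"
    have "(\<lambda>n. of_real y powr (\<gamma> - 1) * of_real (1 - y) powr (\<rho> - 1) * (?c n * of_real y ^ n)) sums
        (F3_kernel \<alpha> \<alpha>' \<beta> \<beta>' \<gamma> \<rho> y)"
      unfolding F3_kernel_def using y by (intro sums_mult F3_diag_sums g) auto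
    moreover have "of_real y powr (\<gamma> - 1) * of_real (1 - y) powr (\<rho> - 1) * (?c n * of_real y ^ n) = f n y" for n
      using y by (subst f_split) auto
    ultimately show "(\<Sum>n. f n y) = F3_kernel \<alpha> \<alpha>' \<beta> \<beta>' \<gamma> \<rho> y" by (simp add: sums_iff)
  qed
  ultimately have S: "(\<lambda>n. ?c n * Beta (\<gamma> + of_nat n) \<rho>) sums (LINT y:{0<..<1}|lborel. F3_kernel \<alpha> \<alpha>' \<beta> \<beta>' \<gamma> \<rho> y)"
    by (simp add: val)
  \<comment> \<open>The same series, now arranged by rows.\<close>
  define T where "T = (\<lambda>k l. ?t k l * Beta (\<gamma> + of_nat (k + l)) \<rho>)"
  obtain D2 where D2: "D2 \<ge> 0" "\<And>n. cmod (Beta (\<gamma> + of_nat n) \<rho>) \<le> D2 * (real n + 1) powr (- Re \<rho>)"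
    using Beta_plus_of_nat_upper[OF g gr] by auto
  have diag: "summable (\<lambda>n. \<Sum>k\<le>n. cmod (T k (n - k)))"
  proof (rule summable_comparison_test_ev)
    show "summable (\<lambda>n. K * D2 * (real n + 1) powr (E - 1 - Re \<rho>))"
      using E(2) by (intro summable_mult summable_Suc_powr) auto
    show "\<forall>\<^sub>F n in sequentially. norm (\<Sum>k\<le>n. cmod (T k (n - k))) \<le> K * D2 * (real n + 1) powr (E - 1 - Re \<rho>)"
    proof (intro always_eventually allI)
      fix n
      have "(\<Sum>k\<le>n. cmod (T k (n - k))) = (\<Sum>k\<le>n. cmod (?t k (n - k))) * cmod (Beta (\<gamma> + of_nat n) \<rho>)"
        by (simp add: T_def norm_mult sum_distrib_right)
      also have "\<dots> \<le> (K * (real n + 1) powr (E - 1)) * (D2 * (real n + 1) powr (- Re \<rho>))"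
        using K0 by (intro mult_mono K D2) auto
      also have "\<dots> = K * D2 * (real n + 1) powr (E - 1 - Re \<rho>)"
      proof -
        have "(real n + 1) powr (E - 1) * (real n + 1) powr (- Re \<rho>) = (real n + 1) powr (E - 1 - Re \<rho>)"
          by (simp only: powr_add[symmetric]) simp
        thus ?thesis by (simp add: mult_ac)
      qed
      finally show "norm (\<Sum>k\<le>n. cmod (T k (n - k))) \<le> K * D2 * (real n + 1) powr (E - 1 - Re \<rho>)"
        by (simp add: sum_nonneg)
    qed
  qed
  note T = double_series_of_diag[OF diag]
  have "(\<Sum>k\<le>n. T k (n - k)) = ?c n * Beta (\<gamma> + of_nat n) \<rho>" for n
    by (simp add: T_def F3_coeff_def sum_distrib_right)
  hence "(\<lambda>n. ?c n * Beta (\<gamma> + of_nat n) \<rho>) sums infsum (\<lambda>(k, l). T k l) UNIV"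
    using double_series_diag[of T, OF T] by (simp only:)
  from sums_unique2[OF this S]
  have "(\<lambda>k. \<Sum>l. T k l) sums (LINT y:{0<..<1}|lborel. F3_kernel \<alpha> \<alpha>' \<beta> \<beta>' \<gamma> \<rho> y)"
    using double_series_rows[of T, OF T] by (simp only:)
  moreover have "(\<Sum>l. T k l) = Gamma \<gamma> * Gamma \<rho> * Gamma (\<rho> + \<beta>' - \<alpha>') * rGamma (\<rho> + \<beta>') * gauss_term \<alpha> \<beta> (\<gamma> + \<rho> - \<alpha>') k" for k
  proof -
    define c where "c = \<gamma> + \<rho> + of_nat k"
    define b where "b = \<gamma> - \<beta>' + of_nat k"
    have Tk: "T k l = Gamma \<gamma> * Gamma \<rho> * (pochhammer \<alpha> k * pochhammer \<beta> k / fact k) * gauss_term \<alpha>' b c l" for l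
      unfolding T_def Beta_plus_of_nat[OF g] F3_term_def gauss_term_def b_def c_def
      using pz[of "k + l"] by (simp add: add_ac mult_ac)
    have re: "Re (c - \<alpha>' - b) > 0" using \<rho>1 by (simp add: c_def b_def)
    have "(\<Sum>l. T k l) = Gamma \<gamma> * Gamma \<rho> * (pochhammer \<alpha> k * pochhammer \<beta> k / fact k) * suminf (gauss_term \<alpha>' b c)"
      unfolding Tk by (intro suminf_mult summable_norm_cancel[OF summable_norm_gauss_term] re)
    also have "suminf (gauss_term \<alpha>' b c) = Gamma (\<rho> + \<beta>' - \<alpha>') * rGamma (\<gamma> + \<rho> - \<alpha>' + of_nat k) * rGamma (\<rho> + \<beta>')"
      unfolding gauss_sum[OF re] by (simp add: c_def b_def algebra_simps)
    finally show ?thesis by (simp add: gauss_term_def mult_ac)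
  qed
  ultimately have S1: "(\<lambda>k. Gamma \<gamma> * Gamma \<rho> * Gamma (\<rho> + \<beta>' - \<alpha>') * rGamma (\<rho> + \<beta>') * gauss_term \<alpha> \<beta> (\<gamma> + \<rho> - \<alpha>') k) sums 
     (LINT y:{0<..<1}|lborel. F3_kernel \<alpha> \<alpha>' \<beta> \<beta>' \<gamma> \<rho> y)" by simp
  have re: "Re (\<gamma> + \<rho> - \<alpha>' - \<alpha> - \<beta>) > 0" using \<rho>2 by simp
  have S2: "(\<lambda>k. Gamma \<gamma> * Gamma \<rho> * Gamma (\<rho> + \<beta>' - \<alpha>') * rGamma (\<rho> + \<beta>') * gauss_term \<alpha> \<beta> (\<gamma> + \<rho> - \<alpha>') k) sums 
     (Gamma \<gamma> * Gamma \<rho> * Gamma (\<rho> + \<beta>' - \<alpha>') * rGamma (\<rho> + \<beta>') * suminf (gauss_term \<alpha> \<beta> (\<gamma> + \<rho> - \<alpha>')))"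
    by (intro sums_mult summable_sums summable_norm_cancel[OF summable_norm_gauss_term] re)
  have "suminf (gauss_term \<alpha> \<beta> (\<gamma> + \<rho> - \<alpha>')) = 
      Gamma (\<rho> + \<gamma> - \<alpha> - \<alpha>' - \<beta>) * rGamma (\<rho> + \<gamma> - \<alpha> - \<alpha>') * rGamma (\<rho> + \<gamma> - \<alpha>' - \<beta>)"
    unfolding gauss_sum[OF re] by (simp add: algebra_simps)
  thus ?thesis using sums_unique2[OF S1 S2] by (simp add: MSM_multiplier_def mult_ac)
qed

text \<open>With \<open>H\<close> for the shifted series, the contiguous relation gives for the derivative of
  \<open>y\<^bsup>\<gamma>\<^esup> (1 - y)\<^bsup>\<rho>\<^esup> H(y)\<close> the value \<open>y\<^bsup>\<gamma> - 1\<^esup> (1 - y)\<^bsup>\<rho> - 1\<^esup> (\<gamma> F3_diag(y) - (\<rho> + \<beta>') y H(y))\<close>. The function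
  vanishes at both ends, so that the two integrals are proportional.\<close>

theorem F3_mellin:
  assumes \<gamma>: "Re \<gamma> > 0" and \<rho>: "Re \<rho> > F3_exponent \<alpha> \<alpha>' \<beta> \<beta>' \<gamma>"
  shows "(LINT y:{0<..<1}|lborel. F3_kernel \<alpha> \<alpha>' \<beta> \<beta>' \<gamma> \<rho> y) = Gamma \<gamma> * MSM_multiplier \<alpha> \<alpha>' \<beta> \<beta>' \<gamma> \<rho>"
proof -
  obtain r :: nat where r: "1 - Re \<alpha>' \<le> real r" using real_arch_simple by blast
  hence "Re \<alpha>' + r \<ge> 1" by simp
  thus ?thesis using assms
  proof (induction r arbitrary: \<alpha>' \<beta>' \<gamma>)
    case 0
    thus ?case by (intro F3_mellin_base) auto
  next
    case (Suc r)
    note \<gamma> = Suc.prems(2) and \<rho> = Suc.prems(3)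
    define H where "H = F3_diag \<alpha> (\<alpha>' + 1) \<beta> (\<beta>' + 1) (\<gamma> + 1)"
    have \<gamma>1: "Re (\<gamma> + 1) > 0" using \<gamma> by simp
    have ex: "F3_exponent \<alpha> (\<alpha>' + 1) \<beta> (\<beta>' + 1) (\<gamma> + 1) = F3_exponent \<alpha> \<alpha>' \<beta> \<beta>' \<gamma>"
      by (simp add: F3_exponent_def)
    have \<rho>1: "Re \<rho> > F3_exponent \<alpha> (\<alpha>' + 1) \<beta> (\<beta>' + 1) (\<gamma> + 1)" using \<rho> ex by simp
    define I where "I = (LINT y:{0<..<1}|lborel. F3_kernel \<alpha> \<alpha>' \<beta> \<beta>' \<gamma> \<rho> y)"
    define I' where "I' = (LINT y:{0<..<1}|lborel. F3_kernel \<alpha> (\<alpha>' + 1) \<beta> (\<beta>' + 1) (\<gamma> + 1) \<rho> y)"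
    have IH: "I' = Gamma (\<gamma> + 1) * MSM_multiplier \<alpha> (\<alpha>' + 1) \<beta> (\<beta>' + 1) (\<gamma> + 1) \<rho>"
      unfolding I'_def by (rule Suc.IH) (use Suc.prems \<rho>1 in auto)
    obtain E where E: "F3_exponent \<alpha> (\<alpha>' + 1) \<beta> (\<beta>' + 1) (\<gamma> + 1) < E" "E < Re \<rho>" using dense[OF \<rho>1] by blast
    obtain C where "\<And>y. 0 \<le> y \<Longrightarrow> y < 1 \<Longrightarrow> cmod ((deriv ^^ 0) H (of_real y)) \<le> C * (1 - y) powr (- E - real 0)"
      unfolding H_def using growsE[OF grows_F3_diag[OF \<gamma>1 E(1)]] by blast
    hence C: "\<And>y. 0 < y \<Longrightarrow> y < 1 \<Longrightarrow> cmod (H (of_real y)) \<le> C * (1 - y) powr (- E)"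
      by fastforce
    have g1: "\<gamma> + 1 \<notin> \<int>\<^sub>\<le>\<^sub>0" using nonpos_Int_Re_le[of "\<gamma> + 1"] \<gamma> by auto
    note int = F3_kernel_integrable[OF \<gamma> \<rho>] F3_kernel_integrable[OF \<gamma>1 \<rho>1]
    \<comment> \<open>The function whose derivative yields the recurrence between the two integrals.\<close>
    define F where "F = (\<lambda>y. of_real y powr \<gamma> * of_real (1 - y) powr \<rho> * H (of_real y))"
    define f where "f = (\<lambda>y. \<gamma> * F3_kernel \<alpha> \<alpha>' \<beta> \<beta>' \<gamma> \<rho> y - (\<beta>' + \<rho>) * F3_kernel \<alpha> (\<alpha>' + 1) \<beta> (\<beta>' + 1) (\<gamma> + 1) \<rho> y)"
    have Fle: "cmod (F y) \<le> C * (y powr Re \<gamma> * (1 - y) powr (Re \<rho> - E))" if y: "0 < y" "y < 1" for y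
    proof -
      have "cmod (F y) = y powr Re \<gamma> * (1 - y) powr Re \<rho> * cmod (H (of_real y))"
        unfolding F_def norm_mult[of _ "H (of_real y)"] norm_Beta_integrand[OF y] ..
      also have "\<dots> \<le> y powr Re \<gamma> * (1 - y) powr Re \<rho> * (C * (1 - y) powr (- E))"
        by (intro mult_left_mono C y) auto
      also have "\<dots> = C * (y powr Re \<gamma> * ((1 - y) powr Re \<rho> * (1 - y) powr (- E)))" by (simp add: mult_ac)
      also have "(1 - y) powr Re \<rho> * (1 - y) powr (- E) = (1 - y) powr (Re \<rho> - E)"
        by (simp only: powr_add[symmetric]) simp
      finally show ?thesis .
    qed
    have "(LINT y:{0<..<1}|lborel. f y) = 0 - 0"
    proof (rule integral_01_of_derivative)
      fix y :: real assume y: "0 < y" "y < 1"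
      have "(H has_field_derivative deriv H (of_real y)) (at (of_real y))"
        using holomorphic_F3_diag[OF g1] y unfolding H_def by (intro holomorphic_derivI[of _ "ball 0 1"]) auto
      from has_vector_derivative_real_field[OF this]
      have dH: "((\<lambda>y. H (of_real y)) has_vector_derivative deriv H (of_real y)) (at y)" .
      have d1: "((\<lambda>y. complex_of_real y powr \<gamma>) has_vector_derivative \<gamma> * of_real y powr (\<gamma> - 1)) (at y)"
        using y by (intro of_real_powr_has_vector_derivative)
      have "(((\<lambda>y. complex_of_real y powr \<rho>) \<circ> (\<lambda>y. 1 - y)) has_vector_derivative (- 1) *\<^sub>R (\<rho> * of_real (1 - y) powr (\<rho> - 1))) (at y)"
        by (intro vector_diff_chain_at of_real_powr_has_vector_derivative)
           (use y in \<open>auto intro!: derivative_eq_intros\<close>)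
      hence d2: "((\<lambda>y. complex_of_real (1 - y) powr \<rho>) has_vector_derivative - (\<rho> * of_real (1 - y) powr (\<rho> - 1))) (at y)"
        by (simp add: o_def)
      have p1: "complex_of_real y powr \<gamma> = of_real y * of_real y powr (\<gamma> - 1)"
        and p2: "complex_of_real (1 - y) powr \<rho> = of_real (1 - y) * of_real (1 - y) powr (\<rho> - 1)"
      proof -
        have *: "z powr s = z * z powr (s - 1)" if "z \<noteq> 0" for z s :: complex
          using that by (simp add: powr_diff)
        show "complex_of_real y powr \<gamma> = of_real y * of_real y powr (\<gamma> - 1)"
             "complex_of_real (1 - y) powr \<rho> = of_real (1 - y) * of_real (1 - y) powr (\<rho> - 1)"
          by (rule *, use y in simp)+
      qed
      have cont: "\<gamma> * F3_diag \<alpha> \<alpha>' \<beta> \<beta>' \<gamma> (of_real y) = \<gamma> * ((1 - of_real y) * H (of_real y)) + \<beta>' * (of_real y * H (of_real y)) + 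
          (of_real y * ((1 - of_real y) * deriv H (of_real y)))"
        unfolding H_def by (rule F3_diag_contiguous) (use \<gamma> y in auto)
      define P Q where "P = complex_of_real y powr (\<gamma> - 1)" and "Q = complex_of_real (1 - y) powr (\<rho> - 1)"
      have fy: "f y = P * Q * (\<gamma> * F3_diag \<alpha> \<alpha>' \<beta> \<beta>' \<gamma> (of_real y)) - (\<beta>' + \<rho>) * (of_real y * P * Q * H (of_real y))"
        unfolding f_def F3_kernel_def H_def[symmetric] P_def Q_def by (simp add: p1 mult_ac)
      have "(F has_vector_derivative (of_real y powr \<gamma> * of_real (1 - y) powr \<rho>) * deriv H (of_real y) + 
           (of_real y powr \<gamma> * (- (\<rho> * of_real (1 - y) powr (\<rho> - 1))) + (\<gamma> * of_real y powr (\<gamma> - 1)) * of_real (1 - y) powr \<rho>) * H (of_real y)) (at y)"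
        unfolding F_def by (intro has_vector_derivative_mult d1 d2 dH)
      also have "(of_real y powr \<gamma> * of_real (1 - y) powr \<rho>) * deriv H (of_real y) + 
           (of_real y powr \<gamma> * (- (\<rho> * of_real (1 - y) powr (\<rho> - 1))) + (\<gamma> * of_real y powr (\<gamma> - 1)) * of_real (1 - y) powr \<rho>) * H (of_real y)
           = f y"
        unfolding fy cont p1 p2 P_def[symmetric] Q_def[symmetric] by (simp add: algebra_simps)
      finally show "(F has_vector_derivative f y) (at y)" .
    next
      show "continuous_on {0<..<1} f" unfolding f_def F3_kernel_def
        by (intro continuous_on_diff continuous_on_mult continuous_on_const continuous_on_Beta_integrand continuous_on_F3_diag \<gamma> \<gamma>1)
      show "set_integrable lborel {0<..<1} f" unfolding f_def using int by simp
      show "(F \<longlongrightarrow> 0) (at_right 0)"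
      proof (rule Lim_null_comparison)
        have "eventually (\<lambda>y::real. y \<in> {0<..<1}) (at_right 0)" by (rule eventually_at_right_real) simp
        thus "\<forall>\<^sub>F y in at_right 0. cmod (F y) \<le> C * (y powr Re \<gamma> * (1 - y) powr (Re \<rho> - E))"
          by eventually_elim (use Fle in auto)
        show "((\<lambda>y. C * (y powr Re \<gamma> * (1 - y) powr (Re \<rho> - E))) \<longlongrightarrow> 0) (at_right 0)"
          using \<gamma> by real_asymp
      qed
      show "(F \<longlongrightarrow> 0) (at_left 1)"
      proof (rule Lim_null_comparison)
        have "eventually (\<lambda>y::real. y \<in> {0<..<1}) (at_left 1)" by (rule eventually_at_left_real) simp
        thus "\<forall>\<^sub>F y in at_left 1. cmod (F y) \<le> C * (y powr Re \<gamma> * (1 - y) powr (Re \<rho> - E))"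
          by eventually_elim (use Fle in auto)
        have "Re \<rho> - E > 0" using E by simp
        thus "((\<lambda>y. C * (y powr Re \<gamma> * (1 - y) powr (Re \<rho> - E))) \<longlongrightarrow> 0) (at_left 1)"
          by real_asymp
      qed
    qed
    moreover have "(LINT y:{0<..<1}|lborel. f y) = \<gamma> * I - (\<beta>' + \<rho>) * I'"
      unfolding f_def I_def I'_def using int by (simp add: set_integral_diff)
    ultimately have "\<gamma> * I = (\<beta>' + \<rho>) * I'" by simp
    also have "\<dots> = (\<beta>' + \<rho>) * (Gamma (\<gamma> + 1) * MSM_multiplier \<alpha> (\<alpha>' + 1) \<beta> (\<beta>' + 1) (\<gamma> + 1) \<rho>)"
      by (simp only: IH)
    also have "Gamma (\<gamma> + 1) = \<gamma> * Gamma \<gamma>"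
      using nonpos_Int_Re_le[of \<gamma>] \<gamma> by (intro Gamma_plus1) auto
    also have "MSM_multiplier \<alpha> (\<alpha>' + 1) \<beta> (\<beta>' + 1) (\<gamma> + 1) \<rho> = 
      Gamma \<rho> * Gamma (\<rho> + \<beta>' - \<alpha>') * Gamma (\<rho> + \<gamma> - \<alpha> - \<alpha>' - \<beta>) *
      rGamma (\<rho> + \<beta>' + 1) * rGamma (\<rho> + \<gamma> - \<alpha> - \<alpha>') * rGamma (\<rho> + \<gamma> - \<alpha>' - \<beta>)"
      unfolding MSM_multiplier_def by (simp add: algebra_simps)
    also have "(\<beta>' + \<rho>) * (\<gamma> * Gamma \<gamma> * (Gamma \<rho> * Gamma (\<rho> + \<beta>' - \<alpha>') * Gamma (\<rho> + \<gamma> - \<alpha> - \<alpha>' - \<beta>) *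
      rGamma (\<rho> + \<beta>' + 1) * rGamma (\<rho> + \<gamma> - \<alpha> - \<alpha>') * rGamma (\<rho> + \<gamma> - \<alpha>' - \<beta>))) = 
      \<gamma> * (Gamma \<gamma> * MSM_multiplier \<alpha> \<alpha>' \<beta> \<beta>' \<gamma> \<rho>)"
      unfolding MSM_multiplier_def rGamma_plus1[of "\<rho> + \<beta>'", symmetric] by (simp add: algebra_simps)
    finally show ?case using \<gamma> unfolding I_def by auto
  qed
qed

section \<open>The Gamma function on vertical lines\<close>

lemma Ln_approx_quadratic:
  fixes w :: complex
  assumes w: "cmod w \<le> 1/2"
  shows "cmod (Ln (1 + w) - w + w\<^sup>2 / 2) \<le> cmod w ^ 3"
proof -
  let ?f = "\<lambda>n. - ((- w) ^ n) / of_nat n"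
  have "?f sums Ln (1 + w)" by (rule Ln_series') (use w in auto)
  hence "(\<lambda>n. ?f (n + 3)) sums (Ln (1 + w) - (\<Sum>n<3. ?f n))" by (rule sums_split_initial_segment)
  also have "(\<Sum>n<3. ?f n) = w - w\<^sup>2 / 2" by (simp add: eval_nat_numeral)
  also have "Ln (1 + w) - (w - w\<^sup>2 / 2) = Ln (1 + w) - w + w\<^sup>2 / 2" by simp
  finally have S: "(\<lambda>n. ?f (n + 3)) sums (Ln (1 + w) - w + w\<^sup>2 / 2)" .
  have le: "cmod (?f (n + 3)) \<le> cmod w ^ 3 / 3 * (1/2) ^ n" for n
  proof -
    have "cmod (?f (n + 3)) = cmod w ^ n * cmod w ^ 3 / (real n + 3)"
      by (simp only: norm_divide norm_minus_cancel norm_power norm_of_nat power_add)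
         (simp add: norm_mult norm_power)
    also have "\<dots> \<le> (1/2) ^ n * cmod w ^ 3 / 3"
      using w by (intro frac_le mult_mono power_mono) auto
    finally show ?thesis by (simp add: mult_ac)
  qed
  have G: "(\<lambda>n. cmod w ^ 3 / 3 * (1/2) ^ n) sums (cmod w ^ 3 / 3 * (1 / (1 - 1/2)))"
    by (intro sums_mult geometric_sums) auto
  have "cmod (Ln (1 + w) - w + w\<^sup>2 / 2) \<le> (\<Sum>n. cmod w ^ 3 / 3 * (1/2) ^ n)"
    unfolding sums_unique[OF S] by (rule norm_suminf_le[OF le sums_summable[OF G]])
  also have "\<dots> = cmod w ^ 3 / 3 * 2" using G by (simp add: sums_iff)
  also have "\<dots> \<le> cmod w ^ 3" by simp
  finally show ?thesis .
qed

text \<open>The logarithm of the main term in Stirling's formula, up to the constant \<open>ln (2\<pi>) / 2\<close>.\<close>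

definition stirling_exponent :: "complex \<Rightarrow> complex" where
  "stirling_exponent z = (z - 1/2) * Ln z - z"

text \<open>Up to second order the expansion of \<open>Ln (1 + 1 / z)\<close> cancels against the linear terms; the remainder
  is small enough to be summed over \<open>z, z + 1, z + 2, \<dots>\<close>.\<close>

lemma stirling_exponent_step:
  assumes z: "Re z \<ge> 2"
  shows "cmod (stirling_exponent (z + 1) - stirling_exponent z - Ln z) \<le> 2 / (cmod z)\<^sup>2"
proof -
  have z0: "z \<noteq> 0" using z by auto
  have nz: "cmod z \<ge> 2" using z complex_Re_le_cmod[of z] by linarith
  define w where "w = 1 / z"
  have w: "cmod w \<le> 1/2" "w \<noteq> 0" using nz z0 by (auto simp: w_def norm_divide divide_simps)
  define a where "a = Ln (1 + w) - w + w\<^sup>2 / 2"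
  have a: "cmod a \<le> cmod w ^ 3" unfolding a_def by (rule Ln_approx_quadratic) (use w in auto)
  have "Re (1 + w) > 0" using w abs_Re_le_cmod[of w] by simp
  hence "\<bar>Im (Ln (1 + w))\<bar> < pi / 2" by (rule Re_Ln_pos_lt_imp)
  moreover have "\<bar>Im (Ln z)\<bar> < pi / 2" by (rule Re_Ln_pos_lt_imp) (use z in auto)
  moreover have "1 + w \<noteq> 0" using \<open>Re (1 + w) > 0\<close> by (metis zero_complex.sel(1) less_irrefl)
  ultimately have "Ln (z * (1 + w)) = Ln z + Ln (1 + w)"
    using z0 by (subst Ln_times) auto
  moreover have "z * (1 + w) = z + 1" using z0 by (simp add: w_def field_simps)
  ultimately have L: "Ln (z + 1) = Ln z + (w - w\<^sup>2 / 2 + a)" by (simp add: a_def)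
  have z1: "z = 1 / w" using z0 by (simp add: w_def)
  have "stirling_exponent (z + 1) - stirling_exponent z - Ln z = (z + 1/2) * (Ln (z + 1) - Ln z) - 1"
    by (simp add: stirling_exponent_def field_simps)
  also have "\<dots> = a / w + a / 2 - w\<^sup>2 / 4"
    unfolding L using w(2) by (simp add: z1 field_simps power2_eq_square)
  finally have eq: "stirling_exponent (z + 1) - stirling_exponent z - Ln z = a / w + a / 2 - w\<^sup>2 / 4" .
  have "cmod (a / w + a / 2 - w\<^sup>2 / 4) \<le> cmod (a / w) + cmod (a / 2) + cmod (w\<^sup>2 / 4)"
    by (meson norm_triangle_ineq norm_triangle_ineq4 add_right_mono order_trans)
  also have "cmod (a / w) \<le> (cmod w)\<^sup>2"
    using a w by (simp add: norm_divide divide_simps power3_eq_cube power2_eq_square)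
  also have "cmod (a / 2) \<le> (cmod w)\<^sup>2 * (1/2)"
  proof -
    have "cmod a \<le> (cmod w)\<^sup>2 * cmod w" using a by (simp add: power3_eq_cube power2_eq_square mult.assoc)
    also have "\<dots> \<le> (cmod w)\<^sup>2 * 1" using w by (intro mult_left_mono) auto
    finally show ?thesis by (simp add: norm_divide)
  qed
  also have "cmod (w\<^sup>2 / 4) = (cmod w)\<^sup>2 / 4" by (simp add: norm_divide norm_power)
  also have "(cmod w)\<^sup>2 + (cmod w)\<^sup>2 * (1/2) + (cmod w)\<^sup>2 / 4 \<le> 2 * (cmod w)\<^sup>2" by simp
  also have "\<dots> = 2 / (cmod z)\<^sup>2" by (simp add: w_def norm_divide power_divide)
  finally show ?thesis unfolding eq by simp
qed

lemma Re_stirling_exponent: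
  assumes "Re z > 0"
  shows "Re (stirling_exponent z) = (Re z - 1/2) * ln (cmod z) - Im z * arctan (Im z / Re z) - Re z"
proof -
  have "z \<noteq> 0" using assms by auto
  moreover have "Im (Ln z) = arctan (Im z / Re z)"
    using assms \<open>z \<noteq> 0\<close> by (simp add: Im_Ln_eq)
  ultimately show ?thesis by (simp add: stirling_exponent_def)
qed

text \<open>That this difference is bounded for \<open>Re z \<ge> 2\<close> is the form of Stirling's formula used here: it
  determines \<open>\<bar>\<Gamma>\<bar>\<close> up to constant factors.\<close>

definition stirling_defect :: "complex \<Rightarrow> real" where
  "stirling_defect z = ln (cmod (Gamma z)) - Re (stirling_exponent z)"

lemma Gamma_nonzero_Re_pos: "Re z > 0 \<Longrightarrow> Gamma z \<noteq> (0 :: complex)"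
  using nonpos_Int_Re_le[of z] by (auto simp: Gamma_eq_zero_iff)

lemma stirling_defect_step:
  assumes "Re z \<ge> 2"
  shows "\<bar>stirling_defect (z + 1) - stirling_defect z\<bar> \<le> 2 / (cmod z)\<^sup>2"
proof -
  have z: "z \<notin> \<int>\<^sub>\<le>\<^sub>0" "z \<noteq> 0" using nonpos_Int_Re_le[of z] assms by auto
  have "ln (cmod (Gamma (z + 1))) = Re (Ln z) + ln (cmod (Gamma z))"
    using z Gamma_nonzero_Re_pos[of z] assms by (simp add: Gamma_plus1 norm_mult ln_mult)
  hence "stirling_defect (z + 1) - stirling_defect z = - Re (stirling_exponent (z + 1) - stirling_exponent z - Ln z)"
    by (simp add: stirling_defect_def)
  also have "\<bar>\<dots>\<bar> \<le> cmod (stirling_exponent (z + 1) - stirling_exponent z - Ln z)"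
    by (simp only: abs_minus_cancel abs_Re_le_cmod)
  also have "\<dots> \<le> 2 / (cmod z)\<^sup>2" by (rule stirling_exponent_step) fact
  finally show ?thesis .
qed

lemma stirling_defect_shift:
  obtains M where "\<And>z n. Re z \<ge> 2 \<Longrightarrow> \<bar>stirling_defect (z + of_nat n) - stirling_defect z\<bar> \<le> M"
proof -
  have sm: "summable (\<lambda>k. 2 * (real k + 1) powr (-2))" by (intro summable_mult summable_Suc_powr) auto
  show ?thesis
  proof (rule that)
    fix z n assume z: "Re z \<ge> 2"
    have "stirling_defect (z + of_nat n) - stirling_defect z = 
       (\<Sum>k<n. stirling_defect (z + of_nat (Suc k)) - stirling_defect (z + of_nat k))"
      by (subst sum_lessThan_telescope) simp
    also have "\<bar>\<dots>\<bar> \<le> (\<Sum>k<n. \<bar>stirling_defect (z + of_nat (Suc k)) - stirling_defect (z + of_nat k)\<bar>)"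
      by (rule sum_abs)
    also have "\<dots> \<le> (\<Sum>k<n. 2 * (real k + 1) powr (-2))"
    proof (intro sum_mono)
      fix k
      have "\<bar>stirling_defect (z + of_nat (Suc k)) - stirling_defect (z + of_nat k)\<bar> \<le> 2 / (cmod (z + of_nat k))\<^sup>2"
        using stirling_defect_step[of "z + of_nat k"] z by (simp add: add_ac)
      also have "\<dots> \<le> 2 / (real k + 1)\<^sup>2"
        using z complex_Re_le_cmod[of "z + of_nat k"] by (intro divide_left_mono power_mono) (auto intro!: mult_pos_pos)
      also have "\<dots> = 2 * (real k + 1) powr (-2)" by (simp add: powr_minus divide_inverse)
      finally show "\<bar>stirling_defect (z + of_nat (Suc k)) - stirling_defect (z + of_nat k)\<bar> \<le> 2 * (real k + 1) powr (-2)" .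
    qed
    also have "\<dots> \<le> (\<Sum>k. 2 * (real k + 1) powr (-2))" by (intro sum_le_suminf sm) auto
    finally show "\<bar>stirling_defect (z + of_nat n) - stirling_defect z\<bar> \<le> (\<Sum>k. 2 * (real k + 1) powr (-2))" .
  qed
qed

lemma ln_Gamma_shift_tendsto:
  assumes "Re z > 0"
  shows "(\<lambda>n. ln (cmod (Gamma (z + of_nat n))) - ln (fact n) - (Re z - 1) * ln (real n + 1)) \<longlonglongrightarrow> 0"
proof -
  have z: "z \<notin> \<int>\<^sub>\<le>\<^sub>0" using nonpos_Int_Re_le[of z] assms by auto
  have pz: "pochhammer z n \<noteq> 0" for n using z pochhammer_eq_0_imp_nonpos_Int by blast
  have G: "Gamma z \<noteq> 0" using z by (simp add: Gamma_eq_zero_iff)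
  have "(\<lambda>n. ln (cmod (pochhammer z n) / (fact n * (real n + 1) powr (Re z - 1)))) \<longlonglongrightarrow> ln (cmod (rGamma z))"
    using z by (intro tendsto_ln norm_pochhammer_tendsto) (auto simp: rGamma_eq_zero_iff)
  hence "(\<lambda>n. ln (cmod (Gamma z)) + ln (cmod (pochhammer z n) / (fact n * (real n + 1) powr (Re z - 1)))) 
      \<longlonglongrightarrow> ln (cmod (Gamma z)) + ln (cmod (rGamma z))"
    by (rule tendsto_add[OF tendsto_const])
  moreover have "ln (cmod (Gamma z)) + ln (cmod (rGamma z)) = 0"
    by (simp add: rGamma_inverse_Gamma norm_inverse ln_inverse)
  moreover have "ln (cmod (Gamma z)) + ln (cmod (pochhammer z n) / (fact n * (real n + 1) powr (Re z - 1))) =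
      ln (cmod (Gamma (z + of_nat n))) - ln (fact n) - (Re z - 1) * ln (real n + 1)" for n
  proof -
    have "Gamma (z + of_nat n) = pochhammer z n * Gamma z" using z by (simp add: pochhammer_Gamma Gamma_eq_zero_iff)
    thus ?thesis using pz[of n] G by (simp add: norm_mult ln_mult ln_div ln_powr)
  qed
  ultimately show ?thesis by simp
qed

lemma stirling_exponent_shift_tendsto:
  fixes x y :: real
  shows "(\<lambda>n. ((x + real n - 1/2) * ln (sqrt ((x + real n)\<^sup>2 + y\<^sup>2)) - y * arctan (y / (x + real n)) - (x + real n))
     - ((2 + real n - 1/2) * ln (2 + real n) - (2 + real n)) - (x - 2) * ln (real n + 1)) \<longlonglongrightarrow> 0"
proof (cases y "0 :: real" rule: linorder_cases)
  case equal
  thus ?thesis by simp real_asymp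
qed real_asymp+

text \<open>Shifts to the right change the defect by at most \<open>M\<close>, and by Euler's limit the defects at \<open>z + n\<close> and
  \<open>2 + n\<close> approach each other. Hence the defect at \<open>z\<close> is close to the one at \<open>2\<close>.\<close>

lemma stirling_defect_bounded:
  obtains M where "\<And>z. Re z \<ge> 2 \<Longrightarrow> \<bar>stirling_defect z\<bar> \<le> M"
proof -
  obtain M where M: "\<And>z n. Re z \<ge> 2 \<Longrightarrow> \<bar>stirling_defect (z + of_nat n) - stirling_defect z\<bar> \<le> M"
    using stirling_defect_shift by metis
  have M0: "M \<ge> 0" using M[of 2 0] by simp
  show ?thesis
  proof (rule that)
    fix z assume z: "Re z \<ge> 2"
    define x y where "x = Re z" and "y = Im z"
    \<comment> \<open>The difference of the shifted defects, sorted into three sequences that tend to 0.\<close>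
    have A: "stirling_defect (z + of_nat n) - stirling_defect (2 + of_nat n) =
       ((ln (cmod (Gamma (z + of_nat n))) - ln (fact n) - (Re z - 1) * ln (real n + 1)) -
       (ln (cmod (Gamma (2 + of_nat n))) - ln (fact n) - (Re 2 - 1) * ln (real n + 1))) -
       (((x + real n - 1/2) * ln (sqrt ((x + real n)\<^sup>2 + y\<^sup>2)) - y * arctan (y / (x + real n)) - (x + real n))
     - ((2 + real n - 1/2) * ln (2 + real n) - (2 + real n)) - (x - 2) * ln (real n + 1))" for n
    proof -
      have 1: "Re (stirling_exponent (z + of_nat n)) = (x + real n - 1/2) * ln (sqrt ((x + real n)\<^sup>2 + y\<^sup>2)) - y * arctan (y / (x + real n)) - (x + real n)"
        using z by (subst Re_stirling_exponent) (auto simp: x_def y_def cmod_def)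
      have "cmod (2 + of_nat n) = 2 + real n" using norm_of_nat[of "2 + n", where 'a = complex] by (simp del: norm_of_nat)
      hence 2: "Re (stirling_exponent (2 + of_nat n)) = (2 + real n - 1/2) * ln (2 + real n) - (2 + real n)"
        by (subst Re_stirling_exponent) auto
      show ?thesis unfolding stirling_defect_def 1 2 by (simp add: x_def algebra_simps)
    qed
    have "(\<lambda>n. stirling_defect (z + of_nat n) - stirling_defect (2 + of_nat n)) \<longlonglongrightarrow> (0 - 0) - 0"
      unfolding A using z
      by (intro tendsto_diff ln_Gamma_shift_tendsto stirling_exponent_shift_tendsto) auto
    hence lim: "(\<lambda>n. \<bar>stirling_defect (z + of_nat n) - stirling_defect (2 + of_nat n)\<bar> + 2 * M) \<longlonglongrightarrow> \<bar>0\<bar> + 2 * M"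
      by (intro tendsto_intros) simp
    have "\<bar>stirling_defect z - stirling_defect 2\<bar> \<le> \<bar>0\<bar> + 2 * M"
    proof (rule tendsto_lowerbound[OF lim])
      show "\<forall>\<^sub>F n in sequentially. \<bar>stirling_defect z - stirling_defect 2\<bar> \<le> 
          \<bar>stirling_defect (z + of_nat n) - stirling_defect (2 + of_nat n)\<bar> + 2 * M"
      proof (intro always_eventually allI)
        fix n
        show "\<bar>stirling_defect z - stirling_defect 2\<bar> \<le> 
          \<bar>stirling_defect (z + of_nat n) - stirling_defect (2 + of_nat n)\<bar> + 2 * M"
          using M[OF z, of n] M[of 2 n] by simp
      qed
    qed auto
    thus "\<bar>stirling_defect z\<bar> \<le> \<bar>stirling_defect 2\<bar> + 2 * M" by simp
  qed
qed

text \<open>The shape of \<open>\<bar>\<Gamma>(x + \<i>y)\<bar>\<close> as a function of \<open>y\<close>, with \<open>p = x - 1/2\<close> and \<open>q = \<pi>/2\<close>; the base \<open>1 + \<bar>y\<bar>\<close>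
  lets the estimates hold for all \<open>y\<close>, small ones included.\<close>

definition vertical_bound :: "real \<Rightarrow> real \<Rightarrow> real \<Rightarrow> real" where
  "vertical_bound p q y = (1 + \<bar>y\<bar>) powr p * exp (- q * \<bar>y\<bar>)"

lemma vertical_bound_pos: "vertical_bound p q y > 0"
  by (simp add: vertical_bound_def add_pos_nonneg)

lemma vertical_bound_mult: "vertical_bound p q y * vertical_bound p' q' y = vertical_bound (p + p') (q + q') y"
  by (simp add: vertical_bound_def powr_add exp_add[symmetric] algebra_simps)

lemma vertical_bound_inverse: "inverse (vertical_bound p q y) = vertical_bound (- p) (- q) y"
  by (simp add: vertical_bound_def powr_minus exp_minus)

lemma vertical_bound_powr: "vertical_bound p q y powr k = vertical_bound (p * k) (q * k) y"
  by (simp add: vertical_bound_def powr_mult powr_powr exp_powr_real add_pos_nonneg)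

text \<open>The phase contributes \<open>y arctan (y / x)\<close>, which lies between \<open>\<pi>\<bar>y\<bar>/2 - x\<close> and \<open>\<pi>\<bar>y\<bar>/2\<close>.\<close>

lemma exp_Re_stirling_exponent_bounds:
  fixes x :: real
  assumes x: "x \<ge> 2"
  obtains c C where "c > 0" "C > 0"
    "\<And>y. exp (Re (stirling_exponent (Complex x y))) \<le> C * vertical_bound (x - 1/2) (pi / 2) y"
    "\<And>y. c * vertical_bound (x - 1/2) (pi / 2) y \<le> exp (Re (stirling_exponent (Complex x y)))"
proof -
  have ex: "exp (Re (stirling_exponent (Complex x y))) = 
      cmod (Complex x y) powr (x - 1/2) * exp (- y * arctan (y / x)) * exp (- x)" for y
  proof -
    have "Complex x y \<noteq> 0" using x by (auto simp: complex_eq_iff)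
    thus ?thesis using x
      by (subst Re_stirling_exponent) (auto simp: powr_def exp_add[symmetric] exp_diff exp_minus field_simps)
  qed
  have yy: "y * arctan (y / x) = \<bar>y\<bar> * arctan (\<bar>y\<bar> / x)" for y
    by (cases "y \<ge> 0") (auto simp: arctan_minus)
  have up: "\<bar>y\<bar> * arctan (\<bar>y\<bar> / x) \<le> pi / 2 * \<bar>y\<bar>" for y
    using mult_left_mono[OF less_imp_le[OF arctan_ubound[of "\<bar>y\<bar> / x"]], of "\<bar>y\<bar>"] by (simp add: mult_ac)
  have lo: "pi / 2 * \<bar>y\<bar> - x \<le> \<bar>y\<bar> * arctan (\<bar>y\<bar> / x)" for y
  proof (cases "y = 0")
    case False
    have "arctan (x / \<bar>y\<bar>) = pi / 2 - arctan (\<bar>y\<bar> / x)"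
      using arctan_inverse[of "\<bar>y\<bar> / x"] x False by (simp add: sgn_if divide_simps split: if_splits)
    moreover have "arctan (x / \<bar>y\<bar>) \<le> x / \<bar>y\<bar>" using x by (intro arctan_le_self) auto
    ultimately have "pi / 2 - x / \<bar>y\<bar> \<le> arctan (\<bar>y\<bar> / x)" by linarith
    hence "\<bar>y\<bar> * (pi / 2 - x / \<bar>y\<bar>) \<le> \<bar>y\<bar> * arctan (\<bar>y\<bar> / x)" by (intro mult_left_mono) auto
    thus ?thesis using False by (simp add: right_diff_distrib mult_ac)
  qed (use x in auto)
  have n1: "cmod (Complex x y) \<le> x * (1 + \<bar>y\<bar>)" for y
  proof -
    have "cmod (Complex x y) \<le> \<bar>x\<bar> + \<bar>y\<bar>" using cmod_le[of "Complex x y"] by simp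
    also have "\<dots> \<le> x * (1 + \<bar>y\<bar>)" using x mult_right_mono[of 1 x "\<bar>y\<bar>"] by (simp add: algebra_simps)
    finally show ?thesis .
  qed
  have n2: "(1 + \<bar>y\<bar>) / 2 \<le> cmod (Complex x y)" for y
    using x abs_Re_le_cmod[of "Complex x y"] abs_Im_le_cmod[of "Complex x y"] by simp
  show ?thesis
  proof (rule that[of "(1/2) powr (x - 1/2) * exp (- x)" "x powr (x - 1/2)"])
    fix y
    have "cmod (Complex x y) powr (x - 1/2) * exp (- y * arctan (y / x)) * exp (- x) \<le>
        (x * (1 + \<bar>y\<bar>)) powr (x - 1/2) * exp (- (pi / 2 * \<bar>y\<bar> - x)) * exp (- x)"
      using x lo[of y] yy[of y] by (intro mult_mono powr_mono2 n1) auto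
    also have "\<dots> = x powr (x - 1/2) * (1 + \<bar>y\<bar>) powr (x - 1/2) * (exp (- (pi / 2 * \<bar>y\<bar> - x)) * exp (- x))"
      using x by (simp add: powr_mult)
    also have "exp (- (pi / 2 * \<bar>y\<bar> - x)) * exp (- x) = exp (- (pi / 2) * \<bar>y\<bar>)"
      by (simp add: exp_add[symmetric])
    finally show "exp (Re (stirling_exponent (Complex x y))) \<le> x powr (x - 1/2) * vertical_bound (x - 1/2) (pi / 2) y"
      unfolding ex vertical_bound_def by (simp add: mult.assoc)
    have "(1/2) powr (x - 1/2) * (1 + \<bar>y\<bar>) powr (x - 1/2) * exp (- (pi / 2) * \<bar>y\<bar>) * exp (- x) =
       ((1 + \<bar>y\<bar>) / 2) powr (x - 1/2) * exp (- (pi / 2) * \<bar>y\<bar>) * exp (- x)"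
      by (simp add: powr_divide)
    also have "\<dots> \<le> cmod (Complex x y) powr (x - 1/2) * exp (- y * arctan (y / x)) * exp (- x)"
      using x up[of y] yy[of y] by (intro mult_mono powr_mono2 n2) auto
    finally show "(1/2) powr (x - 1/2) * exp (- x) * vertical_bound (x - 1/2) (pi / 2) y \<le> exp (Re (stirling_exponent (Complex x y)))"
      unfolding ex vertical_bound_def by (simp add: mult_ac)
  qed (use x in auto)
qed

lemma Gamma_vertical_bounds_ge_2:
  fixes x :: real
  assumes x: "x \<ge> 2"
  shows "\<exists>C>0. \<forall>y. cmod (Gamma (Complex x y)) \<le> C * vertical_bound (x - 1/2) (pi / 2) y"
    and "\<exists>C>0. \<forall>y. cmod (rGamma (Complex x y)) \<le> C * vertical_bound (1/2 - x) (- pi / 2) y"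
proof -
  obtain M where M: "\<And>z. Re z \<ge> 2 \<Longrightarrow> \<bar>stirling_defect z\<bar> \<le> M" using stirling_defect_bounded by metis
  obtain c C where cC: "c > 0" "C > 0"
    "\<And>y. exp (Re (stirling_exponent (Complex x y))) \<le> C * vertical_bound (x - 1/2) (pi / 2) y"
    "\<And>y. c * vertical_bound (x - 1/2) (pi / 2) y \<le> exp (Re (stirling_exponent (Complex x y)))"
    using exp_Re_stirling_exponent_bounds[OF x] by metis
  have G: "cmod (Gamma (Complex x y)) = exp (stirling_defect (Complex x y)) * exp (Re (stirling_exponent (Complex x y)))" for y
    using Gamma_nonzero_Re_pos[of "Complex x y"] x by (simp add: stirling_defect_def exp_add[symmetric])
  have D: "exp (stirling_defect (Complex x y)) \<le> exp M" "exp (- M) \<le> exp (stirling_defect (Complex x y))" for y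
    using M[of "Complex x y"] x by auto
  show "\<exists>C>0. \<forall>y. cmod (Gamma (Complex x y)) \<le> C * vertical_bound (x - 1/2) (pi / 2) y"
  proof (intro exI[of _ "exp M * C"] conjI allI)
    fix y
    show "cmod (Gamma (Complex x y)) \<le> exp M * C * vertical_bound (x - 1/2) (pi / 2) y"
      unfolding G mult.assoc by (intro mult_mono D cC) auto
  qed (use cC in auto)
  show "\<exists>C>0. \<forall>y. cmod (rGamma (Complex x y)) \<le> C * vertical_bound (1/2 - x) (- pi / 2) y"
  proof (intro exI[of _ "inverse (exp (- M) * c)"] conjI allI)
    fix y
    have ge: "exp (- M) * c * vertical_bound (x - 1/2) (pi / 2) y \<le> cmod (Gamma (Complex x y))"
      unfolding G mult.assoc using cC vertical_bound_pos[of "x - 1/2" "pi / 2" y]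
      by (intro mult_mono D cC) (auto simp: less_imp_le)
    have "cmod (rGamma (Complex x y)) = inverse (cmod (Gamma (Complex x y)))"
      by (simp add: rGamma_inverse_Gamma norm_inverse)
    also have "\<dots> \<le> inverse (exp (- M) * c * vertical_bound (x - 1/2) (pi / 2) y)"
      using cC vertical_bound_pos[of "x - 1/2" "pi / 2" y] by (intro le_imp_inverse_le ge) auto
    also have "\<dots> = inverse (exp (- M) * c) * vertical_bound (1/2 - x) (- pi / 2) y"
      unfolding inverse_mult_distrib vertical_bound_inverse by simp
    finally show "cmod (rGamma (Complex x y)) \<le> inverse (exp (- M) * c) * vertical_bound (1/2 - x) (- pi / 2) y" .
  qed (use cC in auto)
qed

text \<open>Descent by the functional equation; the linear factor contributes one power of \<open>1 + \<bar>y\<bar>\<close>.\<close>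

lemma rGamma_vertical_bound:
  fixes x :: real
  shows "\<exists>C>0. \<forall>y. cmod (rGamma (Complex x y)) \<le> C * vertical_bound (1/2 - x) (- pi / 2) y"
proof -
  obtain m :: nat where "2 - x \<le> real m" using real_arch_simple by blast
  hence "x + m \<ge> 2" by simp
  thus ?thesis
  proof (induction m arbitrary: x)
    case 0
    thus ?case using Gamma_vertical_bounds_ge_2(2)[of x] by simp
  next
    case (Suc m)
    obtain C where C: "C > 0" "\<And>y. cmod (rGamma (Complex (x + 1) y)) \<le> C * vertical_bound (1/2 - (x + 1)) (- pi / 2) y"
      using Suc.IH[of "x + 1"] Suc.prems by auto
    show ?case
    proof (intro exI[of _ "(\<bar>x\<bar> + 1) * C"] conjI allI)
      fix y
      have "Complex (x + 1) y = Complex x y + 1" by (simp add: complex_eq_iff)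
      hence "rGamma (Complex x y) = Complex x y * rGamma (Complex (x + 1) y)" by (simp add: rGamma_plus1)
      hence "cmod (rGamma (Complex x y)) = cmod (Complex x y) * cmod (rGamma (Complex (x + 1) y))" by (simp add: norm_mult)
      also have "\<dots> \<le> ((\<bar>x\<bar> + 1) * (1 + \<bar>y\<bar>)) * (C * vertical_bound (1/2 - (x + 1)) (- pi / 2) y)"
      proof (intro mult_mono C)
        have "cmod (Complex x y) \<le> \<bar>x\<bar> + \<bar>y\<bar>" using cmod_le[of "Complex x y"] by simp
        also have "\<dots> \<le> (\<bar>x\<bar> + 1) * (1 + \<bar>y\<bar>)" by (simp add: algebra_simps)
        finally show "cmod (Complex x y) \<le> (\<bar>x\<bar> + 1) * (1 + \<bar>y\<bar>)" .
      qed auto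
      also have "\<dots> = (\<bar>x\<bar> + 1) * C * (vertical_bound 1 0 y * vertical_bound (1/2 - (x + 1)) (- pi / 2) y)"
        by (simp add: vertical_bound_def mult_ac)
      also have "vertical_bound 1 0 y * vertical_bound (1/2 - (x + 1)) (- pi / 2) y = vertical_bound (1/2 - x) (- pi / 2) y"
        unfolding vertical_bound_mult by simp
      finally show "cmod (rGamma (Complex x y)) \<le> (\<bar>x\<bar> + 1) * C * vertical_bound (1/2 - x) (- pi / 2) y" .
    qed (use C in \<open>auto intro!: mult_pos_pos\<close>)
  qed
qed

text \<open>Here the descent divides by the linear factor, which is bounded away from \<open>0\<close> on the whole line
  exactly when the line avoids the pole.\<close>

lemma Gamma_vertical_bound:
  fixes x :: real
  assumes "x \<notin> \<int>\<^sub>\<le>\<^sub>0"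
  shows "\<exists>C>0. \<forall>y. cmod (Gamma (Complex x y)) \<le> C * vertical_bound (x - 1/2) (pi / 2) y"
proof -
  obtain m :: nat where "2 - x \<le> real m" using real_arch_simple by blast
  hence "x + m \<ge> 2" by simp
  thus ?thesis using assms
  proof (induction m arbitrary: x)
    case 0
    thus ?case using Gamma_vertical_bounds_ge_2(1)[of x] by simp
  next
    case (Suc m)
    have x0: "x \<noteq> 0" using Suc.prems by auto
    have x1: "x + 1 \<notin> \<int>\<^sub>\<le>\<^sub>0" using Suc.prems(2) plus_one_in_nonpos_Ints_imp by blast
    obtain C where C: "C > 0" "\<And>y. cmod (Gamma (Complex (x + 1) y)) \<le> C * vertical_bound ((x + 1) - 1/2) (pi / 2) y"
      using Suc.IH[of "x + 1"] Suc.prems x1 by auto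
    define k where "k = 1 / \<bar>x\<bar> + 1"
    have k: "k > 0" by (simp add: k_def add_nonneg_pos)
    show ?case
    proof (intro exI[of _ "k * C"] conjI allI)
      fix y
      have z0: "Complex x y \<noteq> 0" using x0 by (auto simp: complex_eq_iff)
      have ge: "1 + \<bar>y\<bar> \<le> k * cmod (Complex x y)"
      proof -
        have "1 \<le> 1 / \<bar>x\<bar> * cmod (Complex x y)" using abs_Re_le_cmod[of "Complex x y"] x0 by (simp add: divide_simps)
        moreover have "\<bar>y\<bar> \<le> cmod (Complex x y)" using abs_Im_le_cmod[of "Complex x y"] by simp
        ultimately show ?thesis by (simp add: k_def algebra_simps)
      qed
      have "Complex (x + 1) y = Complex x y + 1" by (simp add: complex_eq_iff)
      moreover have "Complex x y \<notin> \<int>\<^sub>\<le>\<^sub>0"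
      proof
        assume "Complex x y \<in> \<int>\<^sub>\<le>\<^sub>0"
        then obtain n where "Complex x y = - of_nat n" by (elim nonpos_Ints_cases')
        hence "x = - of_nat n" by (simp add: complex_eq_iff)
        thus False using Suc.prems by auto
      qed
      ultimately have "Gamma (Complex (x + 1) y) = Complex x y * Gamma (Complex x y)" by (simp add: Gamma_plus1)
      hence "cmod (Gamma (Complex x y)) = cmod (Gamma (Complex (x + 1) y)) / cmod (Complex x y)"
        using z0 by (simp add: norm_mult)
      also have "\<dots> \<le> (C * vertical_bound ((x + 1) - 1/2) (pi / 2) y) / ((1 + \<bar>y\<bar>) / k)"
        using C(1) k ge z0 vertical_bound_pos[of "(x + 1) - 1/2" "pi / 2" y]
        by (intro frac_le C) (auto simp: field_simps less_imp_le add_pos_nonneg)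
      also have "\<dots> = k * C * (vertical_bound (- 1) 0 y * vertical_bound ((x + 1) - 1/2) (pi / 2) y)"
        using k by (simp add: vertical_bound_def powr_minus field_simps)
      also have "vertical_bound (- 1) 0 y * vertical_bound ((x + 1) - 1/2) (pi / 2) y = vertical_bound (x - 1/2) (pi / 2) y"
        unfolding vertical_bound_mult by simp
      finally show "cmod (Gamma (Complex x y)) \<le> k * C * vertical_bound (x - 1/2) (pi / 2) y" .
    qed (use C k in \<open>auto intro!: mult_pos_pos\<close>)
  qed
qed

lemma vertical_bound_affine:
  assumes False: "D \<noteq> 0"
  obtains C where "C > 0" "\<And>t. vertical_bound p q (b + D * t) \<le> C * vertical_bound p (q * \<bar>D\<bar>) t"
proof -
  \<comment> \<open>\<open>1 + \<bar>b + D * t\<bar>\<close> and \<open>1 + \<bar>t\<bar>\<close> are comparable with constant \<open>K\<close> in both directions;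
    the sign of \<open>p\<close> decides which direction counts.\<close>
  define K where "K = 1 + \<bar>b\<bar> + \<bar>D\<bar> + (1 + \<bar>b\<bar>) / \<bar>D\<bar>"
  have K: "K \<ge> 1" by (simp add: K_def)
  have 1: "1 + \<bar>b + D * t\<bar> \<le> K * (1 + \<bar>t\<bar>)" for t
  proof -
    have "1 + \<bar>b + D * t\<bar> \<le> 1 + \<bar>b\<bar> + \<bar>D\<bar> * \<bar>t\<bar>" by (simp add: abs_mult[symmetric])
    also have "\<dots> \<le> (1 + \<bar>b\<bar> + \<bar>D\<bar>) * (1 + \<bar>t\<bar>)" by (simp add: algebra_simps)
    also have "\<dots> \<le> K * (1 + \<bar>t\<bar>)" by (intro mult_right_mono) (auto simp: K_def)
    finally show ?thesis .
  qed
  have 2: "1 + \<bar>t\<bar> \<le> K * (1 + \<bar>b + D * t\<bar>)" for t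
  proof -
    have "\<bar>D\<bar> * \<bar>t\<bar> \<le> \<bar>b + D * t\<bar> + \<bar>b\<bar>" by (simp add: abs_mult[symmetric])
    hence "\<bar>t\<bar> \<le> (\<bar>b + D * t\<bar> + \<bar>b\<bar>) / \<bar>D\<bar>" using False by (simp add: field_simps)
    also have "\<dots> \<le> (1 + \<bar>b\<bar>) * (1 + \<bar>b + D * t\<bar>) / \<bar>D\<bar>" by (intro divide_right_mono) (auto simp: algebra_simps)
    finally have "1 + \<bar>t\<bar> \<le> 1 + (1 + \<bar>b\<bar>) / \<bar>D\<bar> * (1 + \<bar>b + D * t\<bar>)" by simp
    also have "\<dots> \<le> (1 + (1 + \<bar>b\<bar>) / \<bar>D\<bar>) * (1 + \<bar>b + D * t\<bar>)"
      by (simp only: distrib_right) simp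
    also have "\<dots> \<le> K * (1 + \<bar>b + D * t\<bar>)"
      by (intro mult_right_mono) (auto simp: K_def)
    finally show ?thesis .
  qed
  have pw: "(1 + \<bar>b + D * t\<bar>) powr p \<le> K powr \<bar>p\<bar> * (1 + \<bar>t\<bar>) powr p" for t
  proof (cases "p \<ge> 0")
    case True
    have "(1 + \<bar>b + D * t\<bar>) powr p \<le> (K * (1 + \<bar>t\<bar>)) powr p" using True by (intro powr_mono2 1) auto
    thus ?thesis using True K by (simp add: powr_mult)
  next
    case neg: False
    have "(K * (1 + \<bar>b + D * t\<bar>)) powr p \<le> (1 + \<bar>t\<bar>) powr p" using neg by (intro powr_mono2' 2) auto
    hence "K powr p * (1 + \<bar>b + D * t\<bar>) powr p \<le> (1 + \<bar>t\<bar>) powr p" using K by (simp add: powr_mult)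
    hence "K powr \<bar>p\<bar> * (K powr p * (1 + \<bar>b + D * t\<bar>) powr p) \<le> K powr \<bar>p\<bar> * (1 + \<bar>t\<bar>) powr p" by (intro mult_left_mono) auto
    moreover have "K powr \<bar>p\<bar> * K powr p = 1" using neg K by (simp add: powr_add[symmetric])
    ultimately show ?thesis by (simp add: mult.assoc[symmetric])
  qed
  have ex: "exp (- q * \<bar>b + D * t\<bar>) \<le> exp (\<bar>q\<bar> * \<bar>b\<bar>) * exp (- (q * \<bar>D\<bar>) * \<bar>t\<bar>)" for t
  proof -
    have "\<bar>\<bar>b + D * t\<bar> - \<bar>D * t\<bar>\<bar> \<le> \<bar>b\<bar>" by linarith
    hence "\<bar>q * (\<bar>b + D * t\<bar> - \<bar>D * t\<bar>)\<bar> \<le> \<bar>q\<bar> * \<bar>b\<bar>" unfolding abs_mult[of q] by (intro mult_left_mono) auto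
    hence "- q * \<bar>b + D * t\<bar> \<le> \<bar>q\<bar> * \<bar>b\<bar> - q * \<bar>D * t\<bar>" by (simp add: right_diff_distrib)
    thus ?thesis by (simp add: exp_add[symmetric] abs_mult mult.assoc)
  qed
  show ?thesis
  proof (rule that[of "K powr \<bar>p\<bar> * exp (\<bar>q\<bar> * \<bar>b\<bar>)"])
    fix t
    show "vertical_bound p q (b + D * t) \<le> K powr \<bar>p\<bar> * exp (\<bar>q\<bar> * \<bar>b\<bar>) * vertical_bound p (q * \<bar>D\<bar>) t"
      using mult_mono[OF pw[of t] ex[of t]] by (simp add: vertical_bound_def mult_ac)
  qed (use K in auto)
qed

lemma rGamma_on_line:
  fixes c :: complex and D :: real
  assumes "D \<noteq> 0"
  shows "\<exists>C>0. \<forall>t. cmod (rGamma (c + of_real D * (\<i> * of_real t))) \<le> C * vertical_bound (1/2 - Re c) (- pi / 2 * \<bar>D\<bar>) t"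
proof -
  obtain C where C: "C > 0" "\<And>y. cmod (rGamma (Complex (Re c) y)) \<le> C * vertical_bound (1/2 - Re c) (- pi / 2) y"
    using rGamma_vertical_bound by blast
  obtain K where K: "K > 0" "\<And>t. vertical_bound (1/2 - Re c) (- pi / 2) (Im c + D * t) \<le> K * vertical_bound (1/2 - Re c) (- pi / 2 * \<bar>D\<bar>) t"
    using vertical_bound_affine assms by metis
  show ?thesis
  proof (intro exI[of _ "C * K"] conjI allI)
    fix t
    have "c + of_real D * (\<i> * of_real t) = Complex (Re c) (Im c + D * t)" by (simp add: complex_eq_iff)
    hence "cmod (rGamma (c + of_real D * (\<i> * of_real t))) \<le> C * vertical_bound (1/2 - Re c) (- pi / 2) (Im c + D * t)"
      using C(2) by simp
    also have "\<dots> \<le> C * (K * vertical_bound (1/2 - Re c) (- pi / 2 * \<bar>D\<bar>) t)"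
      using C(1) by (intro mult_left_mono K) auto
    finally show "cmod (rGamma (c + of_real D * (\<i> * of_real t))) \<le> C * K * vertical_bound (1/2 - Re c) (- pi / 2 * \<bar>D\<bar>) t"
      by (simp add: mult_ac)
  qed (use C K in auto)
qed

lemma Gamma_on_line:
  fixes c :: complex and D :: real
  assumes "D \<noteq> 0" "Re c \<notin> \<int>\<^sub>\<le>\<^sub>0"
  shows "\<exists>C>0. \<forall>t. cmod (Gamma (c + of_real D * (\<i> * of_real t))) \<le> C * vertical_bound (Re c - 1/2) (pi / 2 * \<bar>D\<bar>) t"
proof -
  obtain C where C: "C > 0" "\<And>y. cmod (Gamma (Complex (Re c) y)) \<le> C * vertical_bound (Re c - 1/2) (pi / 2) y"
    using Gamma_vertical_bound[OF assms(2)] by blast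
  obtain K where K: "K > 0" "\<And>t. vertical_bound (Re c - 1/2) (pi / 2) (Im c + D * t) \<le> K * vertical_bound (Re c - 1/2) (pi / 2 * \<bar>D\<bar>) t"
    using vertical_bound_affine assms(1) by metis
  show ?thesis
  proof (intro exI[of _ "C * K"] conjI allI)
    fix t
    have "c + of_real D * (\<i> * of_real t) = Complex (Re c) (Im c + D * t)" by (simp add: complex_eq_iff)
    hence "cmod (Gamma (c + of_real D * (\<i> * of_real t))) \<le> C * vertical_bound (Re c - 1/2) (pi / 2) (Im c + D * t)"
      using C(2) by simp
    also have "\<dots> \<le> C * (K * vertical_bound (Re c - 1/2) (pi / 2 * \<bar>D\<bar>) t)"
      using C(1) by (intro mult_left_mono K) auto
    finally show "cmod (Gamma (c + of_real D * (\<i> * of_real t))) \<le> C * K * vertical_bound (Re c - 1/2) (pi / 2 * \<bar>D\<bar>) t"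
      by (simp add: mult_ac)
  qed (use C K in auto)
qed

section \<open>The integrand of the I-function\<close>

lemma vertical_bound_borel [measurable]: "vertical_bound p q \<in> borel_measurable borel"
  unfolding vertical_bound_def[abs_def] by measurable

lemma vertical_bound_mono:
  assumes "p \<le> p'"
  shows "vertical_bound p q y \<le> vertical_bound p' q y"
  unfolding vertical_bound_def using assms by (intro mult_right_mono powr_mono) auto

lemma integrable_one_plus_abs_powr:
  fixes p :: real
  assumes p: "p < -1"
  shows "integrable lborel (\<lambda>t. (1 + \<bar>t\<bar>) powr p)"
proof -
  \<comment> \<open>An even function: twice its half on \<open>[0, \<infinity>)\<close>.\<close>
  define g where "g = (\<lambda>t::real. (1 + t) powr p * indicator {0..} t)"
  have "(\<integral>\<^sup>+x. ennreal ((1 + x) powr p) * indicator {0..} x \<partial>lborel) = 0 - (1 + 0) powr (p + 1) / (p + 1)"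
  proof (rule nn_integral_FTC_atLeast)
    fix x :: real assume x: "0 \<le> x"
    show "((\<lambda>x. (1 + x) powr (p + 1) / (p + 1)) has_real_derivative (1 + x) powr p) (at x)"
      using x p by (auto intro!: derivative_eq_intros)
    show "0 \<le> (1 + x) powr p" by simp
  next
    have "((\<lambda>x. (1 + x) powr (p + 1)) \<longlongrightarrow> 0) at_top" using p by real_asymp
    from tendsto_divide[OF this tendsto_const, of "p + 1"] p
    show "((\<lambda>x. (1 + x) powr (p + 1) / (p + 1)) \<longlongrightarrow> 0) at_top" by simp
  qed auto
  hence nn: "(\<integral>\<^sup>+x. ennreal (g x) \<partial>lborel) < \<infinity>"
    by (simp add: g_def ennreal_mult'' ennreal_indicator)
  have g: "integrable lborel g"
    by (rule integrableI_nonneg) (use nn in \<open>auto simp: g_def\<close>)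
  have "integrable lborel (\<lambda>t. g (0 + (-1) * t))"
    using g by (subst lborel_integrable_real_affine_iff) auto
  hence "integrable lborel (\<lambda>t. g t + g (- t))" using g by simp
  thus ?thesis
    by (rule Bochner_Integration.integrable_bound) (auto simp: g_def indicator_def)
qed

text \<open>From \<open>ln z \<le> z - 1\<close> at \<open>z = (1 + u) * q / s\<close>.\<close>

lemma one_plus_powr_exp_bound:
  fixes s q u :: real
  assumes "s > 0" "q > 0" "u \<ge> 0"
  shows "(1 + u) powr s * exp (- q * u) \<le> exp (q - s - s * ln (q / s))"
proof -
  define d where "d = q / s"
  have d: "d > 0" "s * d = q" using assms by (auto simp: d_def)
  have "ln ((1 + u) * d) \<le> (1 + u) * d - 1" using assms d by (intro ln_le_minus_one mult_pos_pos) auto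
  hence "ln (1 + u) \<le> (1 + u) * d - 1 - ln d" using assms d by (simp add: ln_mult)
  hence "s * ln (1 + u) \<le> s * ((1 + u) * d - 1 - ln d)" using assms by (intro mult_left_mono) auto
  also have "\<dots> = (1 + u) * (s * d) - s - s * ln d" by (simp add: algebra_simps)
  finally have "s * ln (1 + u) - q * u \<le> q - s - s * ln d" unfolding d by (simp add: algebra_simps)
  hence "exp (s * ln (1 + u) - q * u) \<le> exp (q - s - s * ln d)" by simp
  thus ?thesis using assms by (simp add: powr_def d_def exp_add[symmetric])
qed

lemma integrable_vertical_bound:
  assumes "q > 0 \<or> q = 0 \<and> p < -1"
  shows "integrable lborel (vertical_bound p q)"
proof (cases "q > 0")
  case False
  hence "q = 0" "p < -1" using assms by auto
  thus ?thesis using integrable_one_plus_abs_powr[of p] by (simp add: vertical_bound_def[abs_def])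
next
  case True
  \<comment> \<open>The exponential pays for \<open>s\<close> powers, so that \<open>(1 + \<bar>t\<bar>)\<^bsup>-2\<^esup>\<close> remains.\<close>
  define s where "s = \<bar>p\<bar> + 2"
  define K where "K = exp (q - s - s * ln (q / s))"
  have le: "vertical_bound p q t \<le> K * (1 + \<bar>t\<bar>) powr (-2)" for t
  proof -
    have "(1 + \<bar>t\<bar>) powr p \<le> (1 + \<bar>t\<bar>) powr (s + (-2))" by (intro powr_mono) (auto simp: s_def)
    also have "\<dots> = (1 + \<bar>t\<bar>) powr s * (1 + \<bar>t\<bar>) powr (-2)" by (rule powr_add)
    finally have "vertical_bound p q t \<le> ((1 + \<bar>t\<bar>) powr s * (1 + \<bar>t\<bar>) powr (-2)) * exp (- q * \<bar>t\<bar>)"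
      unfolding vertical_bound_def by (intro mult_right_mono) auto
    also have "\<dots> = ((1 + \<bar>t\<bar>) powr s * exp (- q * \<bar>t\<bar>)) * (1 + \<bar>t\<bar>) powr (-2)" by (simp only: mult_ac)
    also have "\<dots> \<le> K * (1 + \<bar>t\<bar>) powr (-2)"
      unfolding K_def using True by (intro mult_right_mono one_plus_powr_exp_bound) (auto simp: s_def)
    finally show ?thesis .
  qed
  have "integrable lborel (\<lambda>t. K * (1 + \<bar>t\<bar>) powr (-2))"
    by (intro integrable_mult_right integrable_one_plus_abs_powr) auto
  thus ?thesis
  proof (rule Bochner_Integration.integrable_bound)
    show "AE t in lborel. norm (vertical_bound p q t) \<le> norm (K * (1 + \<bar>t\<bar>) powr (-2))"
    proof (rule AE_I2)
      fix t show "norm (vertical_bound p q t) \<le> norm (K * (1 + \<bar>t\<bar>) powr (-2))"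
        using le[of t] vertical_bound_pos[of p q t] abs_ge_self[of "K * (1 + \<bar>t\<bar>) powr (-2)"] by simp
    qed
  qed simp
qed

definition vertical_growth :: "(real \<Rightarrow> complex) \<Rightarrow> real \<Rightarrow> real \<Rightarrow> bool" where
  "vertical_growth g p q \<longleftrightarrow> g \<in> borel_measurable borel \<and> (\<exists>C>0. \<forall>t. cmod (g t) \<le> C * vertical_bound p q t)"

lemma vertical_growth_mult:
  assumes "vertical_growth g p q" "vertical_growth h p' q'"
  shows "vertical_growth (\<lambda>t. g t * h t) (p + p') (q + q')"
proof -
  obtain C where C: "C > 0" "\<And>t. cmod (g t) \<le> C * vertical_bound p q t" using assms(1) by (auto simp: vertical_growth_def)
  obtain D where D: "D > 0" "\<And>t. cmod (h t) \<le> D * vertical_bound p' q' t" using assms(2) by (auto simp: vertical_growth_def)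
  have "cmod (g t * h t) \<le> C * D * vertical_bound (p + p') (q + q') t" for t
  proof -
    have "cmod (g t * h t) \<le> (C * vertical_bound p q t) * (D * vertical_bound p' q' t)"
      unfolding norm_mult using C(1) vertical_bound_pos[of p q t] by (intro mult_mono C D) (auto simp: less_imp_le)
    also have "\<dots> = C * D * (vertical_bound p q t * vertical_bound p' q' t)" by (simp only: mult_ac)
    finally show ?thesis by (simp only: vertical_bound_mult)
  qed
  moreover have "C * D > 0" using C D by simp
  moreover have "g \<in> borel_measurable borel" "h \<in> borel_measurable borel" using assms by (auto simp: vertical_growth_def)
  ultimately show ?thesis unfolding vertical_growth_def by (blast intro: borel_measurable_times)
qed

lemma vertical_growth_const: "vertical_growth (\<lambda>_. c) 0 0"
  unfolding vertical_growth_def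
  by (intro conjI exI[of _ "cmod c + 1"] allI) (auto simp: vertical_bound_def add_nonneg_pos)

lemma vertical_growth_mono:
  assumes "vertical_growth g p q" "p \<le> p'"
  shows "vertical_growth g p' q"
proof -
  obtain C where C: "C > 0" "\<And>t. cmod (g t) \<le> C * vertical_bound p q t" using assms(1) by (auto simp: vertical_growth_def)
  have "cmod (g t) \<le> C * vertical_bound p' q t" for t
    using C vertical_bound_mono[OF assms(2), of q t] by (meson less_imp_le mult_left_mono order_trans)
  thus ?thesis using assms(1) C(1) by (auto simp: vertical_growth_def)
qed

lemma vertical_growth_integrable:
  assumes "vertical_growth g p q" "q > 0 \<or> q = 0 \<and> p < -1"
  shows "integrable lborel g"
proof -
  obtain C where C: "C > 0" "\<And>t. cmod (g t) \<le> C * vertical_bound p q t" using assms(1) by (auto simp: vertical_growth_def)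
  have "integrable lborel (\<lambda>t. C * vertical_bound p q t)"
    by (intro integrable_mult_right integrable_vertical_bound assms)
  thus ?thesis
  proof (rule Bochner_Integration.integrable_bound)
    show "AE t in lborel. cmod (g t) \<le> norm (C * vertical_bound p q t)"
      using C(2) by (intro AE_I2) (metis abs_ge_self order_trans real_norm_def)
    show "g \<in> borel_measurable lborel" using assms(1) by (simp add: vertical_growth_def)
  qed
qed

lemma vertical_growth_prod_list:
  assumes "\<And>x. x \<in> set xs \<Longrightarrow> vertical_growth (g x) (p x) (q x)"
  shows "vertical_growth (\<lambda>t. \<Prod>x\<leftarrow>xs. g x t) (\<Sum>x\<leftarrow>xs. p x) (\<Sum>x\<leftarrow>xs. q x)"
  using assms by (induction xs) (auto intro: vertical_growth_mult vertical_growth_const)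

lemma vertical_growth_linear:
  fixes c d :: complex
  shows "vertical_growth (\<lambda>t. c + d * of_real t) 1 0"
  unfolding vertical_growth_def
proof (intro conjI exI[of _ "cmod c + cmod d + 1"] allI)
  fix t
  have "cmod (c + d * of_real t) \<le> cmod c + cmod d * \<bar>t\<bar>"
    using norm_triangle_ineq[of c "d * of_real t"] by (simp add: norm_mult)
  also have "\<dots> \<le> (cmod c + cmod d + 1) * (1 + \<bar>t\<bar>)" by (simp add: algebra_simps)
  finally show "cmod (c + d * of_real t) \<le> (cmod c + cmod d + 1) * vertical_bound 1 0 t"
    by (simp add: vertical_bound_def)
qed (auto simp: add_nonneg_pos)

lemma Gamma_pow_eq_Gamma:
  assumes "Gamma_branch \<Lambda>" "Re s = 0"
  shows "Gamma_pow \<Lambda> c D 1 s = Gamma (c + of_real D * s)"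
  using assms by (auto simp: Gamma_pow_def Gamma_branch_def Let_def Gamma_eq_zero_iff)

text \<open>The branch disappears from the absolute value. The equation holds at the poles as well, where both
  sides are \<open>0\<close>.\<close>

lemma norm_Gamma_pow:
  assumes "Gamma_branch \<Lambda>" "Re s = 0"
  shows "cmod (Gamma_pow \<Lambda> c D \<kappa> s) = cmod (Gamma (c + of_real D * s)) powr \<kappa>"
proof (cases "c + of_real D * s \<in> \<int>\<^sub>\<le>\<^sub>0")
  case True
  hence "Gamma (c + of_real D * s) = 0" by (simp add: Gamma_eq_zero_iff)
  thus ?thesis using True by (simp add: Gamma_pow_def)
next
  case False
  hence "exp (\<Lambda> c D \<kappa> s) = Gamma (c + of_real D * s)"
    using assms by (auto simp: Gamma_branch_def Let_def)
  hence "cmod (Gamma (c + of_real D * s)) = exp (Re (\<Lambda> c D \<kappa> s))" by (metis norm_exp_eq_Re)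
  thus ?thesis using False by (simp add: Gamma_pow_def exp_powr_real mult.commute)
qed

lemma norm_inverse_Gamma_pow:
  assumes "Gamma_branch \<Lambda>" "Re s = 0"
  shows "cmod (inverse (Gamma_pow \<Lambda> c D \<kappa> s)) = cmod (rGamma (c + of_real D * s)) powr \<kappa>"
  by (simp add: norm_inverse norm_Gamma_pow[OF assms] rGamma_inverse_Gamma inverse_powr)

lemma borel_measurable_Gamma_pow:
  assumes "Gamma_branch \<Lambda>"
  shows "(\<lambda>t. Gamma_pow \<Lambda> c D \<kappa> (\<i> * complex_of_real t)) \<in> borel_measurable borel"
proof -
  define S where "S = (\<lambda>t. c + of_real D * (\<i> * complex_of_real t)) -` (- \<int>\<^sub>\<le>\<^sub>0)"
  have "open S" unfolding S_def by (intro open_vimage open_Compl closed_nonpos_Ints continuous_intros)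
  hence S: "S \<in> sets borel" by simp
  have "continuous_on {s. Re s = 0 \<and> c + of_real D * s \<notin> \<int>\<^sub>\<le>\<^sub>0} (\<Lambda> c D \<kappa>)"
    using assms by (auto simp: Gamma_branch_def Let_def)
  hence "continuous_on S (\<lambda>t. \<Lambda> c D \<kappa> (\<i> * complex_of_real t))"
    by (rule continuous_on_compose2) (auto simp: S_def intro!: continuous_intros)
  hence "continuous_on S (\<lambda>t. exp (of_real \<kappa> * \<Lambda> c D \<kappa> (\<i> * complex_of_real t)))"
    by (intro continuous_intros)
  from borel_measurable_continuous_on_indicator[OF S this]
  have "(\<lambda>t. indicator S t *\<^sub>R exp (of_real \<kappa> * \<Lambda> c D \<kappa> (\<i> * complex_of_real t))) \<in> borel_measurable borel" .
  also have "(\<lambda>t. indicator S t *\<^sub>R exp (of_real \<kappa> * \<Lambda> c D \<kappa> (\<i> * complex_of_real t))) = 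
     (\<lambda>t. Gamma_pow \<Lambda> c D \<kappa> (\<i> * complex_of_real t))"
    by (auto simp: fun_eq_iff S_def Gamma_pow_def)
  finally show ?thesis .
qed

lemma powr_bound_of_vertical_bound:
  assumes "C > 0" "x \<le> C * vertical_bound p q t" "x \<ge> 0" "\<kappa> > 0"
  shows "x powr \<kappa> \<le> C powr \<kappa> * vertical_bound (p * \<kappa>) (q * \<kappa>) t"
proof -
  have "x powr \<kappa> \<le> (C * vertical_bound p q t) powr \<kappa>" using assms by (intro powr_mono2) auto
  also have "\<dots> = C powr \<kappa> * vertical_bound p q t powr \<kappa>"
    using assms vertical_bound_pos[of p q t] by (simp add: powr_mult)
  finally show ?thesis by (simp only: vertical_bound_powr)
qed

lemma vertical_growth_Gamma_pow:
  assumes \<Lambda>: "Gamma_branch \<Lambda>" and D: "D \<noteq> 0" and c: "Re c \<notin> \<int>\<^sub>\<le>\<^sub>0" and \<kappa>: "\<kappa> > 0"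
  shows "vertical_growth (\<lambda>t. Gamma_pow \<Lambda> c D \<kappa> (\<i> * of_real t)) ((Re c - 1/2) * \<kappa>) (pi / 2 * \<bar>D\<bar> * \<kappa>)"
proof -
  obtain C where C: "C > 0" "\<And>t. cmod (Gamma (c + of_real D * (\<i> * of_real t))) \<le> C * vertical_bound (Re c - 1/2) (pi / 2 * \<bar>D\<bar>) t"
    using Gamma_on_line[OF D c] by blast
  show ?thesis unfolding vertical_growth_def
    by (intro conjI exI[of _ "C powr \<kappa>"] allI borel_measurable_Gamma_pow \<Lambda>, use C(1) in simp)
       (subst norm_Gamma_pow[OF \<Lambda>], simp, rule powr_bound_of_vertical_bound[OF C(1) C(2) norm_ge_zero \<kappa>])
qed

lemma vertical_growth_inverse_Gamma_pow:
  assumes \<Lambda>: "Gamma_branch \<Lambda>" and D: "D \<noteq> 0" and \<kappa>: "\<kappa> > 0"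
  shows "vertical_growth (\<lambda>t. inverse (Gamma_pow \<Lambda> c D \<kappa> (\<i> * of_real t))) ((1/2 - Re c) * \<kappa>) (- pi / 2 * \<bar>D\<bar> * \<kappa>)"
proof -
  obtain C where C: "C > 0" "\<And>t. cmod (rGamma (c + of_real D * (\<i> * of_real t))) \<le> C * vertical_bound (1/2 - Re c) (- pi / 2 * \<bar>D\<bar>) t"
    using rGamma_on_line[OF D] by blast
  show ?thesis unfolding vertical_growth_def
    by (intro conjI exI[of _ "C powr \<kappa>"] allI borel_measurable_inverse borel_measurable_Gamma_pow \<Lambda>, use C(1) in simp)
       (subst norm_inverse_Gamma_pow[OF \<Lambda>], simp, rule powr_bound_of_vertical_bound[OF C(1) C(2) norm_ge_zero \<kappa>])
qed

lemma inverse_prod_list: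
  fixes f :: "'a \<Rightarrow> complex"
  shows "inverse (\<Prod>x\<leftarrow>xs. f x) = (\<Prod>x\<leftarrow>xs. inverse (f x))"
  by (induction xs) auto

lemma sum_list_take_drop:
  fixes f :: "'a \<Rightarrow> real"
  shows "(\<Sum>x\<leftarrow>xs. f x) = (\<Sum>x\<leftarrow>take m xs. f x) + (\<Sum>x\<leftarrow>drop m xs. f x)"
  by (metis append_take_drop_id map_append sum_list_append)

text \<open>The imaginary axis is mapped onto the vertical line through \<open>c\<close>, which meets the real axis at
  \<open>Re c\<close>.\<close>

lemma no_pole_on_axis:
  fixes c :: complex
  assumes D: "D \<noteq> 0" and "\<And>s. c + of_real D * s \<in> \<int>\<^sub>\<le>\<^sub>0 \<Longrightarrow> Re s \<noteq> 0"
  shows "Re c \<notin> \<int>\<^sub>\<le>\<^sub>0"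
proof
  assume "Re c \<in> \<int>\<^sub>\<le>\<^sub>0"
  then obtain n where n: "Re c = - of_nat n" by (elim nonpos_Ints_cases')
  define s where "s = \<i> * of_real (- Im c / D)"
  have "c + of_real D * s = - of_nat n" using n D by (simp add: s_def complex_eq_iff)
  hence "c + of_real D * s \<in> \<int>\<^sub>\<le>\<^sub>0" by simp
  from assms(2)[OF this] show False by (simp add: s_def)
qed

text \<open>Each Gamma factor contributes its exponents, and their sums are the defining sums of \<open>\<Omega>\<close> and
  \<open>\<pi>\<Delta>/2\<close>.\<close>

theorem vertical_growth_I_chi:
  assumes \<Lambda>: "Gamma_branch \<Lambda>" and adm: "I_admissible m n us ls \<theta>"
  shows "vertical_growth (\<lambda>t. I_chi \<Lambda> m n us ls (\<i> * of_real t)) (I_Omega us ls) (pi / 2 * I_Delta m n us ls)"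
proof -
  define N1 where "N1 = (\<lambda>x t. case x of (b, B, \<beta>) \<Rightarrow> Gamma_pow \<Lambda> b B \<beta> (\<i> * complex_of_real t))"
  define N2 where "N2 = (\<lambda>x t. case x of (a, A, \<alpha>) \<Rightarrow> Gamma_pow \<Lambda> (1 - a) (- A) \<alpha> (\<i> * complex_of_real t))"
  define p1 where "p1 = (\<lambda>x. case x of (b, B :: real, \<beta> :: real) \<Rightarrow> (Re b - 1/2) * \<beta>)"
  define p2 where "p2 = (\<lambda>x. case x of (a, A :: real, \<alpha> :: real) \<Rightarrow> (1/2 - Re a) * \<alpha>)"
  define q where "q = (\<lambda>x. case x of (b :: complex, B :: real, \<beta> :: real) \<Rightarrow> \<beta> * B)"
  have us: "A > 0 \<and> \<alpha> > 0" if "(a, A, \<alpha>) \<in> set us" for a A \<alpha> using adm that by (auto simp: I_admissible_def)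
  have ls: "B > 0 \<and> \<beta> > 0" if "(b, B, \<beta>) \<in> set ls" for b B \<beta> using adm that by (auto simp: I_admissible_def)
  have poles_l: "\<forall>(b, B, \<beta>)\<in>set (take m ls). \<forall>s. b + of_real B * s \<in> \<int>\<^sub>\<le>\<^sub>0 \<longrightarrow> Re s < 0"
    and poles_u: "\<forall>(a, A, \<alpha>)\<in>set (take n us). \<forall>s. 1 - a - of_real A * s \<in> \<int>\<^sub>\<le>\<^sub>0 \<longrightarrow> Re s > 0"
    using adm unfolding I_admissible_def by simp_all
  have g1: "vertical_growth (N1 x) (p1 x) (pi / 2 * q x)" if "x \<in> set (take m ls)" for x
  proof -
    obtain b B \<beta> where x: "x = (b, B, \<beta>)" by (cases x)
    have "B > 0 \<and> \<beta> > 0" using ls[of b B \<beta>] that x by (auto dest: in_set_takeD)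
    moreover have "Re b \<notin> \<int>\<^sub>\<le>\<^sub>0"
    proof (rule no_pole_on_axis[of B])
      fix s assume "b + of_real B * s \<in> \<int>\<^sub>\<le>\<^sub>0"
      thus "Re s \<noteq> 0" using bspec[OF poles_l that] unfolding x by auto
    qed (use calculation in auto)
    ultimately show ?thesis using vertical_growth_Gamma_pow[OF \<Lambda>, of B b \<beta>]
      by (simp add: x N1_def p1_def q_def mult_ac)
  qed
  have g2: "vertical_growth (N2 x) (p2 x) (pi / 2 * q x)" if "x \<in> set (take n us)" for x
  proof -
    obtain a A \<alpha> where x: "x = (a, A, \<alpha>)" by (cases x)
    have "A > 0 \<and> \<alpha> > 0" using us[of a A \<alpha>] that x by (auto dest: in_set_takeD)
    moreover have "Re (1 - a) \<notin> \<int>\<^sub>\<le>\<^sub>0"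
    proof (rule no_pole_on_axis[of "- A"])
      fix s assume "1 - a + of_real (- A) * s \<in> \<int>\<^sub>\<le>\<^sub>0"
      hence "1 - a - of_real A * s \<in> \<int>\<^sub>\<le>\<^sub>0" by simp
      thus "Re s \<noteq> 0" using bspec[OF poles_u that] unfolding x by auto
    qed (use calculation in auto)
    ultimately show ?thesis using vertical_growth_Gamma_pow[OF \<Lambda>, of "- A" "1 - a" \<alpha>]
      by (simp add: x N2_def p2_def q_def mult_ac)
  qed
  have g3: "vertical_growth (\<lambda>t. inverse (N2 x t)) (p1 x) (- (pi / 2 * q x))" if "x \<in> set (drop m ls)" for x
  proof -
    obtain b B \<beta> where x: "x = (b, B, \<beta>)" by (cases x)
    have B: "B > 0 \<and> \<beta> > 0" using ls[of b B \<beta>] that x by (auto dest: in_set_dropD)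
    have e: "1/2 - Re (1 - b) = Re b - 1/2" by simp
    show ?thesis using vertical_growth_inverse_Gamma_pow[OF \<Lambda>, of "- B" \<beta> "1 - b"] B
      unfolding e by (simp add: x N2_def p1_def q_def mult_ac)
  qed
  have g4: "vertical_growth (\<lambda>t. inverse (N1 x t)) (p2 x) (- (pi / 2 * q x))" if "x \<in> set (drop n us)" for x
  proof -
    obtain a A \<alpha> where x: "x = (a, A, \<alpha>)" by (cases x)
    have "A > 0 \<and> \<alpha> > 0" using us[of a A \<alpha>] that x by (auto dest: in_set_dropD)
    thus ?thesis using vertical_growth_inverse_Gamma_pow[OF \<Lambda>, of A \<alpha> a]
      by (simp add: x N1_def p2_def q_def mult_ac)
  qed
  have "vertical_growth (\<lambda>t. ((\<Prod>x\<leftarrow>take m ls. N1 x t) * (\<Prod>x\<leftarrow>take n us. N2 x t)) *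
      ((\<Prod>x\<leftarrow>drop m ls. inverse (N2 x t)) * (\<Prod>x\<leftarrow>drop n us. inverse (N1 x t))))
     (((\<Sum>x\<leftarrow>take m ls. p1 x) + (\<Sum>x\<leftarrow>take n us. p2 x)) + ((\<Sum>x\<leftarrow>drop m ls. p1 x) + (\<Sum>x\<leftarrow>drop n us. p2 x)))
     (((\<Sum>x\<leftarrow>take m ls. pi / 2 * q x) + (\<Sum>x\<leftarrow>take n us. pi / 2 * q x)) +
      ((\<Sum>x\<leftarrow>drop m ls. - (pi / 2 * q x)) + (\<Sum>x\<leftarrow>drop n us. - (pi / 2 * q x))))"
    by (intro vertical_growth_mult vertical_growth_prod_list g1 g2 g3 g4)
  also have "(\<lambda>t. ((\<Prod>x\<leftarrow>take m ls. N1 x t) * (\<Prod>x\<leftarrow>take n us. N2 x t)) *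
      ((\<Prod>x\<leftarrow>drop m ls. inverse (N2 x t)) * (\<Prod>x\<leftarrow>drop n us. inverse (N1 x t)))) = 
      (\<lambda>t. I_chi \<Lambda> m n us ls (\<i> * of_real t))"
    unfolding I_chi_def inverse_prod_list[symmetric] N1_def N2_def divide_inverse inverse_mult_distrib ..
  also have "((\<Sum>x\<leftarrow>take m ls. p1 x) + (\<Sum>x\<leftarrow>take n us. p2 x)) + ((\<Sum>x\<leftarrow>drop m ls. p1 x) + (\<Sum>x\<leftarrow>drop n us. p2 x)) = 
      (\<Sum>x\<leftarrow>us. p2 x) + (\<Sum>x\<leftarrow>ls. p1 x)"
    by (simp add: sum_list_take_drop[of p1 ls m] sum_list_take_drop[of p2 us n])
  also have "(\<Sum>x\<leftarrow>us. p2 x) + (\<Sum>x\<leftarrow>ls. p1 x) = I_Omega us ls"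
  proof -
    have "(\<Sum>x\<leftarrow>ls. p1 x) = (\<Sum>x\<leftarrow>ls. - (case x of (b, B, \<beta>) \<Rightarrow> (1/2 - Re b) * \<beta>))"
      by (intro arg_cong[of _ _ sum_list] map_cong) (auto simp: p1_def algebra_simps)
    thus ?thesis unfolding I_Omega_def p2_def by (simp add: uminus_sum_list_map[unfolded o_def, symmetric])
  qed
  also have "((\<Sum>x\<leftarrow>take m ls. pi / 2 * q x) + (\<Sum>x\<leftarrow>take n us. pi / 2 * q x)) +
      ((\<Sum>x\<leftarrow>drop m ls. - (pi / 2 * q x)) + (\<Sum>x\<leftarrow>drop n us. - (pi / 2 * q x))) = pi / 2 * I_Delta m n us ls"
    unfolding I_Delta_def q_def[symmetric] uminus_sum_list_map[unfolded o_def, symmetric] sum_list_const_mult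
    by (simp add: algebra_simps)
  finally show ?thesis .
qed

lemma vertical_growth_exp:
  fixes l \<theta> :: real
  shows "vertical_growth (\<lambda>t. exp (- (\<i> * of_real t) * (of_real l + \<i> * of_real \<theta>))) 0 (- \<bar>\<theta>\<bar>)"
  unfolding vertical_growth_def
proof (intro conjI exI[of _ 1] allI)
  fix t :: real
  have "\<theta> * t \<le> \<bar>\<theta>\<bar> * \<bar>t\<bar>" by (metis abs_ge_self abs_mult)
  thus "cmod (exp (- (\<i> * of_real t) * (of_real l + \<i> * of_real \<theta>))) \<le> 1 * vertical_bound 0 (- \<bar>\<theta>\<bar>) t"
    by (simp add: vertical_bound_def mult.commute)
qed auto

lemma I_convergence_integrable:
  assumes "I_convergence m n us ls 0 \<theta>"
    and "vertical_growth g (I_Omega us ls) (pi / 2 * I_Delta m n us ls - \<bar>\<theta>\<bar>)"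
  shows "integrable lborel g"
  by (rule vertical_growth_integrable[OF assms(2)]) (use assms(1) in \<open>auto simp: I_convergence_def\<close>)

section \<open>Differentiation of superpositions of powers\<close>

lemma has_vector_derivative_iff_quotient:
  fixes f :: "real \<Rightarrow> 'a :: real_normed_vector"
  shows "(f has_vector_derivative D) (at x) \<longleftrightarrow> ((\<lambda>y. (f y - f x) /\<^sub>R (y - x)) \<longlongrightarrow> D) (at x)"
proof -
  have "(f has_vector_derivative D) (at x) \<longleftrightarrow> 
     ((\<lambda>y. (1 / norm (y - x)) *\<^sub>R (f y - (f x + (y - x) *\<^sub>R D))) \<longlongrightarrow> 0) (at x)"
    by (simp add: has_vector_derivative_def has_derivative_within bounded_linear_scaleR_left)
  also have "\<dots> \<longleftrightarrow> ((\<lambda>y. norm ((1 / norm (y - x)) *\<^sub>R (f y - (f x + (y - x) *\<^sub>R D)))) \<longlongrightarrow> 0) (at x)"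
    by (rule tendsto_norm_zero_iff[symmetric])
  also have "\<dots> \<longleftrightarrow> ((\<lambda>y. norm ((f y - f x) /\<^sub>R (y - x) - D)) \<longlongrightarrow> 0) (at x)"
  proof (rule tendsto_cong)
    show "\<forall>\<^sub>F y in at x. norm ((1 / norm (y - x)) *\<^sub>R (f y - (f x + (y - x) *\<^sub>R D))) = norm ((f y - f x) /\<^sub>R (y - x) - D)"
      unfolding eventually_at_filter
    proof (intro always_eventually allI impI)
      fix y assume y: "y \<noteq> x"
      have "(f y - f x) /\<^sub>R (y - x) - D = (f y - (f x + (y - x) *\<^sub>R D)) /\<^sub>R (y - x)"
        using y by (simp add: scaleR_diff_right scaleR_add_right diff_diff_eq)
      thus "norm ((1 / norm (y - x)) *\<^sub>R (f y - (f x + (y - x) *\<^sub>R D))) = norm ((f y - f x) /\<^sub>R (y - x) - D)"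
        by (simp add: divide_inverse)
    qed
  qed
  also have "\<dots> \<longleftrightarrow> ((\<lambda>y. (f y - f x) /\<^sub>R (y - x)) \<longlongrightarrow> D) (at x)"
    by (simp add: tendsto_norm_zero_iff flip: LIM_zero_iff[of _ D])
  finally show ?thesis .
qed

lemma of_real_powr_eq_exp: "x > 0 \<Longrightarrow> complex_of_real x powr w = exp (w * of_real (ln x))"
  by (simp add: powr_def flip: Ln_of_real)

lemma integrable_mult_powr:
  fixes Z w :: "real \<Rightarrow> complex"
  assumes Z: "integrable lborel Z" and w [measurable]: "w \<in> borel_measurable borel"
      and r: "\<And>t. Re (w t) = r" and x: "x > 0"
    shows "integrable lborel (\<lambda>t. Z t * of_real x powr w t)"
proof (rule Bochner_Integration.integrable_bound)
  show "integrable lborel (\<lambda>t. of_real (x powr r) * Z t)" using Z by simp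
  have [measurable]: "Z \<in> borel_measurable borel" using Z by simp
  show "(\<lambda>t. Z t * of_real x powr w t) \<in> borel_measurable lborel"
    unfolding of_real_powr_eq_exp[OF x] by measurable
  show "AE t in lborel. cmod (Z t * of_real x powr w t) \<le> cmod (of_real (x powr r) * Z t)"
    using x r by (intro AE_I2) (simp add: norm_mult norm_powr_real_powr mult.commute)
qed

lemma norm_powr_diff_le:
  fixes w :: complex
  assumes "0 < a" "u \<in> {a..b}" "v \<in> {a..b}"
  shows "cmod (of_real u powr w - of_real v powr w) \<le> cmod w * max (a powr (Re w - 1)) (b powr (Re w - 1)) * \<bar>u - v\<bar>"
proof -
  define B where "B = max (a powr (Re w - 1)) (b powr (Re w - 1))"
  have le: "t powr (Re w - 1) \<le> B" if "t \<in> {a..b}" for t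
  proof (cases "Re w \<ge> 1")
    case True
    have "t powr (Re w - 1) \<le> b powr (Re w - 1)" using True that assms(1) by (intro powr_mono2) auto
    thus ?thesis by (simp add: B_def)
  next
    case False
    have "t powr (Re w - 1) \<le> a powr (Re w - 1)" using False that assms(1) by (intro powr_mono2') auto
    thus ?thesis by (simp add: B_def)
  qed
  have "norm (complex_of_real u powr w - complex_of_real v powr w) \<le> (cmod w * B) * norm (u - v)"
  proof (rule differentiable_bound[of "{a..b}" _ "\<lambda>t h. h *\<^sub>R (w * of_real t powr (w - 1))"])
    fix t assume t: "t \<in> {a..b}"
    have "((\<lambda>t. complex_of_real t powr w) has_vector_derivative w * of_real t powr (w - 1)) (at t within {a..b})"
      using t assms(1) by (intro has_vector_derivative_at_within[OF of_real_powr_has_vector_derivative]) auto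
    thus "((\<lambda>t. complex_of_real t powr w) has_derivative (\<lambda>h. h *\<^sub>R (w * of_real t powr (w - 1)))) (at t within {a..b})"
      by (simp add: has_vector_derivative_def)
    show "onorm (\<lambda>h. h *\<^sub>R (w * of_real t powr (w - 1))) \<le> cmod w * B"
    proof (rule onorm_le)
      fix h :: real
      have "cmod (h *\<^sub>R (w * of_real t powr (w - 1))) = (cmod w * t powr (Re w - 1)) * \<bar>h\<bar>"
        using t assms(1) by (simp add: norm_mult norm_powr_real_powr)
      also have "\<dots> \<le> (cmod w * B) * \<bar>h\<bar>" by (intro mult_right_mono mult_left_mono le t) auto
      finally show "cmod (h *\<^sub>R (w * of_real t powr (w - 1))) \<le> (cmod w * B) * norm h" by simp
    qed
  qed (use assms in auto)
  thus ?thesis by (simp add: B_def)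
qed

text \<open>Since \<open>Re (w t)\<close> does not depend on \<open>t\<close>, the difference quotients of the powers are bounded near \<open>x\<close>
  by a constant times \<open>\<bar>w t\<bar>\<close>, and dominated convergence applies.\<close>

theorem LINT_powr_has_vector_derivative:
  fixes Z w :: "real \<Rightarrow> complex"
  assumes Z: "integrable lborel Z" and Zw: "integrable lborel (\<lambda>t. Z t * w t)"
      and w [measurable]: "w \<in> borel_measurable borel"
      and r: "\<And>t. Re (w t) = r" and x: "x > 0"
    shows "((\<lambda>x. LINT t|lborel. Z t * of_real x powr w t) has_vector_derivative
            (LINT t|lborel. Z t * w t * of_real x powr (w t - 1))) (at x)"
  unfolding has_vector_derivative_iff_quotient
proof -
  let ?F = "\<lambda>x. LINT t|lborel. Z t * of_real x powr w t"
  let ?D = "LINT t|lborel. Z t * w t * of_real x powr (w t - 1)"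
  have [measurable]: "Z \<in> borel_measurable borel" using Z by simp
  define S where "S = {x / 2<..<2 * x}"
  have S: "open S" "x \<in> S" using x by (auto simp: S_def)
  \<comment> \<open>The mean value bound for \<open>y\<^bsup>r - 1\<^esup>\<close> on the neighbourhood; the maximum covers both signs of \<open>r - 1\<close>.\<close>
  define B where "B = max ((x / 2) powr (r - 1)) ((2 * x) powr (r - 1))"
  have "((\<lambda>y. (?F y - ?F x) /\<^sub>R (y - x)) \<longlongrightarrow> ?D) (at x within S)"
    unfolding tendsto_at_iff_sequentially
  proof (intro allI impI)
    fix X assume X: "\<forall>i. X i \<in> S - {x}" and lim: "X \<longlonglongrightarrow> x"
    have X0: "X i > 0" "X i \<noteq> x" "X i \<in> {x / 2..2 * x}" for i using X[rule_format, of i] x by (auto simp: S_def)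
    define q where "q = (\<lambda>i t. (Z t * (of_real (X i) powr w t - of_real x powr w t)) /\<^sub>R (X i - x))"
    have eq: "(?F (X i) - ?F x) /\<^sub>R (X i - x) = (LINT t|lborel. q i t)" for i
    proof -
      have "?F (X i) - ?F x = (LINT t|lborel. Z t * of_real (X i) powr w t - Z t * of_real x powr w t)"
        by (rule Bochner_Integration.integral_diff[symmetric]) (intro integrable_mult_powr[OF Z w r] X0 x)+
      thus ?thesis unfolding q_def by (simp add: right_diff_distrib)
    qed
    have "(\<lambda>i. LINT t|lborel. q i t) \<longlonglongrightarrow> ?D"
    proof (rule integral_dominated_convergence)
      show "(\<lambda>t. Z t * w t * of_real x powr (w t - 1)) \<in> borel_measurable lborel"
        unfolding of_real_powr_eq_exp[OF x] by measurable
      show "q i \<in> borel_measurable lborel" for i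
        unfolding q_def of_real_powr_eq_exp[OF x] of_real_powr_eq_exp[OF X0(1)] by measurable
      show "integrable lborel (\<lambda>t. B * cmod (Z t * w t))" using Zw by simp
      show "AE t in lborel. (\<lambda>i. q i t) \<longlonglongrightarrow> Z t * w t * of_real x powr (w t - 1)"
      proof (rule AE_I2)
        fix t
        have "((\<lambda>y. (complex_of_real y powr w t - of_real x powr w t) /\<^sub>R (y - x)) \<longlongrightarrow> w t * of_real x powr (w t - 1)) (at x)"
          using of_real_powr_has_vector_derivative[OF x, of "w t"] unfolding has_vector_derivative_iff_quotient .
        hence "(\<lambda>i. (complex_of_real (X i) powr w t - of_real x powr w t) /\<^sub>R (X i - x)) \<longlonglongrightarrow> w t * of_real x powr (w t - 1)"
          using lim X0(2) unfolding tendsto_at_iff_sequentially[of _ _ _ UNIV] by (auto simp: o_def)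
        from tendsto_mult[OF tendsto_const[of "Z t"] this]
        show "(\<lambda>i. q i t) \<longlonglongrightarrow> Z t * w t * of_real x powr (w t - 1)" by (simp add: q_def mult.assoc)
      qed
      show "AE t in lborel. cmod (q i t) \<le> B * cmod (Z t * w t)" for i
      proof (rule AE_I2)
        fix t
        have "cmod (of_real (X i) powr w t - of_real x powr w t) \<le> cmod (w t) * B * \<bar>X i - x\<bar>"
          using norm_powr_diff_le[of "x / 2" "X i" "2 * x" x "w t"] X0[of i] x by (simp add: r B_def)
        hence "cmod (Z t) * cmod (of_real (X i) powr w t - of_real x powr w t) \<le> cmod (Z t) * (cmod (w t) * B * \<bar>X i - x\<bar>)"
          by (intro mult_left_mono) auto
        hence "cmod (Z t) * cmod (of_real (X i) powr w t - of_real x powr w t) / \<bar>X i - x\<bar> \<le> cmod (Z t) * (cmod (w t) * B)"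
          using X0(2)[of i] by (simp add: divide_simps mult_ac)
        thus "cmod (q i t) \<le> B * cmod (Z t * w t)"
          by (simp add: q_def norm_mult divide_inverse mult_ac)
      qed
    qed
    thus "((\<lambda>y. (?F y - ?F x) /\<^sub>R (y - x)) \<circ> X) \<longlonglongrightarrow> ?D" by (simp add: o_def eq)
  qed
  thus "((\<lambda>y. (?F y - ?F x) /\<^sub>R (y - x)) \<longlongrightarrow> ?D) (at x)" by (simp only: at_within_open[OF S(2,1)])
qed

section \<open>The MSM integral of a superposition of powers\<close>

lemma set_integral_rescale:
  fixes k :: "real \<Rightarrow> complex"
  assumes x: "x > 0"
  shows "set_integrable lborel {0<..<x} (\<lambda>t. k (1 - t / x)) \<longleftrightarrow> set_integrable lborel {0<..<1} k"
    and "(LINT t:{0<..<x}|lborel. k (1 - t / x)) = of_real x * (LINT y:{0<..<1}|lborel. k y)"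
proof -
  let ?h = "\<lambda>t. indicator {0<..<x} t *\<^sub>R k (1 - t / x)"
  have eq: "?h (x + (- x) * y) = indicator {0<..<1} y *\<^sub>R k y" for y
  proof -
    have "1 - (x + (- x) * y) / x = y" using x by (simp add: field_simps)
    moreover have "x + (- x) * y \<in> {0<..<x} \<longleftrightarrow> y \<in> {0<..<1}"
      using x mult_less_cancel_left_pos[of x y 1] by (auto simp: zero_less_mult_iff)
    ultimately show ?thesis by (simp add: indicator_def)
  qed
  have "integrable lborel (\<lambda>y. ?h (x + (- x) * y)) \<longleftrightarrow> integrable lborel ?h"
    using x by (intro lborel_integrable_real_affine_iff) auto
  thus "set_integrable lborel {0<..<x} (\<lambda>t. k (1 - t / x)) \<longleftrightarrow> set_integrable lborel {0<..<1} k"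
    unfolding eq set_integrable_def by simp
  have "integral\<^sup>L lborel ?h = \<bar>- x\<bar> *\<^sub>R (LINT y|lborel. ?h (x + (- x) * y))"
    using x by (intro lborel_integral_real_affine) auto
  thus "(LINT t:{0<..<x}|lborel. k (1 - t / x)) = of_real x * (LINT y:{0<..<1}|lborel. k y)"
    unfolding eq set_lebesgue_integral_def using x by (simp add: scaleR_conv_of_real)
qed

lemma of_real_powr_mult: 
  assumes "a > 0" "b > 0"
  shows "complex_of_real (a * b) powr s = of_real a powr s * of_real b powr s"
  using assms by (subst of_real_powr_eq_exp, simp)+ (simp add: ln_mult distrib_left exp_add)

text \<open>The weight of \<open>f\<close> in the MSM integral. The power \<open>t\<^bsup>- \<alpha>'\<^esup>\<close> of the definition is combined with the factor
  \<open>(t / x)\<^bsup>\<alpha>'\<^esup>\<close> from Pfaff's transformation.\<close>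

definition MSM_kernel :: "complex \<Rightarrow> complex \<Rightarrow> complex \<Rightarrow> complex \<Rightarrow> complex \<Rightarrow> real \<Rightarrow> real \<Rightarrow> complex" where
  "MSM_kernel \<alpha> \<alpha>' \<beta> \<beta>' \<gamma> x t =
     of_real (x - t) powr (\<gamma> - 1) * of_real x powr (- \<alpha>') * F3_diag \<alpha> \<alpha>' \<beta> \<beta>' \<gamma> (of_real (1 - t / x))"

lemma MSM_integrand_eq_kernel:
  assumes "Re \<gamma> > 0" "0 < t" "t < x"
  shows "MSM_integrand \<alpha> \<alpha>' \<beta> \<beta>' \<gamma> f x t = MSM_kernel \<alpha> \<alpha>' \<beta> \<beta>' \<gamma> x t * f t"
proof -
  have x: "x > 0" using assms by linarith
  define s where "s = t / x"
  have s: "0 < s" "s < 1" using assms x by (auto simp: s_def)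
  have xt: "x / t = 1 / s" and ts: "t = x * s" using x by (auto simp: s_def)
  have "of_real t powr (- \<alpha>') * Appell_F3 \<alpha> \<alpha>' \<beta> \<beta>' \<gamma> (of_real (1 - t / x)) (of_real (1 - x / t)) =
     of_real t powr (- \<alpha>') * of_real s powr \<alpha>' * F3_diag \<alpha> \<alpha>' \<beta> \<beta>' \<gamma> (of_real (1 - s))"
    unfolding xt s_def[symmetric] Appell_F3_eq_F3_diag[OF assms(1) s] by (simp add: mult_ac)
  also have "of_real t powr (- \<alpha>') * of_real s powr \<alpha>' = of_real x powr (- \<alpha>')"
    unfolding ts of_real_powr_mult[OF x s(1)] using s by (simp add: powr_minus)
  finally have eq: "of_real t powr (- \<alpha>') * Appell_F3 \<alpha> \<alpha>' \<beta> \<beta>' \<gamma> (of_real (1 - t / x)) (of_real (1 - x / t)) =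
     of_real x powr (- \<alpha>') * F3_diag \<alpha> \<alpha>' \<beta> \<beta>' \<gamma> (of_real (1 - s))" .
  have "MSM_integrand \<alpha> \<alpha>' \<beta> \<beta>' \<gamma> f x t = of_real (x - t) powr (\<gamma> - 1) * 
      (of_real t powr (- \<alpha>') * Appell_F3 \<alpha> \<alpha>' \<beta> \<beta>' \<gamma> (of_real (1 - t / x)) (of_real (1 - x / t))) * f t"
    by (simp only: MSM_integrand_def mult.assoc)
  thus ?thesis unfolding eq by (simp only: MSM_kernel_def s_def mult.assoc)
qed

lemma MSM_kernel_mult_powr:
  assumes "0 < t" "t < x"
  shows "MSM_kernel \<alpha> \<alpha>' \<beta> \<beta>' \<gamma> x t * of_real t powr (w - 1) = 
         of_real x powr (\<gamma> + w - 2 - \<alpha>') * F3_kernel \<alpha> \<alpha>' \<beta> \<beta>' \<gamma> w (1 - t / x)"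
proof -
  have x: "x > 0" using assms by linarith
  define s where "s = t / x"
  have s: "0 < s" "s < 1" using assms x by (auto simp: s_def)
  have 1: "t = x * s" and 2: "x - t = x * (1 - s)" using x by (auto simp: s_def field_simps)
  have s1: "0 < 1 - s" using s by simp
  have pw: "of_real x powr (\<gamma> + w - 2 - \<alpha>') = of_real x powr (\<gamma> - 1) * of_real x powr (- \<alpha>') * of_real x powr (w - 1)"
    by (simp add: powr_add[symmetric] algebra_simps)
  show ?thesis
    unfolding MSM_kernel_def F3_kernel_def s_def[symmetric] pw
    unfolding 2 of_real_powr_mult[OF x s1]
    unfolding 1 of_real_powr_mult[OF x s(1)] using x by (simp add: mult_ac)
qed

theorem MSM_kernel_power:
  assumes \<gamma>: "Re \<gamma> > 0" and w: "Re w > F3_exponent \<alpha> \<alpha>' \<beta> \<beta>' \<gamma>" and x: "x > 0"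
  shows "set_integrable lborel {0<..<x} (\<lambda>t. MSM_kernel \<alpha> \<alpha>' \<beta> \<beta>' \<gamma> x t * of_real t powr (w - 1))"
    and "(LINT t:{0<..<x}|lborel. MSM_kernel \<alpha> \<alpha>' \<beta> \<beta>' \<gamma> x t * of_real t powr (w - 1)) =
         of_real x powr (\<gamma> + w - 1 - \<alpha>') * (Gamma \<gamma> * MSM_multiplier \<alpha> \<alpha>' \<beta> \<beta>' \<gamma> w)"
proof -
  let ?c = "of_real x powr (\<gamma> + w - 2 - \<alpha>')"
  have eq: "MSM_kernel \<alpha> \<alpha>' \<beta> \<beta>' \<gamma> x t * of_real t powr (w - 1) = ?c * F3_kernel \<alpha> \<alpha>' \<beta> \<beta>' \<gamma> w (1 - t / x)"
    if "t \<in> {0<..<x}" for t using MSM_kernel_mult_powr[of t x] that by auto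
  have "set_integrable lborel {0<..<x} (\<lambda>t. ?c * F3_kernel \<alpha> \<alpha>' \<beta> \<beta>' \<gamma> w (1 - t / x))"
    using F3_kernel_integrable[OF \<gamma> w] by (intro set_integrable_mult_right) (simp add: set_integral_rescale[OF x])
  thus "set_integrable lborel {0<..<x} (\<lambda>t. MSM_kernel \<alpha> \<alpha>' \<beta> \<beta>' \<gamma> x t * of_real t powr (w - 1))"
    by (rule set_integrable_cong[OF refl refl, THEN iffD1, rotated]) (rule eq[symmetric])
  have "(LINT t:{0<..<x}|lborel. MSM_kernel \<alpha> \<alpha>' \<beta> \<beta>' \<gamma> x t * of_real t powr (w - 1)) = 
        (LINT t:{0<..<x}|lborel. ?c * F3_kernel \<alpha> \<alpha>' \<beta> \<beta>' \<gamma> w (1 - t / x))"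
    by (rule set_lebesgue_integral_cong) (use eq in auto)
  also have "\<dots> = ?c * (of_real x * (Gamma \<gamma> * MSM_multiplier \<alpha> \<alpha>' \<beta> \<beta>' \<gamma> w))"
    by (simp add: set_integral_rescale[OF x] F3_mellin[OF \<gamma> w])
  also have "\<dots> = (?c * of_real x powr 1) * (Gamma \<gamma> * MSM_multiplier \<alpha> \<alpha>' \<beta> \<beta>' \<gamma> w)" using x by simp
  also have "?c * of_real x powr 1 = of_real x powr (\<gamma> + w - 1 - \<alpha>')"
    by (simp only: powr_add[symmetric]) (simp add: algebra_simps)
  finally show "(LINT t:{0<..<x}|lborel. MSM_kernel \<alpha> \<alpha>' \<beta> \<beta>' \<gamma> x t * of_real t powr (w - 1)) =
         of_real x powr (\<gamma> + w - 1 - \<alpha>') * (Gamma \<gamma> * MSM_multiplier \<alpha> \<alpha>' \<beta> \<beta>' \<gamma> w)" .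
qed

lemma borel_measurable_MSM_kernel:
  assumes \<gamma>: "Re \<gamma> > 0" and x: "x > 0"
  shows "(\<lambda>t. indicator {0<..<x} t *\<^sub>R MSM_kernel \<alpha> \<alpha>' \<beta> \<beta>' \<gamma> x t) \<in> borel_measurable borel"
proof (rule borel_measurable_continuous_on_indicator)
  have "continuous_on {0<..<x} (\<lambda>t. F3_diag \<alpha> \<alpha>' \<beta> \<beta>' \<gamma> (complex_of_real (1 - t / x)))"
    by (rule continuous_on_compose2[OF continuous_on_F3_diag[OF \<gamma>], of _ "\<lambda>t. 1 - t / x"])
       (use x in \<open>auto intro!: continuous_intros\<close>)
  moreover have "continuous_on {0<..<x} (\<lambda>t. complex_of_real (x - t) powr (\<gamma> - 1) * of_real x powr (- \<alpha>'))"
    by (intro continuous_intros) (auto simp: complex_nonpos_Reals_iff)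
  ultimately show "continuous_on {0<..<x} (MSM_kernel \<alpha> \<alpha>' \<beta> \<beta>' \<gamma> x)"
    unfolding MSM_kernel_def[abs_def] by (rule continuous_on_mult[rotated])
qed auto

text \<open>The absolute value of \<open>t\<^bsup>\<rho> - \<i>\<mu>\<tau> - 1\<^esup>\<close> does not depend on \<open>\<tau>\<close>, so that the double integral of
  absolute values is a product of two finite integrals and Fubini's theorem applies.\<close>

theorem MSM_integral_superposition:
  fixes Y :: "real \<Rightarrow> complex" and f :: "real \<Rightarrow> complex" and \<mu> :: real
  assumes Y: "integrable lborel Y"
      and f: "\<And>t. t > 0 \<Longrightarrow> f t = (LINT \<tau>|lborel. Y \<tau> * of_real t powr (\<rho> - \<i> * of_real (\<mu> * \<tau>) - 1))"
      and \<gamma>: "Re \<gamma> > 0" and \<rho>: "Re \<rho> > F3_exponent \<alpha> \<alpha>' \<beta> \<beta>' \<gamma>" and x: "x > 0"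
  shows "set_integrable lborel {0<..<x} (MSM_integrand \<alpha> \<alpha>' \<beta> \<beta>' \<gamma> f x)"
    and "MSM_integral \<alpha> \<alpha>' \<beta> \<beta>' \<gamma> f x =
      (LINT \<tau>|lborel. Y \<tau> * MSM_multiplier \<alpha> \<alpha>' \<beta> \<beta>' \<gamma> (\<rho> - \<i> * of_real (\<mu> * \<tau>)) *
         of_real x powr (\<gamma> + \<rho> - 1 - \<alpha> - \<alpha>' - \<i> * of_real (\<mu> * \<tau>)))"
proof -
  define w where "w = (\<lambda>\<tau>. \<rho> - \<i> * of_real (\<mu> * \<tau>))"
  have w: "Re (w \<tau>) = Re \<rho>" for \<tau> by (simp add: w_def)
  have [measurable]: "w \<in> borel_measurable borel" unfolding w_def by measurable
  have [measurable]: "Y \<in> borel_measurable borel" using Y by simp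
  define K where "K = (\<lambda>t. indicator {0<..<x} t *\<^sub>R MSM_kernel \<alpha> \<alpha>' \<beta> \<beta>' \<gamma> x t)"
  have [measurable]: "K \<in> borel_measurable borel" unfolding K_def by (rule borel_measurable_MSM_kernel[OF \<gamma> x])
  \<comment> \<open>The power is written with \<open>exp\<close> and \<open>ln\<close> to make joint measurability evident; both forms agree where
    \<open>K\<close> does not vanish.\<close>
  define G where "G = (\<lambda>t \<tau>. K t * (Y \<tau> * exp ((w \<tau> - 1) * of_real (ln t))))"
  have G: "G t \<tau> = Y \<tau> * (K t * of_real t powr (w \<tau> - 1))" for t \<tau>
  proof (cases "t \<in> {0<..<x}")
    case True
    thus ?thesis by (simp add: G_def of_real_powr_eq_exp mult_ac)
  qed (simp add: G_def K_def)
  have nG: "cmod (G t \<tau>) = cmod (K t * of_real t powr (\<rho> - 1)) * cmod (Y \<tau>)" for t \<tau>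
  proof (cases "t \<in> {0<..<x}")
    case True
    thus ?thesis by (simp add: G norm_mult norm_powr_real_powr w mult_ac)
  qed (simp add: G_def K_def)
  have KI: "integrable lborel (\<lambda>t. K t * of_real t powr (v - 1))"
    and KV: "(LINT t|lborel. K t * of_real t powr (v - 1)) = 
         of_real x powr (\<gamma> + v - 1 - \<alpha>') * (Gamma \<gamma> * MSM_multiplier \<alpha> \<alpha>' \<beta> \<beta>' \<gamma> v)"
    if "Re v > F3_exponent \<alpha> \<alpha>' \<beta> \<beta>' \<gamma>" for v
    using MSM_kernel_power[OF \<gamma> that x] by (simp_all add: set_integrable_def set_lebesgue_integral_def K_def)
  have GI: "integrable (lborel \<Otimes>\<^sub>M lborel) (\<lambda>(t, \<tau>). G t \<tau>)"
  proof (rule lborel_pair.Fubini_integrable)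
    show "(\<lambda>(t, \<tau>). G t \<tau>) \<in> borel_measurable (lborel \<Otimes>\<^sub>M lborel)"
      unfolding G_def by measurable
    have "integrable lborel (\<lambda>t. cmod (K t * of_real t powr (\<rho> - 1)) * (LINT \<tau>|lborel. cmod (Y \<tau>)))"
      by (intro integrable_mult_left integrable_norm KI \<rho>)
    thus "integrable lborel (\<lambda>t. LINT \<tau>|lborel. norm (case (t, \<tau>) of (t, \<tau>) \<Rightarrow> G t \<tau>))"
      by (simp add: nG)
    show "AE t in lborel. integrable lborel (\<lambda>\<tau>. case (t, \<tau>) of (t, \<tau>) \<Rightarrow> G t \<tau>)"
    proof (rule AE_I2)
      fix t
      show "integrable lborel (\<lambda>\<tau>. case (t, \<tau>) of (t, \<tau>) \<Rightarrow> G t \<tau>)"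
      proof (rule Bochner_Integration.integrable_bound)
        show "integrable lborel (\<lambda>\<tau>. cmod (K t * of_real t powr (\<rho> - 1)) * cmod (Y \<tau>))"
          using Y by simp
        show "(\<lambda>\<tau>. case (t, \<tau>) of (t, \<tau>) \<Rightarrow> G t \<tau>) \<in> borel_measurable lborel" unfolding G_def by simp
      qed (auto simp: nG)
    qed
  qed
  have Gf: "(LINT \<tau>|lborel. G t \<tau>) = indicator {0<..<x} t *\<^sub>R MSM_integrand \<alpha> \<alpha>' \<beta> \<beta>' \<gamma> f x t" for t
  proof (cases "t \<in> {0<..<x}")
    case True
    hence "(LINT \<tau>|lborel. G t \<tau>) = K t * f t"
      by (simp add: G f w_def mult_ac flip: integral_mult_right_zero)
    thus ?thesis using True MSM_integrand_eq_kernel[OF \<gamma>, of t x] by (simp add: K_def)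
  qed (simp add: G_def K_def)
  have "integrable lborel (\<lambda>t. LINT \<tau>|lborel. (case (t, \<tau>) of (t, \<tau>) \<Rightarrow> G t \<tau>))"
    by (rule lborel_pair.integrable_fst'[OF GI])
  thus "set_integrable lborel {0<..<x} (MSM_integrand \<alpha> \<alpha>' \<beta> \<beta>' \<gamma> f x)"
    by (simp add: Gf set_integrable_def)
  have "(LINT t:{0<..<x}|lborel. MSM_integrand \<alpha> \<alpha>' \<beta> \<beta>' \<gamma> f x t) = (LINT t|lborel. LINT \<tau>|lborel. G t \<tau>)"
    by (simp add: Gf set_lebesgue_integral_def)
  also have "\<dots> = (LINT \<tau>|lborel. LINT t|lborel. G t \<tau>)"
    by (rule lborel_pair.Fubini_integral[OF GI, symmetric])
  also have "\<dots> = (LINT \<tau>|lborel. Gamma \<gamma> * (Y \<tau> * (MSM_multiplier \<alpha> \<alpha>' \<beta> \<beta>' \<gamma> (w \<tau>) * of_real x powr (\<gamma> + w \<tau> - 1 - \<alpha>'))))"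
  proof (rule Bochner_Integration.integral_cong[OF refl])
    fix \<tau>
    have w': "Re (w \<tau>) > F3_exponent \<alpha> \<alpha>' \<beta> \<beta>' \<gamma>" using \<rho> by (simp add: w)
    have "(LINT t|lborel. G t \<tau>) = Y \<tau> * (LINT t|lborel. K t * of_real t powr (w \<tau> - 1))"
      unfolding G by (rule integral_mult_right_zero)
    thus "(LINT t|lborel. G t \<tau>) = Gamma \<gamma> * (Y \<tau> * (MSM_multiplier \<alpha> \<alpha>' \<beta> \<beta>' \<gamma> (w \<tau>) * of_real x powr (\<gamma> + w \<tau> - 1 - \<alpha>')))"
      unfolding KV[OF w'] by (simp only: mult_ac)
  qed
  also have "\<dots> = Gamma \<gamma> * (LINT \<tau>|lborel. Y \<tau> * (MSM_multiplier \<alpha> \<alpha>' \<beta> \<beta>' \<gamma> (w \<tau>) * of_real x powr (\<gamma> + w \<tau> - 1 - \<alpha>')))"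
    by (rule integral_mult_right_zero)
  finally have I: "(LINT t:{0<..<x}|lborel. MSM_integrand \<alpha> \<alpha>' \<beta> \<beta>' \<gamma> f x t) = 
     Gamma \<gamma> * (LINT \<tau>|lborel. Y \<tau> * (MSM_multiplier \<alpha> \<alpha>' \<beta> \<beta>' \<gamma> (w \<tau>) * of_real x powr (\<gamma> + w \<tau> - 1 - \<alpha>')))" .
  have "MSM_integral \<alpha> \<alpha>' \<beta> \<beta>' \<gamma> f x = of_real x powr (- \<alpha>) * 
     (LINT \<tau>|lborel. Y \<tau> * (MSM_multiplier \<alpha> \<alpha>' \<beta> \<beta>' \<gamma> (w \<tau>) * of_real x powr (\<gamma> + w \<tau> - 1 - \<alpha>')))"
    unfolding MSM_integral_def I using Gamma_nonzero_Re_pos[OF \<gamma>] by simp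
  also have "\<dots> = (LINT \<tau>|lborel. of_real x powr (- \<alpha>) * (Y \<tau> * (MSM_multiplier \<alpha> \<alpha>' \<beta> \<beta>' \<gamma> (w \<tau>) * of_real x powr (\<gamma> + w \<tau> - 1 - \<alpha>'))))"
    by (rule integral_mult_right_zero[symmetric])
  also have "\<dots> = (LINT \<tau>|lborel. Y \<tau> * MSM_multiplier \<alpha> \<alpha>' \<beta> \<beta>' \<gamma> (w \<tau>) * of_real x powr (\<gamma> + \<rho> - 1 - \<alpha> - \<alpha>' - \<i> * of_real (\<mu> * \<tau>)))"
  proof (rule Bochner_Integration.integral_cong[OF refl])
    fix \<tau>
    have "of_real x powr (- \<alpha>) * of_real x powr (\<gamma> + w \<tau> - 1 - \<alpha>') = of_real x powr (\<gamma> + \<rho> - 1 - \<alpha> - \<alpha>' - \<i> * of_real (\<mu> * \<tau>))"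
      by (simp only: powr_add[symmetric]) (simp add: w_def algebra_simps)
    note pw = this
    have "of_real x powr (- \<alpha>) * (Y \<tau> * (MSM_multiplier \<alpha> \<alpha>' \<beta> \<beta>' \<gamma> (w \<tau>) * of_real x powr (\<gamma> + w \<tau> - 1 - \<alpha>'))) =
       Y \<tau> * MSM_multiplier \<alpha> \<alpha>' \<beta> \<beta>' \<gamma> (w \<tau>) * (of_real x powr (- \<alpha>) * of_real x powr (\<gamma> + w \<tau> - 1 - \<alpha>'))"
      by (simp only: mult_ac)
    thus "of_real x powr (- \<alpha>) * (Y \<tau> * (MSM_multiplier \<alpha> \<alpha>' \<beta> \<beta>' \<gamma> (w \<tau>) * of_real x powr (\<gamma> + w \<tau> - 1 - \<alpha>'))) =
       Y \<tau> * MSM_multiplier \<alpha> \<alpha>' \<beta> \<beta>' \<gamma> (w \<tau>) * of_real x powr (\<gamma> + \<rho> - 1 - \<alpha> - \<alpha>' - \<i> * of_real (\<mu> * \<tau>))"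
      by (simp only: pw)
  qed
  finally show "MSM_integral \<alpha> \<alpha>' \<beta> \<beta>' \<gamma> f x =
      (LINT \<tau>|lborel. Y \<tau> * MSM_multiplier \<alpha> \<alpha>' \<beta> \<beta>' \<gamma> (\<rho> - \<i> * of_real (\<mu> * \<tau>)) *
         of_real x powr (\<gamma> + \<rho> - 1 - \<alpha> - \<alpha>' - \<i> * of_real (\<mu> * \<tau>)))" by (simp add: w_def)
qed

section \<open>The MSM derivative of the I-function\<close>

lemma Gamma_vertical_growth:
  assumes "Re c > 0" "D > 0"
  shows "vertical_growth (\<lambda>\<tau>. Gamma (c - \<i> * of_real (D * \<tau>))) (Re c - 1/2) (pi / 2 * D)"
proof -
  have c: "Re c \<notin> \<int>\<^sub>\<le>\<^sub>0" using assms by (auto elim!: nonpos_Ints_cases)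
  have eq: "c + of_real (- D) * (\<i> * of_real \<tau>) = c - \<i> * of_real (D * \<tau>)" for \<tau> by (simp add: mult_ac)
  have np: "c - \<i> * of_real (D * \<tau>) \<notin> \<int>\<^sub>\<le>\<^sub>0" for \<tau> 
    using nonpos_Int_Re_le[of "c - \<i> * of_real (D * \<tau>)"] assms by auto
  have "continuous_on UNIV (\<lambda>\<tau>. Gamma (c - \<i> * of_real (D * \<tau>)))"
    by (rule continuous_on_compose2[OF holomorphic_on_imp_continuous_on[OF holomorphic_Gamma[of "- \<int>\<^sub>\<le>\<^sub>0"]]])
       (use np in \<open>auto intro!: continuous_intros\<close>)
  hence "(\<lambda>\<tau>. Gamma (c - \<i> * of_real (D * \<tau>))) \<in> borel_measurable borel"
    by (rule borel_measurable_continuous_onI)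
  moreover have "\<exists>C>0. \<forall>\<tau>. cmod (Gamma (c - \<i> * of_real (D * \<tau>))) \<le> C * vertical_bound (Re c - 1/2) (pi / 2 * D) \<tau>"
    using Gamma_on_line[of "- D" c] c assms unfolding eq by simp
  ultimately show ?thesis by (simp add: vertical_growth_def)
qed

lemma rGamma_vertical_growth:
  assumes "D > 0"
  shows "vertical_growth (\<lambda>\<tau>. rGamma (c - \<i> * of_real (D * \<tau>))) (1/2 - Re c) (- (pi / 2 * D))"
proof -
  have eq: "c + of_real (- D) * (\<i> * of_real \<tau>) = c - \<i> * of_real (D * \<tau>)" for \<tau> by (simp add: mult_ac)
  have "continuous_on UNIV (\<lambda>\<tau>. rGamma (c - \<i> * of_real (D * \<tau>)))"
    by (rule continuous_on_compose2[OF holomorphic_on_imp_continuous_on[OF holomorphic_rGamma[of UNIV]]])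
       (auto intro!: continuous_intros)
  hence "(\<lambda>\<tau>. rGamma (c - \<i> * of_real (D * \<tau>))) \<in> borel_measurable borel"
    by (rule borel_measurable_continuous_onI)
  moreover have "\<exists>C>0. \<forall>\<tau>. cmod (rGamma (c - \<i> * of_real (D * \<tau>))) \<le> C * vertical_bound (1/2 - Re c) (- (pi / 2 * D)) \<tau>"
    using rGamma_on_line[of "- D" c] assms unfolding eq by simp
  ultimately show ?thesis by (simp add: vertical_growth_def)
qed

text \<open>All six factors run along vertical lines with the same speed: the exponentials cancel, and the
  powers combine to \<open>- Re \<gamma>\<close>.\<close>

lemma vertical_growth_MSM_multiplier:
  assumes \<rho>: "Re \<rho> > F3_exponent \<alpha> \<alpha>' \<beta> \<beta>' \<gamma>" and \<mu>: "\<mu> > 0"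
  shows "vertical_growth (\<lambda>\<tau>. MSM_multiplier \<alpha> \<alpha>' \<beta> \<beta>' \<gamma> (\<rho> - \<i> * of_real (\<mu> * \<tau>))) (- Re \<gamma>) 0"
proof -
  have re: "Re \<rho> > 0" "Re (\<rho> + \<beta>' - \<alpha>') > 0" "Re (\<rho> + \<gamma> - \<alpha> - \<alpha>' - \<beta>) > 0"
    using \<rho> by (auto simp: F3_exponent_def)
  note G = Gamma_vertical_growth[OF _ \<mu>] and R = rGamma_vertical_growth[OF \<mu>]
  note * = vertical_growth_mult[OF vertical_growth_mult[OF vertical_growth_mult[OF vertical_growth_mult[OF vertical_growth_mult[OF
     G[OF re(1)] G[OF re(2)]] G[OF re(3)]] R[of "\<rho> + \<beta>'"]] R[of "\<rho> + \<gamma> - \<alpha> - \<alpha>'"]] R[of "\<rho> + \<gamma> - \<alpha>' - \<beta>"]]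
  have p: "Re \<rho> - 1/2 + (Re (\<rho> + \<beta>' - \<alpha>') - 1/2) + (Re (\<rho> + \<gamma> - \<alpha> - \<alpha>' - \<beta>) - 1/2) + (1/2 - Re (\<rho> + \<beta>')) +
      (1/2 - Re (\<rho> + \<gamma> - \<alpha> - \<alpha>')) + (1/2 - Re (\<rho> + \<gamma> - \<alpha>' - \<beta>)) = - Re \<gamma>"
    by simp
  have q: "pi / 2 * \<mu> + pi / 2 * \<mu> + pi / 2 * \<mu> + - (pi / 2 * \<mu>) + - (pi / 2 * \<mu>) + - (pi / 2 * \<mu>) = 0" by simp
  have f: "(\<lambda>\<tau>. MSM_multiplier \<alpha> \<alpha>' \<beta> \<beta>' \<gamma> (\<rho> - \<i> * of_real (\<mu> * \<tau>))) = 
     (\<lambda>\<tau>. Gamma (\<rho> - \<i> * of_real (\<mu> * \<tau>)) * Gamma (\<rho> + \<beta>' - \<alpha>' - \<i> * of_real (\<mu> * \<tau>)) *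
       Gamma (\<rho> + \<gamma> - \<alpha> - \<alpha>' - \<beta> - \<i> * of_real (\<mu> * \<tau>)) * rGamma (\<rho> + \<beta>' - \<i> * of_real (\<mu> * \<tau>)) *
       rGamma (\<rho> + \<gamma> - \<alpha> - \<alpha>' - \<i> * of_real (\<mu> * \<tau>)) * rGamma (\<rho> + \<gamma> - \<alpha>' - \<beta> - \<i> * of_real (\<mu> * \<tau>)))"
    unfolding MSM_multiplier_def by (rule ext) (simp add: algebra_simps)
  show ?thesis using * unfolding f p q .
qed

definition falling_product :: "complex \<Rightarrow> nat \<Rightarrow> complex" where
  "falling_product z k = (\<Prod>j<k. z - of_nat j)"

lemma vertical_growth_falling_product:
  "vertical_growth (\<lambda>\<tau>. falling_product (c - \<i> * of_real (\<mu> * \<tau>)) k) (real k) 0"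
proof (induction k)
  case 0
  show ?case using vertical_growth_const[of 1] by (simp add: falling_product_def)
next
  case (Suc k)
  have "vertical_growth (\<lambda>\<tau>. (c - of_nat k) + (- \<i> * of_real \<mu>) * of_real \<tau>) 1 0"
    by (rule vertical_growth_linear)
  from vertical_growth_mult[OF Suc this] show ?case
    by (simp add: falling_product_def algebra_simps)
qed

text \<open>The linear factors from \<open>N\<close> differentiations bring the reciprocal Gamma function back by \<open>N\<close> steps.\<close>

lemma falling_product_rGamma:
  "falling_product (w + of_nat N - 1) N * rGamma (w + of_nat N) = rGamma w"
proof -
  have "falling_product (w + of_nat N - 1) N = pochhammer w N"
  proof -
    have "(\<Prod>j<N. w + of_nat N - 1 - of_nat j) = (\<Prod>j<N. w + of_nat j)"
      by (rule prod.reindex_bij_witness[of _ "\<lambda>j. N - 1 - j" "\<lambda>j. N - 1 - j"]) (auto simp: of_nat_diff)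
    thus ?thesis by (simp add: falling_product_def pochhammer_prod atLeast0LessThan)
  qed
  thus ?thesis by (simp add: pochhammer_rGamma[of w N])
qed

theorem iter_deriv_LINT_powr:
  fixes Z :: "real \<Rightarrow> complex" and s :: complex and \<mu> :: real
  assumes Z: "\<And>k. k \<le> N \<Longrightarrow> integrable lborel (\<lambda>\<tau>. Z \<tau> * falling_product (s - \<i> * of_real (\<mu> * \<tau>)) k)"
      and g: "\<And>x. x > 0 \<Longrightarrow> g x = (LINT \<tau>|lborel. Z \<tau> * of_real x powr (s - \<i> * of_real (\<mu> * \<tau>)))"
  shows "k \<le> N \<Longrightarrow> x > 0 \<Longrightarrow> iter_deriv k g x = 
           (LINT \<tau>|lborel. Z \<tau> * falling_product (s - \<i> * of_real (\<mu> * \<tau>)) k * of_real x powr (s - \<i> * of_real (\<mu> * \<tau>) - of_nat k))"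
    and "k < N \<Longrightarrow> x > 0 \<Longrightarrow> iter_deriv k g differentiable at x"
proof -
  define F where "F = (\<lambda>k x. LINT \<tau>|lborel. Z \<tau> * falling_product (s - \<i> * of_real (\<mu> * \<tau>)) k * of_real x powr (s - \<i> * of_real (\<mu> * \<tau>) - of_nat k))"
  have der: "(F k has_vector_derivative F (Suc k) x) (at x)" if "k < N" "x > 0" for k x
  proof -
    let ?w = "\<lambda>\<tau>. s - \<i> * of_real (\<mu> * \<tau>) - of_nat k"
    have fp: "falling_product (s - \<i> * of_real (\<mu> * \<tau>)) (Suc k) = falling_product (s - \<i> * of_real (\<mu> * \<tau>)) k * ?w \<tau>" for \<tau>
      by (simp add: falling_product_def)
    have e: "?w \<tau> - 1 = s - \<i> * of_real (\<mu> * \<tau>) - of_nat (Suc k)" for \<tau> by simp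
    have "((\<lambda>x. LINT \<tau>|lborel. (Z \<tau> * falling_product (s - \<i> * of_real (\<mu> * \<tau>)) k) * of_real x powr ?w \<tau>) has_vector_derivative
       (LINT \<tau>|lborel. (Z \<tau> * falling_product (s - \<i> * of_real (\<mu> * \<tau>)) k) * ?w \<tau> * of_real x powr (?w \<tau> - 1))) (at x)"
    proof (rule LINT_powr_has_vector_derivative)
      show "integrable lborel (\<lambda>\<tau>. Z \<tau> * falling_product (s - \<i> * of_real (\<mu> * \<tau>)) k)" using Z that by simp
      show "integrable lborel (\<lambda>\<tau>. Z \<tau> * falling_product (s - \<i> * of_real (\<mu> * \<tau>)) k * ?w \<tau>)"
        using Z[of "Suc k"] that unfolding fp by (simp only: mult.assoc)
      show "Re (?w \<tau>) = Re s - k" for \<tau> by simp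
    qed (use that in auto)
    thus ?thesis unfolding F_def fp e[symmetric] by (simp only: mult.assoc)
  qed
  have main: "iter_deriv k g x = F k x" if "k \<le> N" "x > 0" for k x
    using that
  proof (induction k arbitrary: x)
    case 0
    thus ?case by (simp add: iter_deriv_def F_def falling_product_def g)
  next
    case (Suc k)
    have "(iter_deriv k g has_vector_derivative F (Suc k) x) (at x)"
    proof (rule has_vector_derivative_transform_within_open[OF der])
      show "F k y = iter_deriv k g y" if "y \<in> {0<..}" for y using Suc.IH[of y] Suc.prems that by simp
    qed (use Suc.prems in auto)
    hence "vector_derivative (iter_deriv k g) (at x) = F (Suc k) x" by (rule vector_derivative_at)
    thus ?case by (simp add: iter_deriv_def)
  qed
  thus "k \<le> N \<Longrightarrow> x > 0 \<Longrightarrow> iter_deriv k g x = 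
           (LINT \<tau>|lborel. Z \<tau> * falling_product (s - \<i> * of_real (\<mu> * \<tau>)) k * of_real x powr (s - \<i> * of_real (\<mu> * \<tau>) - of_nat k))"
    by (simp add: F_def)
  assume k: "k < N" "x > 0"
  have "(iter_deriv k g has_vector_derivative F (Suc k) x) (at x)"
  proof (rule has_vector_derivative_transform_within_open[OF der])
    show "F k y = iter_deriv k g y" if "y \<in> {0<..}" for y using main[of k y] k that by simp
  qed (use k in auto)
  thus "iter_deriv k g differentiable at x" by (rule differentiableI_vector)
qed

text \<open>The new triples have exponent \<open>1\<close>, and so their factors are values of \<open>\<Gamma>\<close> itself, whatever the
  branch. A new denominator factor with a pole makes both sides \<open>0\<close>.\<close>

lemma I_chi_extended:
  fixes \<Lambda> :: "complex \<Rightarrow> real \<Rightarrow> real \<Rightarrow> complex \<Rightarrow> complex"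
  assumes \<Lambda>: "Gamma_branch \<Lambda>" and s: "Re s = 0" and m: "m \<le> length ls"
  shows "I_chi \<Lambda> m (n + 3) ([(a1, \<mu>, 1), (a2, \<mu>, 1), (a3, \<mu>, 1)] @ us) (ls @ [(b1, \<mu>, 1), (b2, \<mu>, 1), (b3, \<mu>, 1)]) s =
     I_chi \<Lambda> m n us ls s *
     (Gamma (1 - a1 - of_real \<mu> * s) * Gamma (1 - a2 - of_real \<mu> * s) * Gamma (1 - a3 - of_real \<mu> * s) *
      rGamma (1 - b1 - of_real \<mu> * s) * rGamma (1 - b2 - of_real \<mu> * s) * rGamma (1 - b3 - of_real \<mu> * s))"
proof -
  have g: "Gamma_pow \<Lambda> (1 - c) (- \<mu>) 1 s = Gamma (1 - c - of_real \<mu> * s)" for c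
    by (simp add: Gamma_pow_eq_Gamma[OF \<Lambda> s])
  have n3: "n + 3 = Suc (Suc (Suc n))" by simp
  show ?thesis unfolding I_chi_def n3 using m
    by (simp add: g rGamma_inverse_Gamma divide_inverse mult_ac)
qed

text \<open>The integrand of the I-function at the argument \<open>a\<close>, with the factor \<open>\<i> / (2\<pi>\<i>)\<close> of the contour
  integral included.\<close>

definition I_density ::
  "(complex \<Rightarrow> real \<Rightarrow> real \<Rightarrow> complex \<Rightarrow> complex) \<Rightarrow> nat \<Rightarrow> nat \<Rightarrow> triple list \<Rightarrow> triple list \<Rightarrow>
     complex \<Rightarrow> real \<Rightarrow> real \<Rightarrow> complex" where
  "I_density \<Lambda> m n us ls a \<theta> \<tau> = of_real (1 / (2 * pi)) *
     (I_chi \<Lambda> m n us ls (\<i> * of_real \<tau>) * exp (- (\<i> * of_real \<tau>) * (of_real (ln (cmod a)) + \<i> * of_real \<theta>)))"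

lemma I_fun_eq_LINT_density:
  assumes a: "a \<noteq> 0" and t: "t > 0"
  shows "I_fun \<Lambda> m n us ls (a * of_real (t powr \<mu>)) \<theta> =
     (LINT \<tau>|lborel. I_density \<Lambda> m n us ls a \<theta> \<tau> * of_real t powr (- (\<i> * of_real (\<mu> * \<tau>))))"
proof -
  have l: "ln (cmod (a * of_real (t powr \<mu>))) = ln (cmod a) + \<mu> * ln t"
    using a t by (simp add: norm_mult ln_mult ln_powr)
  have "I_fun \<Lambda> m n us ls (a * of_real (t powr \<mu>)) \<theta> = (LINT \<tau>|lborel. 1 / (2 * of_real pi * \<i>) *
     (I_chi \<Lambda> m n us ls (\<i> * of_real \<tau>) *
        exp (- (\<i> * of_real \<tau>) * (of_real (ln (cmod a) + \<mu> * ln t) + \<i> * of_real \<theta>)) * \<i>))"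
    unfolding I_fun_def l by (rule integral_mult_right_zero[symmetric])
  also have "\<dots> = (LINT \<tau>|lborel. I_density \<Lambda> m n us ls a \<theta> \<tau> * of_real t powr (- (\<i> * of_real (\<mu> * \<tau>))))"
  proof (rule Bochner_Integration.integral_cong[OF refl])
    fix \<tau> :: real
    have "exp (- (\<i> * of_real \<tau>) * (of_real (ln (cmod a) + \<mu> * ln t) + \<i> * of_real \<theta>)) =
       exp (- (\<i> * of_real \<tau>) * (of_real (ln (cmod a)) + \<i> * of_real \<theta>)) * of_real t powr (- (\<i> * of_real (\<mu> * \<tau>)))"
      unfolding of_real_powr_eq_exp[OF t] exp_add[symmetric] by (simp add: algebra_simps)
    thus "1 / (2 * of_real pi * \<i>) * (I_chi \<Lambda> m n us ls (\<i> * of_real \<tau>) *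
        exp (- (\<i> * of_real \<tau>) * (of_real (ln (cmod a) + \<mu> * ln t) + \<i> * of_real \<theta>)) * \<i>) = 
       I_density \<Lambda> m n us ls a \<theta> \<tau> * of_real t powr (- (\<i> * of_real (\<mu> * \<tau>)))"
      by (simp add: I_density_def)
  qed
  finally show ?thesis .
qed

lemma vertical_growth_I_density:
  assumes "Gamma_branch \<Lambda>" "I_admissible m n us ls \<theta>"
  shows "vertical_growth (I_density \<Lambda> m n us ls a \<theta>) (I_Omega us ls) (pi / 2 * I_Delta m n us ls - \<bar>\<theta>\<bar>)"
proof -
  note * = vertical_growth_mult[OF vertical_growth_const[of "of_real (1 / (2 * pi))"]
     vertical_growth_mult[OF vertical_growth_I_chi[OF assms] vertical_growth_exp[of "ln (cmod a)" \<theta>]]]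
  have p: "0 + (I_Omega us ls + 0) = I_Omega us ls" 
    and q: "0 + (pi / 2 * I_Delta m n us ls + - \<bar>\<theta>\<bar>) = pi / 2 * I_Delta m n us ls - \<bar>\<theta>\<bar>" by simp_all
  show ?thesis using * unfolding p q I_density_def[abs_def] .
qed

lemma I_Omega_extended:
  "I_Omega ([(a1, \<mu>, 1), (a2, \<mu>, 1), (a3, \<mu>, 1)] @ us) (ls @ [(b1, \<mu>, 1), (b2, \<mu>, 1), (b3, \<mu>, 1)]) =
     I_Omega us ls + Re (b1 + b2 + b3 - a1 - a2 - a3)"
  by (simp add: I_Omega_def)

lemma I_Delta_extended:
  assumes "m \<le> length ls"
  shows "I_Delta m (n + 3) ([(a1, \<mu>, 1), (a2, \<mu>, 1), (a3, \<mu>, 1)] @ us) (ls @ [(b1, \<mu>, 1), (b2, \<mu>, 1), (b3, \<mu>, 1)]) =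
     I_Delta m n us ls"
proof -
  have n3: "n + 3 = Suc (Suc (Suc n))" by simp
  show ?thesis unfolding I_Delta_def n3 using assms by simp
qed

text \<open>The multiplier of the MSM integral that occurs in the MSM derivative contains \<open>N\<close> in three of its
  Gamma factors; it drops out of two of them by itself and is removed from the third by the derivatives.\<close>

lemma MSM_multiplier_falling_product:
  fixes \<alpha> \<alpha>' \<beta> \<beta>' \<gamma> \<rho> :: complex and N :: nat
  shows "MSM_multiplier (- \<alpha>') (- \<alpha>) (- \<beta>' + of_nat N) (- \<beta>) (- \<gamma> + of_nat N) \<rho> *
           falling_product (\<rho> + \<alpha> + \<alpha>' - \<gamma> + of_nat N - 1) N =
         Gamma \<rho> * Gamma (\<rho> + \<alpha> - \<beta>) * Gamma (\<rho> + \<alpha> + \<alpha>' + \<beta>' - \<gamma>) *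
         rGamma (\<rho> - \<beta>) * rGamma (\<rho> + \<alpha> + \<alpha>' - \<gamma>) * rGamma (\<rho> + \<alpha> + \<beta>' - \<gamma>)"
proof -
  have 1: "\<rho> - \<beta> - - \<alpha> = \<rho> + \<alpha> - \<beta>"
    and 2: "\<rho> + \<alpha> + \<alpha>' - \<gamma> + of_nat N - (- \<beta>' + of_nat N) = \<rho> + \<alpha> + \<alpha>' + \<beta>' - \<gamma>"
    and 3: "\<rho> + - \<beta> = \<rho> - \<beta>"
    and 4: "\<rho> + (- \<gamma> + of_nat N) - - \<alpha>' - - \<alpha> = \<rho> + \<alpha> + \<alpha>' - \<gamma> + of_nat N"
    and 5: "\<rho> + (- \<gamma> + of_nat N) - - \<alpha> - (- \<beta>' + of_nat N) = \<rho> + \<alpha> + \<beta>' - \<gamma>"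
    by simp_all
  show ?thesis
    unfolding MSM_multiplier_def 5 2 4 1 3
      falling_product_rGamma[of "\<rho> + \<alpha> + \<alpha>' - \<gamma>" N, symmetric]
    by (simp only: mult_ac)
qed

theorem theorem4p1:
  fixes \<alpha> \<alpha>' \<beta> \<beta>' \<gamma> \<rho> a :: complex and \<mu> \<theta> :: real
    and m n :: nat and us ls U L :: "triple list"
    and \<Lambda> :: "complex \<Rightarrow> real \<Rightarrow> real \<Rightarrow> complex \<Rightarrow> complex"
    and f :: "real \<Rightarrow> complex"
  defines "U \<equiv> [(1 - \<rho>, \<mu>, 1), (1 - \<alpha> + \<beta> - \<rho>, \<mu>, 1),
                (1 - \<alpha> - \<alpha>' - \<beta>' + \<gamma> - \<rho>, \<mu>, 1)] @ us"
    and "L \<equiv> ls @ [(1 + \<beta> - \<rho>, \<mu>, 1), (1 - \<alpha> - \<alpha>' + \<gamma> - \<rho>, \<mu>, 1),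
                (1 - \<alpha> - \<beta>' + \<gamma> - \<rho>, \<mu>, 1)]"
    and "f \<equiv> \<lambda>t. of_real t powr (\<rho> - 1) * I_fun \<Lambda> m n us ls (a * of_real (t powr \<mu>)) \<theta>"
  assumes "Re \<gamma> > 0" and "a \<noteq> 0" and "\<mu> > 0"
    and "Re \<rho> > Max {0, Re (- \<alpha> + \<beta>), Re (- \<alpha> - \<alpha>' - \<beta>' + \<gamma>)}"
    and "a = rcis (cmod a) \<theta>"
    and "Gamma_branch \<Lambda>"
    and "I_admissible m n us ls \<theta>"
    and "I_admissible m (n + 3) U L \<theta>"
  shows "MSM_derivative_exists \<alpha> \<alpha>' \<beta> \<beta>' \<gamma> f \<and>
    (\<forall>x>0. MSM_derivative \<alpha> \<alpha>' \<beta> \<beta>' \<gamma> f x =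
       of_real x powr (\<alpha> + \<alpha>' - \<gamma> + \<rho> - 1) *
       I_fun \<Lambda> m (n + 3) U L (a * of_real (x powr \<mu>)) \<theta>)"
proof -
  note a = \<open>a \<noteq> 0\<close> and \<mu> = \<open>\<mu> > 0\<close> and \<Lambda> = \<open>Gamma_branch \<Lambda>\<close>
    and adm = \<open>I_admissible m n us ls \<theta>\<close> and adm' = \<open>I_admissible m (n + 3) U L \<theta>\<close>
  have m: "m \<le> length ls" using adm by (simp add: I_admissible_def)
  define N where "N = MSM_order \<gamma>"
  have N: "Re (- \<gamma> + of_nat N) > 0"
  proof -
    have "real N = of_int (\<lfloor>Re \<gamma>\<rfloor> + 1)"
      unfolding N_def MSM_order_def using \<open>Re \<gamma> > 0\<close> by (intro of_nat_nat) (simp add: less_imp_le add_nonneg_pos)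
    moreover have "Re \<gamma> < of_int (\<lfloor>Re \<gamma>\<rfloor> + 1)" by linarith
    ultimately show ?thesis by simp
  qed
  have \<rho>: "Re \<rho> > F3_exponent (- \<alpha>') (- \<alpha>) (- \<beta>' + of_nat N) (- \<beta>) (- \<gamma> + of_nat N)"
    using \<open>Re \<rho> > Max _\<close> by (simp add: F3_exponent_def)
  define Y where "Y = I_density \<Lambda> m n us ls a \<theta>"
  define w where "w = (\<lambda>\<tau>. \<rho> - \<i> * of_real (\<mu> * \<tau>))"
  define M where "M = (\<lambda>\<tau>. MSM_multiplier (- \<alpha>') (- \<alpha>) (- \<beta>' + of_nat N) (- \<beta>) (- \<gamma> + of_nat N) (\<rho> - \<i> * of_real (\<mu> * \<tau>)))"
  define s where "s = - \<gamma> + of_nat N + \<rho> - 1 - - \<alpha>' - - \<alpha>"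
  define g where "g = MSM_integral (- \<alpha>') (- \<alpha>) (- \<beta>' + of_nat N) (- \<beta>) (- \<gamma> + of_nat N) f"
  have Omega: "I_Omega U L = I_Omega us ls + Re \<gamma>"
    unfolding U_def L_def I_Omega_extended by simp
  have Delta: "I_Delta m (n + 3) U L = I_Delta m n us ls"
    unfolding U_def L_def by (rule I_Delta_extended[OF m])
  have conv: "I_convergence m (n + 3) U L 0 \<theta>" using adm' by (simp add: I_admissible_def)
  have growY: "vertical_growth Y (I_Omega us ls) (pi / 2 * I_Delta m n us ls - \<bar>\<theta>\<bar>)"
    unfolding Y_def by (rule vertical_growth_I_density[OF \<Lambda> adm])
  have growM: "vertical_growth M (- Re (- \<gamma> + of_nat N)) 0"
    unfolding M_def by (rule vertical_growth_MSM_multiplier[OF \<rho> \<mu>])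
  \<comment> \<open>The convergence condition for the I-function on the right-hand side is exactly what the \<open>N\<close>-th derivative
    needs; the MSM integral and the lower derivatives have slower growth.\<close>
  have integrable: "integrable lborel h" if "vertical_growth h p (pi / 2 * I_Delta m n us ls - \<bar>\<theta>\<bar>)" "p \<le> I_Omega us ls + Re \<gamma>" for h p
    by (rule I_convergence_integrable[OF conv]) (use vertical_growth_mono[OF that] in \<open>simp only: Omega Delta\<close>)
  have Y: "integrable lborel Y" by (rule integrable[OF growY]) (use \<open>Re \<gamma> > 0\<close> in simp)
  have Z: "integrable lborel (\<lambda>\<tau>. Y \<tau> * M \<tau> * falling_product (s - \<i> * of_real (\<mu> * \<tau>)) k)" if "k \<le> N" for k
  proof (rule integrable)
    have "vertical_growth (\<lambda>\<tau>. Y \<tau> * M \<tau> * falling_product (s - \<i> * of_real (\<mu> * \<tau>)) k) 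
       (I_Omega us ls + - Re (- \<gamma> + of_nat N) + real k) (pi / 2 * I_Delta m n us ls - \<bar>\<theta>\<bar> + 0 + 0)"
      by (intro vertical_growth_mult growY growM vertical_growth_falling_product)
    thus "vertical_growth (\<lambda>\<tau>. Y \<tau> * M \<tau> * falling_product (s - \<i> * of_real (\<mu> * \<tau>)) k) 
       (I_Omega us ls + - Re (- \<gamma> + of_nat N) + real k) (pi / 2 * I_Delta m n us ls - \<bar>\<theta>\<bar>)" by simp
    show "I_Omega us ls + - Re (- \<gamma> + of_nat N) + real k \<le> I_Omega us ls + Re \<gamma>" using that by simp
  qed
  have f: "f t = (LINT \<tau>|lborel. Y \<tau> * of_real t powr (\<rho> - \<i> * of_real (\<mu> * \<tau>) - 1))" if t: "t > 0" for t
  proof -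
    have "f t = (LINT \<tau>|lborel. of_real t powr (\<rho> - 1) * (Y \<tau> * of_real t powr (- (\<i> * of_real (\<mu> * \<tau>)))))"
      unfolding f_def I_fun_eq_LINT_density[OF a t] Y_def by (rule integral_mult_right_zero[symmetric])
    also have "\<dots> = (LINT \<tau>|lborel. Y \<tau> * of_real t powr (\<rho> - \<i> * of_real (\<mu> * \<tau>) - 1))"
    proof (rule Bochner_Integration.integral_cong[OF refl])
      fix \<tau> :: real
      have "\<rho> - \<i> * of_real (\<mu> * \<tau>) - 1 = (\<rho> - 1) + - (\<i> * of_real (\<mu> * \<tau>))" by simp
      hence "complex_of_real t powr (\<rho> - \<i> * of_real (\<mu> * \<tau>) - 1) = of_real t powr (\<rho> - 1) * of_real t powr (- (\<i> * of_real (\<mu> * \<tau>)))"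
        by (simp only: powr_add)
      thus "of_real t powr (\<rho> - 1) * (Y \<tau> * of_real t powr (- (\<i> * of_real (\<mu> * \<tau>)))) = Y \<tau> * of_real t powr (\<rho> - \<i> * of_real (\<mu> * \<tau>) - 1)"
        by (simp only: mult_ac)
    qed
    finally show ?thesis .
  qed
  note super = MSM_integral_superposition[OF Y f N \<rho>]
  have g: "g x = (LINT \<tau>|lborel. (Y \<tau> * M \<tau>) * of_real x powr (s - \<i> * of_real (\<mu> * \<tau>)))" if "x > 0" for x
    unfolding g_def M_def s_def using super(2)[OF _ that] by simp
  note der = iter_deriv_LINT_powr[OF Z g]
  have "MSM_derivative_exists \<alpha> \<alpha>' \<beta> \<beta>' \<gamma> f"
    unfolding MSM_derivative_exists_def Let_def N_def[symmetric] g_def[symmetric]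
    using super(1) der(2) by blast
  moreover have "MSM_derivative \<alpha> \<alpha>' \<beta> \<beta>' \<gamma> f x = of_real x powr (\<alpha> + \<alpha>' - \<gamma> + \<rho> - 1) *
       I_fun \<Lambda> m (n + 3) U L (a * of_real (x powr \<mu>)) \<theta>" if x: "x > 0" for x
  proof -
    have "MSM_derivative \<alpha> \<alpha>' \<beta> \<beta>' \<gamma> f x = iter_deriv N g x"
      by (simp add: MSM_derivative_def Let_def N_def g_def)
    also have "\<dots> = (LINT \<tau>|lborel. Y \<tau> * M \<tau> * falling_product (s - \<i> * of_real (\<mu> * \<tau>)) N * 
        of_real x powr (s - \<i> * of_real (\<mu> * \<tau>) - of_nat N))"
      by (rule der(1)[OF _ _ order_refl x])
    also have "\<dots> = (LINT \<tau>|lborel. of_real x powr (\<alpha> + \<alpha>' - \<gamma> + \<rho> - 1) * 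
        (I_density \<Lambda> m (n + 3) U L a \<theta> \<tau> * of_real x powr (- (\<i> * of_real (\<mu> * \<tau>)))))"
    proof (rule Bochner_Integration.integral_cong[OF refl])
      fix \<tau> :: real
      have s1: "s - \<i> * of_real (\<mu> * \<tau>) = w \<tau> + \<alpha> + \<alpha>' - \<gamma> + of_nat N - 1" by (simp add: s_def w_def)
      have Mf: "M \<tau> * falling_product (s - \<i> * of_real (\<mu> * \<tau>)) N =
         Gamma (w \<tau>) * Gamma (w \<tau> + \<alpha> - \<beta>) * Gamma (w \<tau> + \<alpha> + \<alpha>' + \<beta>' - \<gamma>) *
         rGamma (w \<tau> - \<beta>) * rGamma (w \<tau> + \<alpha> + \<alpha>' - \<gamma>) * rGamma (w \<tau> + \<alpha> + \<beta>' - \<gamma>)"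
      proof -
        have "M \<tau> = MSM_multiplier (- \<alpha>') (- \<alpha>) (- \<beta>' + of_nat N) (- \<beta>) (- \<gamma> + of_nat N) (w \<tau>)"
          by (simp only: M_def w_def)
        thus ?thesis unfolding s1 by (simp only: MSM_multiplier_falling_product)
      qed
      have "s - \<i> * of_real (\<mu> * \<tau>) - of_nat N = (\<alpha> + \<alpha>' - \<gamma> + \<rho> - 1) + - (\<i> * of_real (\<mu> * \<tau>))" by (simp add: s_def)
      hence pw: "complex_of_real x powr (s - \<i> * of_real (\<mu> * \<tau>) - of_nat N) =
          of_real x powr (\<alpha> + \<alpha>' - \<gamma> + \<rho> - 1) * of_real x powr (- (\<i> * of_real (\<mu> * \<tau>)))"
        by (simp only: powr_add)
      have args:
        "1 - (1 - \<rho>) - of_real \<mu> * (\<i> * of_real \<tau>) = w \<tau>"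
        "1 - (1 - \<alpha> + \<beta> - \<rho>) - of_real \<mu> * (\<i> * of_real \<tau>) = w \<tau> + \<alpha> - \<beta>"
        "1 - (1 - \<alpha> - \<alpha>' - \<beta>' + \<gamma> - \<rho>) - of_real \<mu> * (\<i> * of_real \<tau>) = w \<tau> + \<alpha> + \<alpha>' + \<beta>' - \<gamma>"
        "1 - (1 + \<beta> - \<rho>) - of_real \<mu> * (\<i> * of_real \<tau>) = w \<tau> - \<beta>"
        "1 - (1 - \<alpha> - \<alpha>' + \<gamma> - \<rho>) - of_real \<mu> * (\<i> * of_real \<tau>) = w \<tau> + \<alpha> + \<alpha>' - \<gamma>"
        "1 - (1 - \<alpha> - \<beta>' + \<gamma> - \<rho>) - of_real \<mu> * (\<i> * of_real \<tau>) = w \<tau> + \<alpha> + \<beta>' - \<gamma>"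
        by (simp_all add: w_def)
      have re: "Re (\<i> * complex_of_real \<tau>) = 0" by simp
      have "I_chi \<Lambda> m (n + 3) U L (\<i> * of_real \<tau>) = I_chi \<Lambda> m n us ls (\<i> * of_real \<tau>) * (M \<tau> * falling_product (s - \<i> * of_real (\<mu> * \<tau>)) N)"
        unfolding U_def L_def I_chi_extended[OF \<Lambda> re m] args Mf ..
      hence "I_density \<Lambda> m (n + 3) U L a \<theta> \<tau> = Y \<tau> * M \<tau> * falling_product (s - \<i> * of_real (\<mu> * \<tau>)) N"
        unfolding I_density_def Y_def by (simp only: mult_ac)
      thus "Y \<tau> * M \<tau> * falling_product (s - \<i> * of_real (\<mu> * \<tau>)) N * of_real x powr (s - \<i> * of_real (\<mu> * \<tau>) - of_nat N) =
         of_real x powr (\<alpha> + \<alpha>' - \<gamma> + \<rho> - 1) * (I_density \<Lambda> m (n + 3) U L a \<theta> \<tau> * of_real x powr (- (\<i> * of_real (\<mu> * \<tau>))))"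
        unfolding pw by (simp only: mult_ac)
    qed
    also have "\<dots> = of_real x powr (\<alpha> + \<alpha>' - \<gamma> + \<rho> - 1) * 
        I_fun \<Lambda> m (n + 3) U L (a * of_real (x powr \<mu>)) \<theta>"
      unfolding I_fun_eq_LINT_density[OF a x] by (rule integral_mult_right_zero)
    finally show ?thesis .
  qed
  ultimately show ?thesis by blast
qed

end
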